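(* Let $p$ be a prime, let $S$ be a finite ordered set, and let $\mathrm{TL}=\{u^{\otimes p^k}\mid u\in\mathrm{Lyn}(S),\ k\ge0\}$. Let $\widehat{\mathrm{TL}}=\{\hat w\mid w\in\mathrm{TL}\}$ be a set of variables in bijection with $\mathrm{TL}$. Then, as $\mathbb{F}_p$-algebras, $$\mathrm{MS}_{\mathbb{F}_p,0}(S)\cong\mathbb{F}_p[\widehat{\mathrm{TL}}]/\langle\hat w^{\,p}\mid\hat w\in\widehat{\mathrm{TL}}\rangle=\bigotimes_{\hat w\in\widehat{\mathrm{TL}}}\Big(\mathbb{F}_p[\hat w]/\langle\hat w^{\,p}\rangle\Big),$$ where $\langle Y\rangle$ denotes the ideal generated by $Y$.
   Context: For a set $S$ and a commutative ring $\mathbf{k}$, $\mathrm{MS}_{\mathbf{k},0}(S)$ is the shuffle algebra on $S$: the free $\mathbf{k}$-module on the words $M^{\otimes}(S)=\{1\}\cup\{u_1\otimes\cdots\otimes u_r\mid u_i\in S,\ r\ge1\}$ with the shuffle product, i.e. the bilinear product with identity $1$ and $(a\otimes\mathfrak{a}')\diamond(b\otimes\mathfrak{b}')=a\otimes(\mathfrak{a}'\diamond(b\otimes\mathfrak{b}'))+b\otimes((a\otimes\mathfrak{a}')\diamond\mathfrak{b}')$ for letters $a,b$ and (possibly empty) words $\mathfrak{a}',\mathfrak{b}'$ (with $a\otimes1$ read as $a$). An ordered set is a totally ordered set. Lexicographic order on $M^{\otimes}(S)$: $u<v$ iff either $v=u\otimes x$ for a non-empty word $x$, or $u=x\otimes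 a\otimes u'$, $v=x\otimes b\otimes v'$ with words $x,u',v'$ and letters $a<b$. A Lyndon word is a non-empty word $w$ such that $w=u\otimes v$ with $u,v\ne1$ implies $w<v$. $\mathrm{Lyn}(S)$ is the set of Lyndon words. For a word $u$, $u^{\otimes k}$ is its $k$-fold concatenation power. *)

theory Defs
  imports
    "HOL-Algebra.Module"
    "HOL-Algebra.QuotRing"
    "HOL-Algebra.Product_Groups"
    "HOL-Number_Theory.Residues"
    "HOL-Library.Multiset"
begin

section \<open>Algebras over a commutative ring\<close>

definition alg_iso ::
  "('k, 'c) ring_scheme \<Rightarrow> ('k, 'a, 'd) module_scheme \<Rightarrow> ('k, 'b, 'e) module_scheme \<Rightarrow> ('a \<Rightarrow> 'b) set"
  where "alg_iso R A B =
    {h \<in> ring_iso A B. \<forall>c \<in> carrier R. \<forall>x \<in> carrier A. h (c \<odot>\<^bsub>A\<^esub> x) = c \<odot>\<^bsub>B\<^esub> h x}"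

text \<open>The quotient of an algebra by an ideal: the library's quotient ring, with the scalar
  multiplication on cosets written in the style of \<^const>\<open>rcoset_mult\<close>.\<close>

definition quot_algebra :: "('k, 'a, 'd) module_scheme \<Rightarrow> 'a set \<Rightarrow> ('k, 'a set) module"
  where "quot_algebra A I =
    \<lparr>carrier = carrier (A Quot I),
     monoid.mult = monoid.mult (A Quot I),
     one = one (A Quot I),
     zero = zero (A Quot I),
     add = add (A Quot I),
     smult = (\<lambda>c C. \<Union>x\<in>C. I +>\<^bsub>A\<^esub> (c \<odot>\<^bsub>A\<^esub> x))\<rparr>"

text \<open>The free \<open>R\<close>-module on a set \<open>B\<close> consists of the finitely supported functions from \<open>B\<close> to
  \<open>R\<close>, extended by zero outside \<open>B\<close>.  It is turned into an algebra by a unit \<open>e \<in> B\<close> and the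
  bilinear extension of a product \<open>m\<close> that is given on pairs of basis elements, where
  \<open>m u v w\<close> is the coefficient of \<open>w\<close> in the product of \<open>u\<close> and \<open>v\<close>.\<close>

definition free_gen :: "('k, 'c) ring_scheme \<Rightarrow> 'b \<Rightarrow> 'b \<Rightarrow> 'k"
  where "free_gen R b = (\<lambda>x. if x = b then \<one>\<^bsub>R\<^esub> else \<zero>\<^bsub>R\<^esub>)"

definition free_algebra ::
  "('k, 'c) ring_scheme \<Rightarrow> 'b set \<Rightarrow> 'b \<Rightarrow> ('b \<Rightarrow> 'b \<Rightarrow> 'b \<Rightarrow> 'k) \<Rightarrow> ('k, 'b \<Rightarrow> 'k) module"
  where "free_algebra R B e m =
    \<lparr>carrier = {f. (\<forall>x. f x \<in> carrier R) \<and> (\<forall>x. x \<notin> B \<longrightarrow> f x = \<zero>\<^bsub>R\<^esub>) \<and> finite {x. f x \<noteq> \<zero>\<^bsub>R\<^esub>}},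
     monoid.mult = (\<lambda>f g w. \<Oplus>\<^bsub>R\<^esub>u\<in>{u. f u \<noteq> \<zero>\<^bsub>R\<^esub>}. \<Oplus>\<^bsub>R\<^esub>v\<in>{v. g v \<noteq> \<zero>\<^bsub>R\<^esub>}.
        f u \<otimes>\<^bsub>R\<^esub> g v \<otimes>\<^bsub>R\<^esub> m u v w),
     one = free_gen R e,
     zero = (\<lambda>_. \<zero>\<^bsub>R\<^esub>),
     add = (\<lambda>f g w. f w \<oplus>\<^bsub>R\<^esub> g w),
     smult = (\<lambda>c f w. c \<otimes>\<^bsub>R\<^esub> f w)\<rparr>"

definition monoid_algebra ::
  "('k, 'c) ring_scheme \<Rightarrow> ('b, 'd) monoid_scheme \<Rightarrow> ('k, 'b \<Rightarrow> 'k) module"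
  where "monoid_algebra R M =
    free_algebra R (carrier M) \<one>\<^bsub>M\<^esub> (\<lambda>x y. free_gen R (x \<otimes>\<^bsub>M\<^esub> y))"


section \<open>The shuffle algebra\<close>

text \<open>Words over \<open>S\<close> are the lists in \<^term>\<open>lists S\<close>.  The function \<open>prepend R a\<close> is the linear
  extension of the map \<open>w \<mapsto> a # w\<close>.\<close>

definition prepend :: "('k, 'c) ring_scheme \<Rightarrow> 's \<Rightarrow> ('s list \<Rightarrow> 'k) \<Rightarrow> 's list \<Rightarrow> 'k"
  where "prepend R a f =
    (\<lambda>w. case w of [] \<Rightarrow> \<zero>\<^bsub>R\<^esub> | b # w' \<Rightarrow> if b = a then f w' else \<zero>\<^bsub>R\<^esub>)"

fun shuffle_words :: "('k, 'c) ring_scheme \<Rightarrow> 's list \<Rightarrow> 's list \<Rightarrow> 's list \<Rightarrow> 'k"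
  where
    "shuffle_words R [] v = free_gen R v"
  | "shuffle_words R (a # u) [] = free_gen R (a # u)"
  | "shuffle_words R (a # u) (b # v) =
       (\<lambda>w. prepend R a (shuffle_words R u (b # v)) w
          \<oplus>\<^bsub>R\<^esub> prepend R b (shuffle_words R (a # u) v) w)"

definition shuffle_algebra :: "('k, 'c) ring_scheme \<Rightarrow> 's set \<Rightarrow> ('k, 's list \<Rightarrow> 'k) module"
  where "shuffle_algebra R S = free_algebra R (lists S) [] (shuffle_words R)"


section \<open>Lyndon words\<close>

definition Lyn :: "'s::linorder set \<Rightarrow> 's list set"
  where "Lyn S = {w \<in> lists S. w \<noteq> [] \<and>
    (\<forall>u v. w = u @ v \<longrightarrow> u \<noteq> [] \<longrightarrow> v \<noteq> [] \<longrightarrow> (w, v) \<in> lexord {(a, b). a < b})}"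

definition TL :: "nat \<Rightarrow> 's::linorder set \<Rightarrow> 's list set"
  where "TL p S = {concat (replicate (p ^ k) u) | u k. u \<in> Lyn S}"


section \<open>Polynomial algebras\<close>

text \<open>As in HOL-Algebra's indexed polynomials, a monomial in the variables indexed by \<open>X\<close> is
  a multiset with support in \<open>X\<close>.\<close>

definition monomials :: "'x set \<Rightarrow> 'x multiset monoid"
  where "monomials X =
    \<lparr>carrier = {m. set_mset m \<subseteq> X}, monoid.mult = (+), one = {#}\<rparr>"

definition poly_algebra :: "('k, 'c) ring_scheme \<Rightarrow> 'x set \<Rightarrow> ('k, 'x multiset \<Rightarrow> 'k) module"
  where "poly_algebra R X = monoid_algebra R (monomials X)"

definition var :: "('k, 'c) ring_scheme \<Rightarrow> 'x \<Rightarrow> 'x multiset \<Rightarrow> 'k"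
  where "var R x = free_gen R {#x#}"

definition power_ideal :: "('k, 'c) ring_scheme \<Rightarrow> nat \<Rightarrow> 'x set \<Rightarrow> ('x multiset \<Rightarrow> 'k) set"
  where "power_ideal R p X =
    Idl\<^bsub>poly_algebra R X\<^esub> {var R x [^]\<^bsub>poly_algebra R X\<^esub> p | x. x \<in> X}"

definition truncated_poly ::
  "('k, 'c) ring_scheme \<Rightarrow> nat \<Rightarrow> 'x set \<Rightarrow> ('k, ('x multiset \<Rightarrow> 'k) set) module"
  where "truncated_poly R p X = quot_algebra (poly_algebra R X) (power_ideal R p X)"

definition truncated_var ::
  "('k, 'c) ring_scheme \<Rightarrow> nat \<Rightarrow> 'x set \<Rightarrow> 'x \<Rightarrow> ('x multiset \<Rightarrow> 'k) set"
  where "truncated_var R p X x = power_ideal R p X +>\<^bsub>poly_algebra R X\<^esub> var R x"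


section \<open>Tensor products of arbitrary families of algebras\<close>

text \<open>The tensor product of an infinite family of commutative \<open>R\<close>-algebras is the direct limit of
  the tensor products of its finite subfamilies, along the maps that insert \<open>1\<close> in the new factors.
  Concretely, it is spanned by the pure tensors of families almost all of whose entries are \<open>1\<close>,
  subject to linearity in each entry, with the entrywise product of pure tensors.  The span of
  the relations below is already closed under multiplication by pure tensors, so that the ideal
  generated by them is the submodule generated by them.\<close>

definition restricted_product :: "'i set \<Rightarrow> ('i \<Rightarrow> ('a, 'd) monoid_scheme) \<Rightarrow> ('i \<Rightarrow> 'a) monoid"
  where "restricted_product I A =
    (product_group I A)
      \<lparr>carrier := {x \<in> carrier (product_group I A). finite {i \<in> I. x i \<noteq> \<one>\<^bsub>A i\<^esub>}}\<rparr>"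

definition tensor_rels ::
  "('k, 'c) ring_scheme \<Rightarrow> 'i set \<Rightarrow> ('i \<Rightarrow> ('k, 'a, 'd) module_scheme) \<Rightarrow> (('i \<Rightarrow> 'a) \<Rightarrow> 'k) set"
  where "tensor_rels R I A =
    (let M = monoid_algebra R (restricted_product I A) in
      {free_gen R (x(i := a \<oplus>\<^bsub>A i\<^esub> b)) \<ominus>\<^bsub>M\<^esub>
         (free_gen R (x(i := a)) \<oplus>\<^bsub>M\<^esub> free_gen R (x(i := b))) | x i a b.
         x \<in> carrier (restricted_product I A) \<and> i \<in> I \<and> a \<in> carrier (A i) \<and> b \<in> carrier (A i)} \<union>
      {free_gen R (x(i := c \<odot>\<^bsub>A i\<^esub> a)) \<ominus>\<^bsub>M\<^esub> c \<odot>\<^bsub>M\<^esub> free_gen R (x(i := a)) | x i c a.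
         x \<in> carrier (restricted_product I A) \<and> i \<in> I \<and> c \<in> carrier R \<and> a \<in> carrier (A i)})"

definition tensor_ideal ::
  "('k, 'c) ring_scheme \<Rightarrow> 'i set \<Rightarrow> ('i \<Rightarrow> ('k, 'a, 'd) module_scheme) \<Rightarrow> (('i \<Rightarrow> 'a) \<Rightarrow> 'k) set"
  where "tensor_ideal R I A =
    Idl\<^bsub>monoid_algebra R (restricted_product I A)\<^esub> (tensor_rels R I A)"

definition tensor_algebra ::
  "('k, 'c) ring_scheme \<Rightarrow> 'i set \<Rightarrow> ('i \<Rightarrow> ('k, 'a, 'd) module_scheme)
    \<Rightarrow> ('k, (('i \<Rightarrow> 'a) \<Rightarrow> 'k) set) module"
  where "tensor_algebra R I A =
    quot_algebra (monoid_algebra R (restricted_product I A)) (tensor_ideal R I A)"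

text \<open>The canonical map from the factor \<open>A i\<close>: the pure tensor with \<open>a\<close> in position \<open>i\<close> and \<open>1\<close>
  elsewhere.\<close>

definition tensor_in ::
  "('k, 'c) ring_scheme \<Rightarrow> 'i set \<Rightarrow> ('i \<Rightarrow> ('k, 'a, 'd) module_scheme) \<Rightarrow> 'i \<Rightarrow> 'a
    \<Rightarrow> (('i \<Rightarrow> 'a) \<Rightarrow> 'k) set"
  where "tensor_in R I A i a =
    tensor_ideal R I A +>\<^bsub>monoid_algebra R (restricted_product I A)\<^esub>
      free_gen R (\<one>\<^bsub>restricted_product I A\<^esub>(i := a))"

end

theory Submission
  imports Defs "HOL-Library.List_Lexorder"
begin

text \<open>
Evaluating the variable of \<open>w\<close> at the word \<open>w\<close> identifies the truncated polynomial algebra with the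
shuffle algebra. Two things have to be seen: that the \<open>p\<close>-th shuffle power of a nonempty word
vanishes, and that the shuffle monomials in \<^term>\<open>TL p S\<close> with all exponents below \<open>p\<close> form a basis.

For the first, let \<open>\<partial>\<^sub>c f\<close> be the coefficient function \<open>w \<mapsto> f (c # w)\<close>. The recursion for shuffles says
that every \<open>\<partial>\<^sub>c\<close> is a derivation, and an element is determined by its constant term and its
derivatives. Associativity and commutativity of the shuffle product follow by induction on the word
at which a coefficient is taken. Moreover \<open>\<partial>\<^sub>c (f\<^sup>p) = p f\<^sup>p\<^sup>-\<^sup>1 \<partial>\<^sub>c f = 0\<close> in characteristic \<open>p\<close>, so that
\<open>f\<^sup>p = 0\<close> as soon as \<open>f\<close> has constant term zero (\<open>pow_char_eq_zero\<close>).

For the second, every word is in a unique way a concatenation of powers \<open>l\<^sup>n\<close> of Lyndon words that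
decrease from left to right. Writing the exponents \<open>n\<close> in base \<open>p\<close> gives a bijection between words
and monomials in the \<open>l^(p^k)\<close> with exponents below \<open>p\<close>. A monomial is carried to a nonzero multiple
of its word plus lexicographically smaller words of the same length: the shuffles of a Lyndon power
\<open>l\<^sup>a\<close> with a decreasing product \<open>l\<^sup>b v\<close> of Lyndon words \<open>\<le> l\<close> do not exceed \<open>l\<^sup>a\<^sup>+\<^sup>b v\<close>
(\<open>lyndon_power_shuffles_le\<close>), and this word arises in \<open>a + b choose a\<close> ways
(\<open>shuffle_count_lyndon_powers\<close>). For \<open>a = p^k\<close> the binomial coefficient is congruent modulo \<open>p\<close> to the
\<open>k\<close>-th digit of \<open>a + b\<close> (\<open>choose_prime_power_cong\<close>), which is the exponent of \<open>l^(p^k)\<close> reached so far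
and hence not zero in the prime field. So the monomials are triangular with respect to the words,
with invertible diagonal, and surjectivity and injectivity follow (\<open>gen_in_image\<close>,
\<open>word_hom_reduced_inj\<close>).

The comparison with the tensor product holds over every commutative ring and is a matter of
universal properties: homomorphisms out of either algebra are determined by their values on the
variables, which can be any elements with vanishing \<open>p\<close>-th power. This yields two mutually inverse
homomorphisms.
\<close>

section \<open>Counting the shuffles of two words\<close>

text \<open>
The recursion consumes the result, not the factors: coefficients of a product are always computed
at a word that is read from its first letter.
\<close>

primrec shuffle_count :: "'s list \<Rightarrow> 's list \<Rightarrow> 's list \<Rightarrow> nat" where
  "shuffle_count u v [] = (if u = [] \<and> v = [] then 1 else 0)"
| "shuffle_count u v (c # w) =
    (if u \<noteq> [] \<and> hd u = c then shuffle_count (tl u) v w else 0) +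
    (if v \<noteq> [] \<and> hd v = c then shuffle_count u (tl v) w else 0)"

lemma shuffle_count_pos_iff: "0 < shuffle_count u v w \<longleftrightarrow> w \<in> shuffles u v"
proof (induction w arbitrary: u v)
  case (Cons c w)
  show ?case by (auto simp: Cons_in_shuffles_iff Cons.IH)
qed simp

lemma shuffle_count_eq_0_iff: "shuffle_count u v w = 0 \<longleftrightarrow> w \<notin> shuffles u v"
  using shuffle_count_pos_iff[of u v w] by auto

lemma shuffle_count_Nil_left: "shuffle_count [] v w = (if w = v then 1 else 0)"
proof (induction w arbitrary: v)
  case (Cons c w)
  then show ?case by (cases v) auto
qed auto

lemma shuffle_count_Nil_right: "shuffle_count u [] w = (if w = u then 1 else 0)"
proof (induction w arbitrary: u)
  case (Cons c w)
  then show ?case by (cases u) auto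
qed auto

text \<open>
Deconcatenation is multiplicative for the shuffle product: an initial part of a shuffle is a
shuffle of initial parts of the two factors.
\<close>

lemma shuffle_count_append:
  "shuffle_count u v (x @ y) =
    (\<Sum>i\<le>length u. \<Sum>j\<le>length v.
      shuffle_count (take i u) (take j v) x * shuffle_count (drop i u) (drop j v) y)"
proof (induction x arbitrary: u v)
  case Nil
  have "(\<Sum>i\<le>length u. \<Sum>j\<le>length v.
      shuffle_count (take i u) (take j v) [] * shuffle_count (drop i u) (drop j v) y)
    = (\<Sum>i\<le>length u. \<Sum>j\<le>length v. if i = 0 \<and> j = 0 then shuffle_count u v y else 0)"
    by (intro sum.cong refl) auto
  also have "\<dots> = (\<Sum>i\<le>length u. if i = 0 then shuffle_count u v y else 0)"
    by (intro sum.cong refl) (auto simp: sum.delta)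
  also have "\<dots> = shuffle_count u v y" by (simp add: sum.delta)
  finally show ?case by simp
next
  case (Cons c x)
  let ?G = "\<lambda>u v i j. shuffle_count (take i u) (take j v) x * shuffle_count (drop i u) (drop j v) y"
  have 1: "(\<Sum>i\<le>length u. \<Sum>j\<le>length v.
      (if take i u \<noteq> [] \<and> hd (take i u) = c then shuffle_count (tl (take i u)) (take j v) x else 0)
       * shuffle_count (drop i u) (drop j v) y)
     = (if u \<noteq> [] \<and> hd u = c then (\<Sum>i\<le>length (tl u). \<Sum>j\<le>length v. ?G (tl u) v i j) else 0)"
  proof (cases u)
    case (Cons a u')
    show ?thesis unfolding Cons by (simp add: sum.atMost_Suc_shift del: sum.atMost_Suc)
  qed simp
  have 2: "(\<Sum>j\<le>length v.
      (if take j v \<noteq> [] \<and> hd (take j v) = c then shuffle_count (take i u) (tl (take j v)) x else 0)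
       * shuffle_count (drop i u) (drop j v) y)
     = (if v \<noteq> [] \<and> hd v = c then (\<Sum>j\<le>length (tl v). ?G u (tl v) i j) else 0)" for i
  proof (cases v)
    case (Cons a v')
    show ?thesis unfolding Cons by (simp add: sum.atMost_Suc_shift del: sum.atMost_Suc)
  qed simp
  have "shuffle_count u v ((c # x) @ y)
     = (if u \<noteq> [] \<and> hd u = c then (\<Sum>i\<le>length (tl u). \<Sum>j\<le>length v. ?G (tl u) v i j) else 0)
     + (if v \<noteq> [] \<and> hd v = c then (\<Sum>i\<le>length u. \<Sum>j\<le>length (tl v). ?G u (tl v) i j) else 0)"
    by (simp add: Cons.IH)
  also have "\<dots> = (\<Sum>i\<le>length u. \<Sum>j\<le>length v.
      (if take i u \<noteq> [] \<and> hd (take i u) = c then shuffle_count (tl (take i u)) (take j v) x else 0)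
       * shuffle_count (drop i u) (drop j v) y)
    + (\<Sum>i\<le>length u. \<Sum>j\<le>length v.
      (if take j v \<noteq> [] \<and> hd (take j v) = c then shuffle_count (take i u) (tl (take j v)) x else 0)
       * shuffle_count (drop i u) (drop j v) y)"
    unfolding 1 2 by simp
  also have "\<dots> = (\<Sum>i\<le>length u. \<Sum>j\<le>length v.
      shuffle_count (take i u) (take j v) (c # x) * shuffle_count (drop i u) (drop j v) y)"
    by (simp add: sum.distrib[symmetric] distrib_right del: take_eq_Nil)
  finally show ?case .
qed

lemma append_in_shuffles: "u @ v \<in> shuffles u v"
  by (induction u) (auto simp: Cons_in_shuffles_iff)

text \<open>
Half of the associativity of shuffling: first shuffle \<open>v\<close> with \<open>y\<close>, then insert \<open>u\<close>, whose letters
all precede those of \<open>v\<close>.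
\<close>

lemma shuffles_append_assoc:
  "w \<in> shuffles (u @ v) y \<Longrightarrow> \<exists>z \<in> shuffles v y. w \<in> shuffles u z"
proof (induction w arbitrary: u v y)
  case Nil
  then show ?case by auto
next
  case (Cons c w)
  show ?case
  proof (cases "u = []")
    case False
    then obtain a u' where u: "u = a # u'" by (cases u) auto
    from Cons.prems consider "a = c" "w \<in> shuffles (u' @ v) y"
      | "y \<noteq> []" "hd y = c" "w \<in> shuffles (u @ v) (tl y)"
      by (auto simp: Cons_in_shuffles_iff u)
    then show ?thesis
    proof cases
      case 1
      with Cons.IH obtain z where "z \<in> shuffles v y" "w \<in> shuffles u' z" by blast
      with 1 show ?thesis by (auto simp: Cons_in_shuffles_iff u)
    next
      case 2
      with Cons.IH obtain z where "z \<in> shuffles v (tl y)" "w \<in> shuffles u z" by blast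
      with 2 show ?thesis by (intro bexI[of _ "c # z"]) (auto simp: Cons_in_shuffles_iff)
    qed
  qed (use Cons.prems in auto)
qed

lemma shuffles_append_mono:
  "\<lbrakk>x \<in> shuffles u v; y \<in> shuffles u' v'\<rbrakk> \<Longrightarrow> x @ y \<in> shuffles (u @ u') (v @ v')"
proof (induction x arbitrary: u v)
  case (Cons c x)
  then show ?case
    by (auto simp: Cons_in_shuffles_iff neq_Nil_conv)
qed auto

lemma shuffles_nonempty: "shuffles u v \<noteq> {}"
  using append_in_shuffles by blast

text \<open>
At the step where the first letter in which \<open>y\<close> and \<open>v\<close> differ is used, the larger one can be used
instead, and the shuffle can then be completed in any way. Equality of the lengths excludes that
\<open>y\<close> is an initial part of \<open>v\<close>.
\<close>

lemma shuffles_strict_mono: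
  fixes y :: "'s::linorder list"
  assumes "length y = length v" "y < v" "w \<in> shuffles u y"
  shows "\<exists>w' \<in> shuffles u v. w < w'"
  using assms
proof (induction w arbitrary: u y v)
  case Nil
  then show ?case by auto
next
  case (Cons c w)
  from Cons.prems(1,2) obtain b y' d v' where y: "y = b # y'" "v = d # v'"
    by (cases y; cases v) auto
  from Cons.prems consider "u \<noteq> []" "hd u = c" "w \<in> shuffles (tl u) y"
    | "b = c" "w \<in> shuffles u y'" by (auto simp: Cons_in_shuffles_iff y)
  then show ?case
  proof cases
    case 1
    with Cons.IH Cons.prems obtain w' where "w' \<in> shuffles (tl u) v" "w < w'" by blast
    with 1 show ?thesis by (intro bexI[of _ "c # w'"]) (auto simp: Cons_in_shuffles_iff)
  next
    case 2
    show ?thesis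
    proof (cases "b < d")
      case True
      with 2 have "d # u @ v' \<in> shuffles u v" "c # w < d # u @ v'"
        by (auto simp: Cons_in_shuffles_iff y append_in_shuffles)
      then show ?thesis by blast
    next
      case False
      with Cons.prems y have "b = d" "y' < v'" "length y' = length v'" by auto
      with 2 Cons.IH obtain w' where "w' \<in> shuffles u v'" "w < w'" by blast
      with 2 \<open>b = d\<close> show ?thesis by (intro bexI[of _ "c # w'"]) (auto simp: Cons_in_shuffles_iff y)
    qed
  qed
qed

lemma shuffles_mono:
  fixes y :: "'s::linorder list"
  assumes "length y = length v" "y \<le> v" "w \<in> shuffles u y"
  shows "\<exists>w' \<in> shuffles u v. w \<le> w'"
  using assms shuffles_strict_mono[of y v w u] by (cases "y = v") (auto simp: order_le_less)

text \<open>
Moving an initial part \<open>s\<close> from the larger word to the smaller one does not lower the largest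
shuffle. Follow a shuffle of \<open>s @ u\<close> and \<open>v\<close>. As long as \<open>u\<close> and \<open>v\<close> agree, a letter of \<open>v\<close> that is
used can be booked as a letter of \<open>u\<close> by letting \<open>s\<close> grow; if \<open>s\<close> is used up, both pairs have the
same shuffles, and where \<open>u\<close> has a larger letter than \<open>v\<close>, that letter improves the shuffle.
\<close>

lemma shuffles_exchange:
  fixes u :: "'s::linorder list"
  assumes "v \<le> u" "w \<in> shuffles (s @ u) v"
  shows "\<exists>w' \<in> shuffles u (s @ v). w \<le> w'"
  using assms
proof (induction w arbitrary: s u v)
  case Nil
  then show ?case by auto
next
  case (Cons c w)
  show ?case
  proof (cases "s = [] \<or> v = []")
    case True
    then show ?thesis
    proof
      assume "s = []" with Cons.prems show ?thesis by auto
    next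
      assume "v = []"
      with Cons.prems have "c # w = s @ u" by simp
      moreover have "s @ u \<in> shuffles u s" using append_in_shuffles shuffles_commutes by blast
      ultimately show ?thesis using \<open>v = []\<close> by auto
    qed
  next
    case False
    then obtain a s' b v' where s: "s = a # s'" "v = b # v'" by (auto simp: neq_Nil_conv)
    with Cons.prems(1) obtain d u' where u: "u = d # u'" by (cases u) auto
    from Cons.prems consider "a = c" "w \<in> shuffles (s' @ u) v"
      | "b = c" "w \<in> shuffles (s @ u) v'" by (auto simp: Cons_in_shuffles_iff s)
    then show ?thesis
    proof cases
      case 1
      with Cons.IH Cons.prems(1) obtain w' where "w' \<in> shuffles u (s' @ v)" "w \<le> w'" by blast
      with 1 show ?thesis by (intro bexI[of _ "c # w'"]) (auto simp: Cons_in_shuffles_iff s)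
    next
      case 2
      show ?thesis
      proof (cases "b < d")
        case True
        with 2 have "d # u' @ s @ v \<in> shuffles u (s @ v)" "c # w \<le> d # u' @ s @ v"
          by (auto simp: Cons_in_shuffles_iff u append_in_shuffles)
        then show ?thesis by blast
      next
        case False
        with Cons.prems(1) have "b = d" "v' \<le> u'" by (auto simp: s u)
        moreover from 2 have "w \<in> shuffles ((s @ [b]) @ u') v'" by (simp add: u \<open>b = d\<close>)
        ultimately obtain w' where "w' \<in> shuffles u' ((s @ [b]) @ v')" "w \<le> w'"
          using Cons.IH by blast
        with 2 \<open>b = d\<close> show ?thesis
          by (intro bexI[of _ "c # w'"]) (auto simp: Cons_in_shuffles_iff s u)
      qed
    qed
  qed
qed

text \<open>
Starting with the smaller word can only compete if its first letter is also \<open>a\<close>, and then this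
letter can be booked to the larger word by exchanging.
\<close>

lemma shuffles_greedy:
  fixes u' :: "'s::linorder list"
  assumes "v \<le> a # u'" "w \<in> shuffles (a # u') v"
  shows "\<exists>w' \<in> shuffles u' v. w \<le> a # w'"
proof -
  obtain c w1 where w: "w = c # w1" using assms(2) by (cases w) auto
  from assms(2) consider "a = c" "w1 \<in> shuffles u' v"
    | b v' where "v = b # v'" "b = c" "w1 \<in> shuffles (a # u') v'"
    by (auto simp: Cons_in_shuffles_iff w neq_Nil_conv)
  then show ?thesis
  proof cases
    case 1 then show ?thesis by (auto simp: w)
  next
    case 2
    show ?thesis
    proof (cases "b = a")
      case True
      with 2 assms(1) have "v' \<le> u'" "w1 \<in> shuffles ([a] @ u') v'" by auto
      from shuffles_exchange[OF this] 2 True show ?thesis by (auto simp: w)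
    next
      case False
      with 2 assms(1) have "c < a" by auto
      then show ?thesis using shuffles_nonempty by (auto simp: w)
    qed
  qed
qed

section \<open>Lyndon words\<close>

definition lyndon :: "'s::linorder list \<Rightarrow> bool" where
  "lyndon w \<longleftrightarrow> w \<noteq> [] \<and> (\<forall>u v. w = u @ v \<longrightarrow> u \<noteq> [] \<longrightarrow> v \<noteq> [] \<longrightarrow> w < v)"

lemma Lyn_eq: "Lyn S = {w \<in> lists S. lyndon w}"
  by (simp add: Lyn_def lyndon_def list_less_def)

lemma lyndonD: "lyndon (u @ v) \<Longrightarrow> u \<noteq> [] \<Longrightarrow> v \<noteq> [] \<Longrightarrow> u @ v < v"
  by (auto simp: lyndon_def)

lemma lyndon_suffix_ge: "lyndon (u @ v) \<Longrightarrow> v \<noteq> [] \<Longrightarrow> u @ v \<le> v"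
  by (cases "u = []") (auto intro: less_imp_le lyndonD)

lemma less_append_cases:
  fixes l :: "'s::linorder list"
  assumes "l < x"
  obtains "\<And>y. l @ y < x" | t where "t \<noteq> []" "x = l @ t"
proof -
  from assms have "(\<forall>y. l @ y < x) \<or> (\<exists>t. t \<noteq> [] \<and> x = l @ t)"
  proof (induction l arbitrary: x)
    case Nil
    then show ?case by auto
  next
    case (Cons a l)
    then show ?case by (cases x) auto
  qed
  with that show ?thesis by blast
qed

lemma append_less_cancel [simp]: "x @ y < x @ z \<longleftrightarrow> y < z" for x :: "'s::linorder list"
  by (induction x) auto

lemma append_le_cancel [simp]: "x @ y \<le> x @ z \<longleftrightarrow> y \<le> z" for x :: "'s::linorder list"
  by (induction x) auto

lemma le_append: "x \<le> x @ y" for x :: "'s::linorder list"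
  by (induction x) auto

text \<open>
Compare from the left. A factor that is an initial part of \<open>x\<close> is cancelled, and what remains of
\<open>x\<close> is a suffix to which the same argument applies.
\<close>

lemma concat_less:
  fixes x :: "'s::linorder list"
  assumes "x \<noteq> []" "\<And>s t l. \<lbrakk>x = s @ t; t \<noteq> []; l \<in> set ls\<rbrakk> \<Longrightarrow> l < t"
  shows "concat ls < x"
  using assms
proof (induction ls arbitrary: x)
  case Nil
  then show ?case by (cases x) auto
next
  case (Cons l ls)
  have "l < x" using Cons.prems(2)[of "[]" x l] Cons.prems(1) by simp
  then show ?case
  proof (cases rule: less_append_cases)
    case (2 t)
    have "concat ls < t"
    proof (rule Cons.IH[OF \<open>t \<noteq> []\<close>])
      fix s t' k assume "t = s @ t'" "t' \<noteq> []" "k \<in> set ls"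
      then show "k < t'" using Cons.prems(2)[of "l @ s" t' k] 2 by simp
    qed
    then show ?thesis by (simp add: 2)
  qed simp
qed

text \<open>
While \<open>s\<close> is not exhausted, its remaining part is a suffix of \<open>s\<close> and hence exceeds the whole
product, so by the greedy rule it is best to go on with \<open>s\<close>.
\<close>

lemma shuffles_concat_le:
  fixes s :: "'s::linorder list"
  assumes "\<And>s' t l. \<lbrakk>s = s' @ t; t \<noteq> []; l \<in> set ls\<rbrakk> \<Longrightarrow> l < t"
    and "w \<in> shuffles s (concat ls)"
  shows "w \<le> s @ concat ls"
  using assms
proof (induction s arbitrary: w)
  case (Cons a s)
  have "concat ls < a # s" using concat_less[of "a # s" ls] Cons.prems(1) by blast
  then obtain w' where "w' \<in> shuffles s (concat ls)" "w \<le> a # w'"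
    using shuffles_greedy[OF less_imp_le Cons.prems(2)] by blast
  moreover have "w' \<le> s @ concat ls"
  proof (rule Cons.IH[OF _ \<open>w' \<in> _\<close>])
    fix s' t l assume "s = s' @ t" "t \<noteq> []" "l \<in> set ls"
    then show "l < t" using Cons.prems(1)[of "a # s'" t l] by simp
  qed
  ultimately show ?case by (metis Cons_le_Cons append_Cons order_trans)
qed auto

text \<open>
If all factors are smaller than \<open>l\<close>, the suffixes of \<open>l\<close> dominate them, and \<open>l\<close> is used up first. If
the first factor equals \<open>l\<close>, only the initial step is ambiguous: whichever copy of \<open>l\<close> is started,
its remaining part is a proper suffix of \<open>l\<close> and is used up before the other copy.
\<close>

lemma lyndon_shuffles_le:
  assumes "lyndon l" "\<forall>k \<in> set ls. k \<le> l" "sorted_wrt (\<ge>) ls"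
    and "w \<in> shuffles l (concat ls)"
  shows "w \<le> l @ concat ls"
  using assms(2-)
proof (induction ls arbitrary: w)
  case Nil
  then show ?case by simp
next
  case (Cons k ls)
  have suffix: "j < t" if "l = s @ t" "s \<noteq> []" "t \<noteq> []" "j \<in> set (k # ls)" for s t j
    using lyndonD[of s t] assms(1) that Cons.prems(1) by (auto intro: le_less_trans)
  show ?case
  proof (cases "k = l")
    case False
    with Cons.prems have less: "j < l" if "j \<in> set (k # ls)" for j using that by force
    show ?thesis
    proof (rule shuffles_concat_le[OF _ Cons.prems(3)])
      fix s t j assume "l = s @ t" "t \<noteq> []" "j \<in> set (k # ls)"
      then show "j < t" using lyndon_suffix_ge[of s t] assms(1) less[of j] by (auto intro: less_le_trans)
    qed
  next
    case True
    obtain a l1 where l: "l = a # l1" using assms(1) by (cases l) (auto simp: lyndon_def)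
    obtain c w1 where w: "w = c # w1" using Cons.prems(3) by (cases w) (auto simp: l)
    have tail: "z \<le> l1 @ concat (k # ls)" if "z \<in> shuffles l1 (concat (k # ls))" for z
    proof (rule shuffles_concat_le[OF _ that])
      fix s t j assume "l1 = s @ t" "t \<noteq> []" "j \<in> set (k # ls)"
      then show "j < t" using suffix[of "a # s" t j] l by simp
    qed
    from Cons.prems(3) consider "a = c" "w1 \<in> shuffles l1 (concat (k # ls))"
      | "a = c" "w1 \<in> shuffles l (l1 @ concat ls)"
      by (auto simp: Cons_in_shuffles_iff w l True)
    then show ?thesis
    proof cases
      case 1
      with tail show ?thesis by (auto simp: l w)
    next
      case 2
      then obtain z where z: "z \<in> shuffles l (concat ls)" "w1 \<in> shuffles l1 z"
        using shuffles_append_assoc[of w1 l1 "concat ls" l] by (auto simp: shuffles_commutes)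
      have "z \<le> l @ concat ls" using Cons z by auto
      moreover have "length z = length (l @ concat ls)" using z length_shuffles by fastforce
      ultimately obtain w' where "w' \<in> shuffles l1 (l @ concat ls)" "w1 \<le> w'"
        using shuffles_mono[OF _ _ z(2)] by blast
      with tail[of w'] have "w1 \<le> l1 @ l @ concat ls" by (auto simp: True)
      with 2 show ?thesis by (simp add: w l True)
    qed
  qed
qed

lemma sorted_wrt_ge_replicate: "sorted_wrt (\<ge>) (replicate n (x :: 'a::order))"
  by (induction n) auto

lemma lyndon_power_shuffles_le:
  assumes "lyndon l" "\<forall>k \<in> set ls. k \<le> l" "sorted_wrt (\<ge>) ls"
    and "w \<in> shuffles (concat (replicate n l)) (concat ls)"
  shows "w \<le> concat (replicate n l) @ concat ls"
  using assms(4)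
proof (induction n arbitrary: w)
  case (Suc n)
  then obtain z where z: "z \<in> shuffles (concat (replicate n l)) (concat ls)" "w \<in> shuffles l z"
    using shuffles_append_assoc[of w l "concat (replicate n l)" "concat ls"] by auto
  let ?Y = "concat (replicate n l @ ls)"
  have "z \<le> ?Y" using Suc.IH[OF z(1)] by simp
  moreover have "length z = length ?Y" using length_shuffles[OF z(1)] by simp
  ultimately obtain w' where "w' \<in> shuffles l ?Y" "w \<le> w'"
    using shuffles_mono[OF _ _ z(2)] by blast
  moreover from this(1) have "w' \<le> l @ ?Y"
    by (rule lyndon_shuffles_le[rotated -1]) (use assms in \<open>auto simp: sorted_wrt_append sorted_wrt_ge_replicate\<close>)
  ultimately show ?case by auto
qed simp

text \<open>
If an initial part \<open>x\<close> of the result cannot be assembled from both factors, it comes entirely from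
one of them.
\<close>

lemma shuffle_count_append_outer:
  assumes "x \<noteq> []"
    and "\<And>i j. \<lbrakk>0 < i; 0 < j; i + j = length x; i \<le> length u; j \<le> length v;
      x \<in> shuffles (take i u) (take j v); y \<in> shuffles (drop i u) (drop j v)\<rbrakk> \<Longrightarrow> False"
  shows "shuffle_count u v (x @ y) =
    (if take (length x) u = x then shuffle_count (drop (length x) u) v y else 0) +
    (if take (length x) v = x then shuffle_count u (drop (length x) v) y else 0)" (is "_ = ?A + ?B")
proof -
  let ?n = "length x"
  have "shuffle_count (take i u) (take j v) x * shuffle_count (drop i u) (drop j v) y
      = (if i = ?n then if j = 0 then ?A else 0 else 0) + (if i = 0 then if j = ?n then ?B else 0 else 0)"
    if "i \<le> length u" "j \<le> length v" for i j
  proof -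
    have len: "length (take i u) = i" "length (take j v) = j" using that by auto
    consider "j = 0" | "i = 0" "0 < j" | "0 < i" "0 < j" by linarith
    then show ?thesis
    proof cases
      case 1
      with assms(1) len show ?thesis by (auto simp: shuffle_count_Nil_right)
    next
      case 2
      with assms(1) len show ?thesis by (auto simp: shuffle_count_Nil_left)
    next
      case 3
      have "x \<notin> shuffles (take i u) (take j v) \<or> y \<notin> shuffles (drop i u) (drop j v)"
        using assms(2)[OF 3 _ that] length_shuffles[of x "take i u" "take j v"] len by auto
      with 3 show ?thesis by (auto simp flip: shuffle_count_eq_0_iff)
    qed
  qed
  then have "shuffle_count u v (x @ y) = (\<Sum>i\<le>length u. \<Sum>j\<le>length v.
      (if i = ?n then if j = 0 then ?A else 0 else 0) + (if i = 0 then if j = ?n then ?B else 0 else 0))"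
    unfolding shuffle_count_append by (intro sum.cong refl) auto
  also have "\<dots> = (\<Sum>i\<le>length u. if i = ?n then \<Sum>j\<le>length v. if j = 0 then ?A else 0 else 0) +
     (\<Sum>i\<le>length u. if i = 0 then \<Sum>j\<le>length v. if j = ?n then ?B else 0 else 0)"
    unfolding sum.distrib[symmetric] by (intro sum.cong refl) (auto simp: sum.distrib)
  also have "\<dots> = (if ?n \<le> length u then ?A else 0) + (if ?n \<le> length v then ?B else 0)"
    by (simp add: sum.delta)
  also have "\<dots> = ?A + ?B" by (auto dest: arg_cong[where f = length])
  finally show ?thesis .
qed

text \<open>
The largest shuffle starts with a copy of \<open>l\<close>. This copy cannot be composed of letters of both
factors: part of a copy of \<open>l\<close> in the left factor would be left over, and continuing with this
proper suffix, which is larger than \<open>l\<close>, would exceed the largest shuffle. So the copy is taken as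
a whole from one of the two powers, a product of smaller Lyndon words having no initial part \<open>l\<close>,
and the numbers satisfy Pascal's recursion.
\<close>

lemma shuffle_count_lyndon_powers:
  assumes "lyndon l" "\<forall>k \<in> set ls. k < l" "sorted_wrt (\<ge>) ls"
  shows "shuffle_count (concat (replicate a l)) (concat (replicate b l) @ concat ls)
    (concat (replicate (a + b) l) @ concat ls) = (a + b) choose a"
proof (induction "a + b" arbitrary: a b)
  case 0
  then show ?case by (simp add: shuffle_count_Nil_left)
next
  case (Suc n)
  show ?case
  proof (cases a)
    case 0
    then show ?thesis by (simp add: shuffle_count_Nil_left)
  next
    case (Suc a')
    let ?pow = "\<lambda>n. concat (replicate n l)"
    let ?Z = "concat (replicate a' l @ replicate b l @ ls)"
    have l: "l \<noteq> []" using assms(1) by (auto simp: lyndon_def)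
    have main: "shuffle_count (?pow a) (?pow b @ concat ls) (l @ ?Z) =
      (if take (length l) (?pow a) = l then shuffle_count (drop (length l) (?pow a)) (?pow b @ concat ls) ?Z else 0) +
      (if take (length l) (?pow b @ concat ls) = l
        then shuffle_count (?pow a) (drop (length l) (?pow b @ concat ls)) ?Z else 0)"
    proof (rule shuffle_count_append_outer[OF l])
      fix i j assume ij: "0 < i" "0 < j" "i + j = length l"
        and mem: "l \<in> shuffles (take i (?pow a)) (take j (?pow b @ concat ls))"
      let ?r = "drop i (?pow a) @ drop j (?pow b @ concat ls)"
      have "l @ ?r \<in> shuffles (?pow a) (?pow b @ concat ls)"
        using shuffles_append_mono[OF mem append_in_shuffles] by (metis append_take_drop_id)
      then have "l @ ?r \<in> shuffles (?pow a) (concat (replicate b l @ ls))" by simp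
      then have "l @ ?r \<le> ?pow a @ concat (replicate b l @ ls)"
        by (rule lyndon_power_shuffles_le[rotated -1]) (use assms in \<open>auto simp: sorted_wrt_append sorted_wrt_ge_replicate\<close>)
      then have "?r \<le> ?Z" by (simp add: Suc)
      \<comment> \<open>The part of \<open>l\<close> that is left over in the first factor exceeds all Lyndon words \<open>\<le> l\<close>.\<close>
      moreover have "?Z < drop i l"
      proof (rule concat_less)
        show "drop i l \<noteq> []" using ij by auto
        fix s t k assume "drop i l = s @ t" "t \<noteq> []" "k \<in> set (replicate a' l @ replicate b l @ ls)"
        moreover from this have "(take i l @ s) @ t = l" "take i l @ s \<noteq> []"
          using l ij by (auto simp flip: \<open>drop i l = s @ t\<close>)
        ultimately show "k < t"
          using lyndonD[of "take i l @ s" t] assms(1,2) by (auto intro: le_less_trans less_trans)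
      qed
      moreover have "drop i l \<le> ?r" using ij by (simp add: Suc le_append)
      ultimately show False by auto
    qed
    have Y: "take (length l) (concat ls) \<noteq> l"
    proof
      assume "take (length l) (concat ls) = l"
      then have "l \<le> concat ls" by (metis append_take_drop_id le_append)
      moreover have "concat ls < l"
      proof (rule concat_less[OF l])
        fix s t k assume "l = s @ t" "t \<noteq> []" "k \<in> set ls"
        then show "k < t" using lyndon_suffix_ge[of s t] assms(1,2) by (auto intro: less_le_trans)
      qed
      ultimately show False by simp
    qed
    have IH1: "shuffle_count (?pow a') (?pow b @ concat ls) ?Z = (a' + b) choose a'"
      using Suc.hyps(1)[of a' b] Suc.hyps(2) Suc by (simp add: replicate_add)
    have "shuffle_count (?pow a) (?pow b @ concat ls) (l @ ?Z) = (a + b) choose a"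
    proof (cases b)
      case 0
      show ?thesis unfolding main using Y IH1 by (simp add: 0 Suc)
    next
      case (Suc b')
      have "replicate a' l @ replicate b l = replicate (a + b') l"
        using Suc \<open>a = Suc a'\<close> by (simp add: replicate_add replicate_app_Cons_same)
      then have Z: "?Z = ?pow (a + b') @ concat ls"
        by (metis append.assoc concat_append)
      have "shuffle_count (?pow a) (?pow b' @ concat ls) ?Z = (a + b') choose a"
        unfolding Z using Suc.hyps(1)[of a b'] Suc.hyps(2) Suc by simp
      then show ?thesis unfolding main using IH1 by (simp add: Suc \<open>a = Suc a'\<close>)
    qed
    moreover have Z: "l @ ?Z = ?pow (a + b) @ concat ls"
      by (simp add: Suc replicate_add)
    ultimately show ?thesis unfolding Z by simp
  qed
qed

text \<open>
The last factor is the least nonempty suffix \<open>m\<close> of \<open>w\<close>, which is a Lyndon word. If the factor \<open>k\<close>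
before it were smaller, then so would be the suffix \<open>k @ m\<close>, except if \<open>k\<close> is an initial part of
\<open>m\<close>, where cancelling \<open>k\<close> contradicts that \<open>m\<close> is a Lyndon word.
\<close>

lemma lyndon_factorization_exists:
  fixes w :: "'s::linorder list"
  shows "\<exists>ls. concat ls = w \<and> (\<forall>l \<in> set ls. lyndon l) \<and> sorted_wrt (\<ge>) ls"
proof (induction "length w" arbitrary: w rule: less_induct)
  case less
  show ?case
  proof (cases "w = []")
    case True
    then show ?thesis by (intro exI[of _ "[]"]) auto
  next
    case False
    let ?suf = "{v. v \<noteq> [] \<and> (\<exists>u. w = u @ v)}"
    define m where "m = Min ?suf"
    have "?suf \<subseteq> (\<lambda>n. drop n w) ` {..length w}"
    proof
      fix v assume "v \<in> ?suf"
      then obtain u where "w = u @ v" by blast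
      then have "v = drop (length u) w" "length u \<le> length w" by auto
      then show "v \<in> (\<lambda>n. drop n w) ` {..length w}" by blast
    qed
    then have fin: "finite ?suf" by (rule finite_subset) auto
    have "?suf \<noteq> {}" using False by blast
    from Min_in[OF fin this] obtain u where m: "m \<noteq> []" "w = u @ m" unfolding m_def by blast
    have min: "m \<le> v" if "v \<noteq> []" "w = x @ v" for x v
      unfolding m_def by (rule Min_le[OF fin]) (use that in blast)
    have "lyndon m" unfolding lyndon_def
    proof (intro conjI allI impI)
      fix x y assume "m = x @ y" "x \<noteq> []" "y \<noteq> []"
      then show "m < y" using min[of y "u @ x"] m by (auto simp: order_le_less)
    qed (rule m)
    obtain ls where ls: "concat ls = u" "\<forall>l \<in> set ls. lyndon l" "sorted_wrt (\<ge>) ls"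
      using less[of u] m by auto
    have "m \<le> l" if "l \<in> set ls" for l
    proof -
      from that have "ls \<noteq> []" by auto
      then obtain ls' k where k: "ls = ls' @ [k]" by (meson rev_exhaust)
      have "m \<le> k"
      proof (rule ccontr)
        assume "\<not> m \<le> k"
        then have "k < m" by simp
        have le: "m \<le> k @ m" using min[of "k @ m" "concat ls'"] m ls k by auto
        from \<open>k < m\<close> show False
        proof (cases rule: less_append_cases)
          case 1
          with le show False using leD by blast
        next
          case (2 t)
          with le have "t \<le> m" by simp
          moreover have "m < t" using lyndonD[of k t] \<open>lyndon m\<close> 2 ls k by (auto simp: lyndon_def)
          ultimately show False by simp
        qed
      qed
      with that ls(3) show ?thesis by (auto simp: k sorted_wrt_append)
    qed
    then show ?thesis using ls \<open>lyndon m\<close> m by (intro exI[of _ "ls @ [m]"]) (auto simp: sorted_wrt_append)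
  qed
qed

text \<open>
The last factor is recovered from the product as its least nonempty suffix, which makes the
factorization unique.
\<close>

lemma last_lyndon_factor_le_suffix:
  fixes l :: "'s::linorder list"
  assumes "\<forall>k \<in> set (ls @ [l]). lyndon k" "sorted_wrt (\<ge>) (ls @ [l])"
    and "concat (ls @ [l]) = x @ s" "s \<noteq> []"
  shows "l \<le> s"
  using assms
proof (induction ls arbitrary: x)
  case Nil
  then show ?case using lyndon_suffix_ge[of x s] by auto
next
  case (Cons k ls)
  from Cons.prems(3) consider t where "x = k @ t" "concat (ls @ [l]) = t @ s"
    | t where "k = x @ t" "s = t @ concat (ls @ [l])"
    by (auto simp: append_eq_append_conv2)
  then show ?case
  proof cases
    case 1
    with Cons show ?thesis by auto
  next
    case 2
    show ?thesis
    proof (cases "t = []")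
      case True
      with 2 Cons.IH[of "[]"] Cons.prems show ?thesis by auto
    next
      case False
      with 2 Cons.prems have "k \<le> t" using lyndon_suffix_ge[of x t] by auto
      moreover have "l \<le> k" using Cons.prems by auto
      ultimately show ?thesis using 2 le_append[of t "concat (ls @ [l])"] by (auto intro: order_trans)
    qed
  qed
qed

lemma lyndon_factorization_unique:
  fixes ls :: "'s::linorder list list"
  assumes "\<forall>l \<in> set ls. lyndon l" "sorted_wrt (\<ge>) ls"
    and "\<forall>l \<in> set ks. lyndon l" "sorted_wrt (\<ge>) ks"
    and "concat ls = concat ks"
  shows "ls = ks"
  using assms
proof (induction ls arbitrary: ks rule: rev_induct)
  case Nil
  then show ?case by (cases ks) (auto simp: lyndon_def)
next
  case (snoc l ls)
  from snoc.prems have "ks \<noteq> []" by (auto simp: lyndon_def)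
  then obtain ks' k where k: "ks = ks' @ [k]" by (meson rev_exhaust)
  have "l \<noteq> []" "k \<noteq> []" using snoc.prems by (auto simp: lyndon_def k)
  then have "l \<le> k" "k \<le> l"
    using last_lyndon_factor_le_suffix[of ls l "concat ks'" k]
      last_lyndon_factor_le_suffix[of ks' k "concat ls" l] snoc.prems k by auto
  then have "l = k" by simp
  moreover have "ls = ks'"
    by (rule snoc.IH) (use snoc.prems \<open>l = k\<close> in \<open>simp_all add: k sorted_wrt_append\<close>)
  ultimately show ?case by (simp add: k)
qed

definition lyndon_product :: "'s::linorder list multiset \<Rightarrow> 's list" where
  "lyndon_product M = concat (rev (sorted_list_of_multiset M))"

lemma lyndon_product_mset: "sorted_wrt (\<ge>) ls \<Longrightarrow> lyndon_product (mset ls) = concat ls"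
proof -
  assume "sorted_wrt (\<ge>) ls"
  then have "sorted (rev ls)" by (simp add: sorted_wrt_rev)
  then have "sort ls = rev ls" by (intro properties_for_sort) auto
  then show ?thesis by (simp add: lyndon_product_def)
qed

lemma sorted_list_of_multiset_exists:
  fixes M :: "'a::linorder multiset"
  obtains ls where "mset ls = M" "sorted_wrt (\<ge>) ls"
proof
  show "mset (rev (sorted_list_of_multiset M)) = M" by simp
  show "sorted_wrt (\<ge>) (rev (sorted_list_of_multiset M))"
    using sorted_sorted_list_of_multiset[of M] by (simp add: sorted_wrt_rev)
qed

lemma lyndon_product_add:
  assumes "\<And>k. k \<in># M \<Longrightarrow> k \<le> l"
  shows "lyndon_product (replicate_mset n l + M) = concat (replicate n l) @ lyndon_product M"
proof -
  obtain ls where ls: "mset ls = M" "sorted_wrt (\<ge>) ls" by (rule sorted_list_of_multiset_exists)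
  then have "sorted_wrt (\<ge>) (replicate n l @ ls)"
    using assms by (auto simp: sorted_wrt_append sorted_wrt_ge_replicate)
  from lyndon_product_mset[OF this] lyndon_product_mset[OF ls(2)] ls(1) show ?thesis by simp
qed

lemma lyndon_product_inj:
  assumes "set_mset M \<subseteq> Lyn S" "set_mset N \<subseteq> Lyn S" "lyndon_product M = lyndon_product N"
  shows "M = N"
proof -
  obtain ls where ls: "mset ls = M" "sorted_wrt (\<ge>) ls" by (rule sorted_list_of_multiset_exists)
  obtain ks where ks: "mset ks = N" "sorted_wrt (\<ge>) ks" by (rule sorted_list_of_multiset_exists)
  have "ls = ks"
    by (rule lyndon_factorization_unique)
      (use assms ls ks lyndon_product_mset[of ls] lyndon_product_mset[of ks] in \<open>auto simp: Lyn_eq\<close>)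
  with ls ks show ?thesis by simp
qed

lemma lyndon_product_surj:
  assumes "w \<in> lists S"
  obtains M where "set_mset M \<subseteq> Lyn S" "lyndon_product M = w"
proof -
  obtain ls where ls: "concat ls = w" "\<forall>l \<in> set ls. lyndon l" "sorted_wrt (\<ge>) ls"
    using lyndon_factorization_exists by blast
  have "set_mset (mset ls) \<subseteq> Lyn S" using ls assms by (auto simp: Lyn_eq)
  with ls that lyndon_product_mset show ?thesis by blast
qed

lemma lyndon_power_inj:
  assumes "l \<in> Lyn S" "k \<in> Lyn S" "m \<noteq> 0" "concat (replicate m l) = concat (replicate n k)"
  shows "l = k \<and> m = n"
proof -
  have "lyndon_product (replicate_mset m l) = lyndon_product (replicate_mset n k)"
    using assms lyndon_product_add[of "{#}" l m] lyndon_product_add[of "{#}" k n]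
    by (simp add: lyndon_product_def)
  then have "replicate_mset m l = replicate_mset n k"
    by (rule lyndon_product_inj[rotated -1]) (use assms in \<open>auto split: if_splits\<close>)
  then show ?thesis using assms(3) by (metis count_replicate_mset)
qed

section \<open>Binomial coefficients and digits in a prime base\<close>

text \<open>
Since \<open>i\<close> times the binomial coefficient is divisible by \<open>p ^ j\<close> and \<open>i\<close> is not, the binomial
coefficient cannot be prime to \<open>p\<close>.
\<close>

lemma prime_dvd_choose_prime_power:
  fixes p :: nat
  assumes "Factorial_Ring.prime p" "0 < i" "i < p ^ j"
  shows "p dvd (p ^ j choose i)"
proof (rule ccontr)
  assume "\<not> p dvd (p ^ j choose i)"
  then have "coprime (p ^ j) (p ^ j choose i)"
    using assms(1) by (simp add: prime_imp_coprime)
  moreover obtain i' n where "i = Suc i'" "p ^ j = Suc n"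
    using assms by (metis gr0_conv_Suc gr_implies_not0 not0_implies_Suc)
  then have "p ^ j dvd i * (p ^ j choose i)"
    by (metis Suc_times_binomial dvd_triv_left)
  ultimately have "p ^ j dvd i" by (simp add: coprime_dvd_mult_left_iff)
  with assms show False by (auto dest: dvd_imp_le)
qed

text \<open>
The case of Lucas' theorem that is needed. Both sides vanish for \<open>n < p ^ j\<close>, and by Vandermonde's
identity and the previous lemma, replacing \<open>n\<close> by \<open>n + p ^ j\<close> adds one to the left-hand side
modulo \<open>p\<close>.
\<close>

lemma choose_prime_power_cong:
  fixes p :: nat
  assumes "Factorial_Ring.prime p"
  shows "[n choose (p ^ j) = n div p ^ j] (mod p)"
proof (induction n rule: less_induct)
  case (less n)
  have pos: "0 < p ^ j" using assms by (simp add: prime_gt_0_nat)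
  show ?case
  proof (cases "n < p ^ j")
    case False
    define n' where "n' = n - p ^ j"
    have n: "n = p ^ j + n'" using False by (simp add: n'_def)
    have "[(\<Sum>k\<le>p ^ j. (p ^ j choose k) * (n' choose (p ^ j - k))) =
      (\<Sum>k\<le>p ^ j. if k = 0 then n' choose (p ^ j) else if k = p ^ j then 1 else 0)] (mod p)"
    proof (rule cong_sum)
      fix k assume "k \<in> {..p ^ j}"
      then consider "k = 0" | "0 < k" "k < p ^ j" | "k = p ^ j" "k \<noteq> 0"
        using pos by fastforce
      then show "[(p ^ j choose k) * (n' choose (p ^ j - k)) =
        (if k = 0 then n' choose (p ^ j) else if k = p ^ j then 1 else 0)] (mod p)"
      proof cases
        case 2
        with prime_dvd_choose_prime_power[OF assms 2] show ?thesis by (simp add: cong_0_iff)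
      qed auto
    qed
    also have "(\<Sum>k\<le>p ^ j. (p ^ j choose k) * (n' choose (p ^ j - k))) = n choose (p ^ j)"
      by (simp add: vandermonde n)
    also have "(\<Sum>k\<le>p ^ j. if k = 0 then n' choose (p ^ j) else if k = p ^ j then 1 else 0)
      = (\<Sum>k\<le>p ^ j. (if k = 0 then n' choose (p ^ j) else 0) + (if k = p ^ j then 1 else 0))"
      using pos by (intro sum.cong refl) auto
    also have "\<dots> = (n' choose (p ^ j)) + 1" by (simp add: sum.distrib sum.delta)
    also have "[\<dots> = n' div p ^ j + 1] (mod p)"
      using less[of n'] pos by (intro cong_add) (auto simp: n)
    also have "n' div p ^ j + 1 = n div p ^ j" using pos by (simp add: n)
    finally show ?thesis .
  qed (simp add: binomial_eq_0)
qed

lemma digit_of_sum: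
  fixes p :: nat
  assumes "\<And>k. d k < p" "j < K"
  shows "(\<Sum>k<K. d k * p ^ k) div p ^ j mod p = d j"
  using assms
proof (induction j arbitrary: d K)
  case (0 d K)
  then obtain K' where K: "K = Suc K'" by (cases K) auto
  have "(\<Sum>k<K. d k * p ^ k) = d 0 + p * (\<Sum>k<K'. d (Suc k) * p ^ k)"
    by (simp add: K sum.lessThan_Suc_shift sum_distrib_left ac_simps del: sum.lessThan_Suc)
  with 0 show ?case by simp
next
  case (Suc j d K)
  then obtain K' where K: "K = Suc K'" by (cases K) auto
  have "(\<Sum>k<K. d k * p ^ k) = d 0 + p * (\<Sum>k<K'. d (Suc k) * p ^ k)"
    by (simp add: K sum.lessThan_Suc_shift sum_distrib_left ac_simps del: sum.lessThan_Suc)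
  moreover have "p \<noteq> 0" "d 0 < p" using Suc.prems(1)[of 0] by auto
  ultimately have "(\<Sum>k<K. d k * p ^ k) div p = (\<Sum>k<K'. d (Suc k) * p ^ k)" by simp
  with Suc.IH[of "\<lambda>k. d (Suc k)" K'] Suc.prems K show ?case by (simp add: div_mult2_eq)
qed

lemma sum_of_digits:
  fixes p :: nat
  shows "(\<Sum>k<K. (n div p ^ k mod p) * p ^ k) = n mod p ^ K"
proof (induction K)
  case (Suc K)
  have "n mod (p ^ K * p) = p ^ K * (n div p ^ K mod p) + n mod p ^ K" by (rule mod_mult2_eq)
  with Suc show ?case by (simp add: ac_simps)
qed simp

section \<open>Reduced monomials and their leading words\<close>

text \<open>
The description determines \<open>M\<close> because Lyndon factorizations exist and are unique.
\<close>

definition lyndon_factors :: "'s::linorder list \<Rightarrow> 's list multiset" where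
  "lyndon_factors w = (THE M. set_mset M \<subseteq> Lyn UNIV \<and> lyndon_product M = w)"

lemma Lyn_subset_UNIV: "Lyn S \<subseteq> Lyn UNIV"
  by (auto simp: Lyn_eq)

lemma lyndon_factors_product: "set_mset M \<subseteq> Lyn S \<Longrightarrow> lyndon_factors (lyndon_product M) = M"
  unfolding lyndon_factors_def
  by (rule the_equality) (use Lyn_subset_UNIV lyndon_product_inj[of _ UNIV] in blast)+

lemma lyndon_product_replicate: "lyndon_product (replicate_mset n l) = concat (replicate n l)"
  using lyndon_product_add[of "{#}" l n] by (simp add: lyndon_product_def)

lemma lyndon_factors_power: "l \<in> Lyn S \<Longrightarrow> lyndon_factors (concat (replicate n l)) = replicate_mset n l"
  using lyndon_factors_product[of "replicate_mset n l" S]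
  by (auto simp: lyndon_product_replicate split: if_splits)

definition all_lyndon_factors :: "'s::linorder list multiset \<Rightarrow> 's list multiset" where
  "all_lyndon_factors m = (\<Sum>t\<in>#m. lyndon_factors t)"

lemma all_lyndon_factors_simps [simp]:
  "all_lyndon_factors {#} = {#}"
  "all_lyndon_factors (add_mset t m) = lyndon_factors t + all_lyndon_factors m"
  "all_lyndon_factors (m + n) = all_lyndon_factors m + all_lyndon_factors n"
  by (simp_all add: all_lyndon_factors_def)

definition reduced_monomials :: "nat \<Rightarrow> 'x set \<Rightarrow> 'x multiset set" where
  "reduced_monomials p X = {m. set_mset m \<subseteq> X \<and> (\<forall>x. count m x < p)}"

abbreviation lyndon_power :: "nat \<Rightarrow> 's list \<Rightarrow> nat \<Rightarrow> 's list" where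
  "lyndon_power p l k \<equiv> concat (replicate (p ^ k) l)"

lemma TL_E:
  assumes "t \<in> TL p S"
  obtains l k where "l \<in> Lyn S" "t = lyndon_power p l k"
  using assms by (auto simp: TL_def)

lemma lyndon_power_eq_iff:
  assumes "1 < p" "l \<in> Lyn S" "l' \<in> Lyn S"
  shows "lyndon_power p l k = lyndon_power p l' k' \<longleftrightarrow> l = l' \<and> k = k'"
  using lyndon_power_inj[OF assms(2,3), of "p ^ k" "p ^ k'"] assms(1) by auto

lemma count_all_lyndon_factors:
  assumes "1 < p" "set_mset m \<subseteq> TL p S" "l \<in> Lyn S"
    and "\<And>k. lyndon_power p l k \<in># m \<Longrightarrow> k < K"
  shows "count (all_lyndon_factors m) l = (\<Sum>k<K. count m (lyndon_power p l k) * p ^ k)"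
  using assms(2,4)
proof (induction m)
  case (add t m)
  then obtain l' k' where t: "l' \<in> Lyn S" "t = lyndon_power p l' k'" by (auto elim: TL_E)
  have "count (lyndon_factors t) l = (if l = l' then p ^ k' else 0)"
    using t by (simp add: lyndon_factors_power)
  also have "\<dots> = (\<Sum>k<K. (if k = k' then if l = l' then p ^ k else 0 else 0))"
    using add.prems(2)[of k'] t by (auto simp: sum.delta)
  finally have "count (lyndon_factors t) l = (\<Sum>k<K. (if t = lyndon_power p l k then p ^ k else 0))"
    using lyndon_power_eq_iff[OF assms(1) t(1) assms(3)] t(2) by (auto intro!: sum.cong)
  with add show ?case
    by (auto simp: sum.distrib[symmetric] intro!: sum.cong)
qed simp

text \<open>
Each \<open>l^(p^k)\<close> contributes \<open>p^k\<close> copies of \<open>l\<close>, so the exponents of a reduced monomial are the base \<open>p\<close>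
digits of the multiplicities of the Lyndon words.
\<close>

lemma count_all_lyndon_factors_digit:
  assumes "1 < p" "m \<in> reduced_monomials p (TL p S)" "l \<in> Lyn S"
  shows "count (all_lyndon_factors m) l div p ^ j mod p = count m (lyndon_power p l j)"
proof -
  have "inj (lyndon_power p l)" using lyndon_power_eq_iff[OF assms(1,3,3)] by (auto intro: injI)
  then have "finite (lyndon_power p l -` set_mset m)" by (intro finite_vimageI) auto
  then obtain K where K: "lyndon_power p l -` set_mset m \<subseteq> {..<K}" by (auto dest: finite_nat_bounded)
  have "count (all_lyndon_factors m) l = (\<Sum>k<K + Suc j. count m (lyndon_power p l k) * p ^ k)"
    by (rule count_all_lyndon_factors[OF assms(1) _ assms(3)])
      (use K assms(2) in \<open>auto simp: reduced_monomials_def\<close>)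
  then show ?thesis
    using assms(2) by (simp only:) (rule digit_of_sum; auto simp: reduced_monomials_def)
qed

lemma set_all_lyndon_factors:
  "set_mset m \<subseteq> TL p S \<Longrightarrow> set_mset (all_lyndon_factors m) \<subseteq> Lyn S"
proof (induction m)
  case (add t m)
  then obtain l' k' where t: "l' \<in> Lyn S" "t = lyndon_power p l' k'" by (auto elim: TL_E)
  with add show ?case by (auto simp: lyndon_factors_power split: if_splits)
qed simp

lemma all_lyndon_factors_inj:
  assumes "1 < p" "m \<in> reduced_monomials p (TL p S)" "n \<in> reduced_monomials p (TL p S)"
    and "all_lyndon_factors m = all_lyndon_factors n"
  shows "m = n"
proof (rule multiset_eqI)
  fix t
  show "count m t = count n t"
  proof (cases "t \<in> TL p S")
    case True
    then show ?thesis
      using count_all_lyndon_factors_digit[OF assms(1,2)] count_all_lyndon_factors_digit[OF assms(1,3)]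
        assms(4) by (metis TL_E)
  next
    case False
    then have "t \<notin># m" "t \<notin># n" using assms(2,3) by (auto simp: reduced_monomials_def)
    then show ?thesis by (metis count_eq_zero_iff)
  qed
qed

lemma all_lyndon_factors_surj:
  fixes S :: "'s::linorder set"
  assumes "1 < p" "set_mset M \<subseteq> Lyn S"
  obtains m where "m \<in> reduced_monomials p (TL p S)" "all_lyndon_factors m = M"
proof -
  \<comment> \<open>More than enough digits: multiplicities in \<open>M\<close> are at most \<open>size M < p ^ size M\<close>.\<close>
  define K where "K = size M"
  define d where "d l k = count M l div p ^ k mod p" for l k
  define m where "m = (\<Sum>l\<in>set_mset M. \<Sum>k<K. replicate_mset (d l k) (lyndon_power p l k))"
  have factors_sum: "all_lyndon_factors (sum f A) = (\<Sum>x\<in>A. all_lyndon_factors (f x))"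
    if "finite A" for A :: "'x set" and f :: "'x \<Rightarrow> 's list multiset"
    using that by (induction A) auto
  have factors_replicate: "all_lyndon_factors (replicate_mset n t) = repeat_mset n (lyndon_factors t)"
    for n and t :: "'s list" by (induction n) auto
  have "all_lyndon_factors m = (\<Sum>l\<in>set_mset M. \<Sum>k<K. replicate_mset (d l k * p ^ k) l)"
    unfolding m_def
  proof (simp add: factors_sum factors_replicate, intro sum.cong refl)
    fix l k assume "l \<in># M"
    then have "lyndon_factors (lyndon_power p l k) = replicate_mset (p ^ k) l"
      using assms(2) by (auto intro: lyndon_factors_power)
    then show "repeat_mset (d l k) (lyndon_factors (lyndon_power p l k)) = replicate_mset (d l k * p ^ k) l"
      by (intro multiset_eqI) simp
  qed
  also have "\<dots> = M"
  proof (rule multiset_eqI)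
    fix l
    have "count (\<Sum>l\<in>set_mset M. \<Sum>k<K. replicate_mset (d l k * p ^ k) l) l =
      (\<Sum>l'\<in>set_mset M. if l' = l then \<Sum>k<K. d l k * p ^ k else 0)"
      unfolding count_sum by (intro sum.cong refl) auto
    also have "\<dots> = (if l \<in># M then count M l mod p ^ K else 0)"
      by (simp add: sum.delta d_def sum_of_digits)
    also have "\<dots> = count M l"
    proof -
      have "count M l \<le> K" unfolding K_def by (rule count_le_size)
      also have "K < p ^ K" using assms(1) by (simp add: power_gt_expt)
      finally show ?thesis by (simp add: count_eq_zero_iff)
    qed
    finally show "count (\<Sum>l\<in>set_mset M. \<Sum>k<K. replicate_mset (d l k * p ^ k) l) l = count M l" .
  qed
  finally have "all_lyndon_factors m = M" .
  moreover have "m \<in> reduced_monomials p (TL p S)"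
  proof -
    have "set_mset m \<subseteq> TL p S" using assms(2)
      by (auto simp: m_def TL_def set_mset_sum split: if_splits)
    moreover have "count m t < p" for t
    proof -
      have m: "count m t = (\<Sum>l\<in>set_mset M. \<Sum>k<K. if t = lyndon_power p l k then d l k else 0)"
        by (auto simp: m_def count_sum intro!: sum.cong)
      show ?thesis
      proof (cases "\<exists>l0\<in>Lyn S. \<exists>k0. t = lyndon_power p l0 k0")
        case True
        then obtain l0 k0 where t: "l0 \<in> Lyn S" "t = lyndon_power p l0 k0" by blast
        have "count m t = (\<Sum>l\<in>set_mset M. if l = l0 then \<Sum>k<K. if k = k0 then d l k else 0 else 0)"
          unfolding m
        proof (rule sum.cong[OF refl])
          fix l assume "l \<in># M"
          then have "t = lyndon_power p l k \<longleftrightarrow> l = l0 \<and> k = k0" for k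
            using t lyndon_power_eq_iff[OF assms(1) t(1), of l] assms(2) by auto
          then show "(\<Sum>k<K. if t = lyndon_power p l k then d l k else 0) =
            (if l = l0 then \<Sum>k<K. if k = k0 then d l k else 0 else 0)"
            by (auto intro!: sum.neutral sum.cong)
        qed
        also have "\<dots> \<le> d l0 k0" by (auto simp: sum.delta)
        also have "\<dots> < p" using assms(1) by (simp add: d_def)
        finally show ?thesis .
      next
        case False
        then have "count m t = 0" unfolding m using assms(2) by (auto intro!: sum.neutral)
        with assms(1) show ?thesis by simp
      qed
    qed
    ultimately show ?thesis by (simp add: reduced_monomials_def)
  qed
  ultimately show ?thesis using that by blast
qed

text \<open>
For a reduced monomial, the largest word that occurs in the shuffle product of its variables.
\<close>

abbreviation leading_word :: "'s::linorder list multiset \<Rightarrow> 's list" where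
  "leading_word m \<equiv> lyndon_product (all_lyndon_factors m)"

text \<open>
Induction over monomials splits off a variable whose Lyndon word is maximal, because shuffling with
such a power has a known largest result.
\<close>

lemma remove_largest_factor:
  assumes "1 < p" "set_mset m \<subseteq> TL p S" "m \<noteq> {#}"
  obtains l k m' where "m = add_mset (lyndon_power p l k) m'" "l \<in> Lyn S"
    "\<And>x. x \<in># all_lyndon_factors m' \<Longrightarrow> x \<le> l"
proof -
  have factors: "lyndon_factors t \<noteq> {#}" if "t \<in> TL p S" for t
    using that assms(1) by (auto elim!: TL_E simp: lyndon_factors_power simp flip: size_eq_0_iff_empty)
  let ?L = "set_mset (all_lyndon_factors m)"
  obtain t0 where "t0 \<in># m" using assms(3) by auto
  with factors[of t0] assms(2) have "?L \<noteq> {}" by (auto simp: all_lyndon_factors_def)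
  then have "Max ?L \<in> ?L" by (intro Max_in) auto
  then obtain t where t: "t \<in># m" "Max ?L \<in># lyndon_factors t" by (auto simp: all_lyndon_factors_def)
  then obtain l k where l: "l \<in> Lyn S" "t = lyndon_power p l k" using assms(2) by (meson TL_E subsetD)
  with t(2) have "Max ?L = l" by (auto simp: lyndon_factors_power split: if_splits)
  obtain m' where m: "m = add_mset t m'" using t(1) by (metis insert_DiffM)
  show ?thesis
  proof (rule that)
    show "m = add_mset (lyndon_power p l k) m'" using m l by simp
    show "x \<le> l" if "x \<in># all_lyndon_factors m'" for x
      unfolding \<open>Max ?L = l\<close>[symmetric] using that m by (intro Max_ge) auto
  qed (rule l)
qed

context
  fixes p :: nat and S :: "'s::linorder set" and l :: "'s list" and k :: nat and m :: "'s list multiset"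
  assumes l: "l \<in> Lyn S" and m: "set_mset m \<subseteq> TL p S"
    and le: "\<And>x. x \<in># all_lyndon_factors m \<Longrightarrow> x \<le> l"
begin

lemma leading_word_add: "leading_word (add_mset (lyndon_power p l k) m) = lyndon_power p l k @ leading_word m"
  using lyndon_product_add[of "all_lyndon_factors m" l "p ^ k"] le by (simp add: lyndon_factors_power[OF l])

lemma shuffles_le_leading_word:
  assumes "length y = length (leading_word m)" "y \<le> leading_word m" "w \<in> shuffles (lyndon_power p l k) y"
  shows "w \<le> leading_word (add_mset (lyndon_power p l k) m)"
proof -
  obtain ls where ls: "mset ls = all_lyndon_factors m" "sorted_wrt (\<ge>) ls"
    by (rule sorted_list_of_multiset_exists)
  obtain w' where w': "w' \<in> shuffles (lyndon_power p l k) (leading_word m)" "w \<le> w'"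
    using shuffles_mono[OF assms] by blast
  have "set ls = set_mset (all_lyndon_factors m)" using ls(1) by (metis set_mset_mset)
  then have "w' \<le> lyndon_power p l k @ concat ls"
    using l le ls lyndon_product_mset[OF ls(2)] w'(1)
    by (intro lyndon_power_shuffles_le[of l ls]) (auto simp: Lyn_eq)
  with w'(2) lyndon_product_mset[OF ls(2)] show ?thesis
    unfolding leading_word_add by (simp add: ls(1))
qed

lemma shuffles_less_leading_word:
  assumes "length y = length (leading_word m)" "y < leading_word m" "w \<in> shuffles (lyndon_power p l k) y"
  shows "w < leading_word (add_mset (lyndon_power p l k) m)"
  using shuffles_strict_mono[OF assms] shuffles_le_leading_word[OF refl order_refl] by (auto intro: less_le_trans)

text \<open>
If \<open>b\<close> is the multiplicity of \<open>l\<close> in the word of \<open>m\<close>, the number is \<open>p^k + b choose p^k\<close>. Modulo \<open>p\<close>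
it equals the exponent of \<open>l^(p^k)\<close> in the larger monomial, which lies strictly between \<open>0\<close> and \<open>p\<close>.
\<close>

lemma shuffle_count_leading_word:
  assumes p: "Factorial_Ring.prime p" and red: "add_mset (lyndon_power p l k) m \<in> reduced_monomials p (TL p S)"
  shows "\<not> p dvd shuffle_count (lyndon_power p l k) (leading_word m)
    (leading_word (add_mset (lyndon_power p l k) m))"
proof -
  let ?M = "all_lyndon_factors m" and ?m = "add_mset (lyndon_power p l k) m"
  define b where "b = count ?M l"
  obtain ls where ls: "mset ls = filter_mset (\<lambda>x. x \<noteq> l) ?M" "sorted_wrt (\<ge>) ls"
    by (rule sorted_list_of_multiset_exists)
  have M: "?M = replicate_mset b l + mset ls"
    unfolding ls(1) b_def by (intro multiset_eqI) auto
  have less: "\<forall>x\<in>set ls. x < l"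
  proof
    fix x assume "x \<in> set ls"
    then have "x \<in># filter_mset (\<lambda>x. x \<noteq> l) ?M" by (simp flip: ls(1))
    with le[of x] show "x < l" by auto
  qed
  then have "x \<le> l" if "x \<in># mset ls" for x using that by auto
  then have "leading_word m = concat (replicate b l) @ concat ls"
    unfolding M using lyndon_product_add[of "mset ls" l b] lyndon_product_mset[OF ls(2)] by simp
  moreover from this have "leading_word ?m = concat (replicate (p ^ k + b) l) @ concat ls"
    unfolding leading_word_add by (simp add: replicate_add)
  moreover have "lyndon l" using l by (simp add: Lyn_eq)
  ultimately have "shuffle_count (lyndon_power p l k) (leading_word m) (leading_word ?m)
      = (p ^ k + b) choose (p ^ k)"
    using shuffle_count_lyndon_powers[OF _ less ls(2)] by simp
  moreover have "[(p ^ k + b) choose (p ^ k) = (p ^ k + b) div p ^ k] (mod p)"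
    by (rule choose_prime_power_cong[OF p])
  moreover have "p ^ k + b = count (all_lyndon_factors ?m) l"
    by (simp add: lyndon_factors_power[OF l] b_def)
  then have "(p ^ k + b) div p ^ k mod p = count ?m (lyndon_power p l k)"
    using count_all_lyndon_factors_digit[OF _ red l] prime_gt_1_nat[OF p] by simp
  ultimately show ?thesis by (simp add: cong_def mod_eq_0_iff_dvd[symmetric])
qed

end

section \<open>Free modules with a bilinear product\<close>

definition finsupp :: "('k, 'c) ring_scheme \<Rightarrow> 'b set \<Rightarrow> ('b \<Rightarrow> 'k) set" where
  "finsupp R B = {f. (\<forall>x. f x \<in> carrier R) \<and> (\<forall>x. x \<notin> B \<longrightarrow> f x = \<zero>\<^bsub>R\<^esub>) \<and> finite {x. f x \<noteq> \<zero>\<^bsub>R\<^esub>}}"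

lemma free_algebra_simps:
  "carrier (free_algebra R B e m) = finsupp R B"
  "f \<otimes>\<^bsub>free_algebra R B e m\<^esub> g = (\<lambda>w. \<Oplus>\<^bsub>R\<^esub>u\<in>{u. f u \<noteq> \<zero>\<^bsub>R\<^esub>}. \<Oplus>\<^bsub>R\<^esub>v\<in>{v. g v \<noteq> \<zero>\<^bsub>R\<^esub>}.
        f u \<otimes>\<^bsub>R\<^esub> g v \<otimes>\<^bsub>R\<^esub> m u v w)"
  "\<one>\<^bsub>free_algebra R B e m\<^esub> = free_gen R e"
  "\<zero>\<^bsub>free_algebra R B e m\<^esub> = (\<lambda>_. \<zero>\<^bsub>R\<^esub>)"
  "f \<oplus>\<^bsub>free_algebra R B e m\<^esub> g = (\<lambda>w. f w \<oplus>\<^bsub>R\<^esub> g w)"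
  "c \<odot>\<^bsub>free_algebra R B e m\<^esub> f = (\<lambda>w. c \<otimes>\<^bsub>R\<^esub> f w)"
  by (simp_all add: free_algebra_def finsupp_def)

lemma finsupp_mono: "A \<subseteq> B \<Longrightarrow> f \<in> finsupp R A \<Longrightarrow> f \<in> finsupp R B"
  by (auto simp: finsupp_def)

context cring
begin

lemma finsuppD:
  assumes "f \<in> finsupp R B"
  shows "f x \<in> carrier R" "x \<notin> B \<Longrightarrow> f x = \<zero>" "finite {x. f x \<noteq> \<zero>}" "{x. f x \<noteq> \<zero>} \<subseteq> B"
  using assms by (auto simp: finsupp_def)

lemma finsuppI:
  assumes "\<And>x. f x \<in> carrier R" "finite X" "X \<subseteq> B" "\<And>x. x \<notin> X \<Longrightarrow> f x = \<zero>"
  shows "f \<in> finsupp R B"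
proof -
  have "{x. f x \<noteq> \<zero>} \<subseteq> X" using assms(4) by auto
  with assms show ?thesis by (auto simp: finsupp_def intro: finite_subset)
qed

lemma free_gen_closed: "b \<in> B \<Longrightarrow> free_gen R b \<in> finsupp R B"
  by (rule finsuppI[of _ "{b}"]) (auto simp: free_gen_def)

lemma zero_finsupp: "(\<lambda>_. \<zero>) \<in> finsupp R B"
  by (rule finsuppI[of _ "{}"]) auto

lemma add_finsupp: "f \<in> finsupp R B \<Longrightarrow> g \<in> finsupp R B \<Longrightarrow> (\<lambda>x. f x \<oplus> g x) \<in> finsupp R B"
  by (rule finsuppI[of _ "{x. f x \<noteq> \<zero>} \<union> {x. g x \<noteq> \<zero>}"])
    (use finsuppD[of f B] finsuppD[of g B] in auto)

lemma smult_finsupp: "c \<in> carrier R \<Longrightarrow> f \<in> finsupp R B \<Longrightarrow> (\<lambda>x. c \<otimes> f x) \<in> finsupp R B"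
  by (rule finsuppI[of _ "{x. f x \<noteq> \<zero>}"]) (use finsuppD[of f B] in auto)

text \<open>
Linear statements need to be checked on basis elements only.
\<close>

lemma finsupp_induct [consumes 1, case_names zero add]:
  assumes "f \<in> finsupp R B" "P (\<lambda>_. \<zero>)"
    and step: "\<And>c b f. \<lbrakk>c \<in> carrier R; b \<in> B; f \<in> finsupp R B; P f\<rbrakk> \<Longrightarrow> P (\<lambda>x. c \<otimes> free_gen R b x \<oplus> f x)"
  shows "P f"
proof -
  have "P f" if "finite F" "f \<in> finsupp R B" "{x. f x \<noteq> \<zero>} \<subseteq> F" for F f
    using that
  proof (induction F arbitrary: f)
    case empty
    then have "f = (\<lambda>_. \<zero>)" by auto
    with assms(2) show ?case by simp
  next
    case (insert b F)
    show ?case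
    proof (cases "b \<in> B")
      case True
      have f': "f(b := \<zero>) \<in> finsupp R B"
        by (rule finsuppI[of _ "{x. f x \<noteq> \<zero>}"]) (use finsuppD[OF insert.prems(1)] in auto)
      moreover have "P (f(b := \<zero>))" by (rule insert.IH[OF f']) (use insert.prems in auto)
      ultimately have "P (\<lambda>x. f b \<otimes> free_gen R b x \<oplus> (f(b := \<zero>)) x)"
        using True finsuppD(1)[OF insert.prems(1)] by (intro step)
      moreover have "(\<lambda>x. f b \<otimes> free_gen R b x \<oplus> (f(b := \<zero>)) x) = f"
        using finsuppD(1)[OF insert.prems(1)] by (auto simp: free_gen_def)
      ultimately show ?thesis by simp
    next
      case False
      then have "f b = \<zero>" using finsuppD(2)[OF insert.prems(1)] by simp
      then have "{x. f x \<noteq> \<zero>} \<subseteq> F" using insert.prems(2) by auto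
      with insert show ?thesis by blast
    qed
  qed
  with assms(1) finsuppD(3) show ?thesis by blast
qed

lemma finsum_single: "f x \<in> carrier R \<Longrightarrow> (\<Oplus>y\<in>{x}. f y) = f x"
  by (subst finsum_insert) auto

lemma double_finsum_cong:
  assumes "\<And>u v. u \<in> U \<Longrightarrow> v \<in> V \<Longrightarrow> a u v = b u v" "\<And>u v. u \<in> U \<Longrightarrow> v \<in> V \<Longrightarrow> b u v \<in> carrier R"
  shows "(\<Oplus>u\<in>U. \<Oplus>v\<in>V. a u v) = (\<Oplus>u\<in>U. \<Oplus>v\<in>V. b u v)"
proof (rule finsum_cong'[OF refl])
  show "(\<lambda>u. \<Oplus>v\<in>V. b u v) \<in> U \<rightarrow> carrier R" using assms(2) by (auto intro!: finsum_closed)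
  show "(\<Oplus>v\<in>V. a u v) = (\<Oplus>v\<in>V. b u v)" if "u \<in> U" for u
    by (rule finsum_cong'[OF refl]) (use assms that in auto)
qed

lemma double_finsum_add:
  assumes a: "\<And>u v. u \<in> U \<Longrightarrow> v \<in> V \<Longrightarrow> a u v \<in> carrier R"
    and b: "\<And>u v. u \<in> U \<Longrightarrow> v \<in> V \<Longrightarrow> b u v \<in> carrier R"
  shows "(\<Oplus>u\<in>U. \<Oplus>v\<in>V. a u v \<oplus> b u v) = (\<Oplus>u\<in>U. \<Oplus>v\<in>V. a u v) \<oplus> (\<Oplus>u\<in>U. \<Oplus>v\<in>V. b u v)"
proof -
  have closed: "(\<Oplus>v\<in>V. a u v) \<in> carrier R" "(\<Oplus>v\<in>V. b u v) \<in> carrier R" if "u \<in> U" for u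
    using a b that by (auto intro!: finsum_closed)
  have "(\<Oplus>u\<in>U. \<Oplus>v\<in>V. a u v \<oplus> b u v) = (\<Oplus>u\<in>U. (\<Oplus>v\<in>V. a u v) \<oplus> (\<Oplus>v\<in>V. b u v))"
  proof (rule finsum_cong'[OF refl])
    show "(\<Oplus>v\<in>V. a u v \<oplus> b u v) = (\<Oplus>v\<in>V. a u v) \<oplus> (\<Oplus>v\<in>V. b u v)" if "u \<in> U" for u
      by (rule finsum_addf) (use a b that in auto)
  qed (use closed in auto)
  also have "\<dots> = (\<Oplus>u\<in>U. \<Oplus>v\<in>V. a u v) \<oplus> (\<Oplus>u\<in>U. \<Oplus>v\<in>V. b u v)"
    by (rule finsum_addf) (use closed in auto)
  finally show ?thesis .
qed

lemma double_finsum_smult: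
  assumes c: "c \<in> carrier R" and "finite U" "finite V"
    and a: "\<And>u v. u \<in> U \<Longrightarrow> v \<in> V \<Longrightarrow> a u v \<in> carrier R"
  shows "(\<Oplus>u\<in>U. \<Oplus>v\<in>V. c \<otimes> a u v) = c \<otimes> (\<Oplus>u\<in>U. \<Oplus>v\<in>V. a u v)"
proof -
  have closed: "(\<Oplus>v\<in>V. a u v) \<in> carrier R" if "u \<in> U" for u
    using a that by (auto intro!: finsum_closed)
  have "(\<Oplus>u\<in>U. \<Oplus>v\<in>V. c \<otimes> a u v) = (\<Oplus>u\<in>U. c \<otimes> (\<Oplus>v\<in>V. a u v))"
  proof (rule finsum_cong'[OF refl])
    show "(\<Oplus>v\<in>V. c \<otimes> a u v) = c \<otimes> (\<Oplus>v\<in>V. a u v)" if "u \<in> U" for u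
      by (rule finsum_rdistr[symmetric]) (use assms that in auto)
  qed (use closed c in auto)
  also have "\<dots> = c \<otimes> (\<Oplus>u\<in>U. \<Oplus>v\<in>V. a u v)"
    by (rule finsum_rdistr[symmetric]) (use assms closed in auto)
  finally show ?thesis .
qed

lemma free_module: "module R (free_algebra R B e m)"
proof (rule moduleI)
  show "abelian_group (free_algebra R B e m)"
  proof (rule abelian_groupI; unfold free_algebra_simps)
    fix f assume "f \<in> finsupp R B"
    then show "\<exists>g \<in> finsupp R B. (\<lambda>w. g w \<oplus> f w) = (\<lambda>_. \<zero>)"
      by (intro bexI[of _ "\<lambda>w. \<ominus> \<one> \<otimes> f w"] smult_finsupp) (simp_all add: finsuppD(1)[of f B] l_minus l_neg)
  qed (simp_all add: finsuppD(1)[of _ B] add_finsupp zero_finsupp a_ac)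
qed (simp_all add: free_algebra_simps smult_finsupp l_distr r_distr m_assoc finsuppD(1)[of _ B] is_cring)

end

locale free_bilinear = cring R for R (structure) +
  fixes B :: "'x set" and e :: 'x and m :: "'x \<Rightarrow> 'x \<Rightarrow> 'x \<Rightarrow> 'a"
  assumes e_closed: "e \<in> B"
    and m_closed: "u \<in> B \<Longrightarrow> v \<in> B \<Longrightarrow> m u v \<in> finsupp R B"
begin

abbreviation A where "A \<equiv> free_algebra R B e m"

abbreviation product (infixl \<open>\<star>\<close> 70) where "f \<star> g \<equiv> f \<otimes>\<^bsub>A\<^esub> g"

text \<open>
Summing over larger index sets than the supports makes the products of different elements
comparable term by term.
\<close>

lemma mult_eq:
  assumes f: "f \<in> finsupp R B" and U: "finite U" "U \<subseteq> B" "\<And>x. x \<notin> U \<Longrightarrow> f x = \<zero>"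
    and g: "g \<in> finsupp R B" and V: "finite V" "V \<subseteq> B" "\<And>x. x \<notin> V \<Longrightarrow> g x = \<zero>"
  shows "(f \<star> g) w = (\<Oplus>u\<in>U. \<Oplus>v\<in>V. f u \<otimes> g v \<otimes> m u v w)"
proof -
  have m: "m u v w \<in> carrier R" if "u \<in> B" "v \<in> B" for u v
    using m_closed[OF that] by (rule finsuppD(1))
  have c: "f u \<otimes> g v \<otimes> m u v w \<in> carrier R" if "u \<in> B" "v \<in> B" for u v
    using m[OF that] finsuppD(1)[OF f] finsuppD(1)[OF g] by simp
  have inner: "(\<Oplus>v\<in>{v. g v \<noteq> \<zero>}. f u \<otimes> g v \<otimes> m u v w) = (\<Oplus>v\<in>V. f u \<otimes> g v \<otimes> m u v w)" if "u \<in> B" for u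
    by (rule add.finprod_mono_neutral_cong_left[OF V(1)])
      (use V that c m finsuppD[OF f] finsuppD[OF g] in auto)
  have "(\<Oplus>u\<in>{u. f u \<noteq> \<zero>}. \<Oplus>v\<in>{v. g v \<noteq> \<zero>}. f u \<otimes> g v \<otimes> m u v w) = (\<Oplus>u\<in>U. \<Oplus>v\<in>V. f u \<otimes> g v \<otimes> m u v w)"
  proof (rule add.finprod_mono_neutral_cong_left[OF U(1)])
    fix u assume u: "u \<in> U - {u. f u \<noteq> \<zero>}"
    have "m u v w \<in> carrier R" if "v \<in> V" for v using that u U(2) V(2) by (intro m) auto
    with u have "(\<Oplus>v\<in>V. f u \<otimes> g v \<otimes> m u v w) = (\<Oplus>v\<in>V. \<zero>)"
      using finsuppD(1)[OF g] by (intro finsum_cong') auto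
    then show "(\<Oplus>v\<in>V. f u \<otimes> g v \<otimes> m u v w) = \<zero>" by (simp add: finsum_zero)
  next
    show "(\<lambda>u. \<Oplus>v\<in>V. f u \<otimes> g v \<otimes> m u v w) \<in> U \<rightarrow> carrier R"
      using U(2) V(2) by (intro Pi_I finsum_closed c) auto
  qed (use U(3) finsuppD[OF f] in \<open>auto intro: inner\<close>)
  then show ?thesis by (simp add: free_algebra_simps)
qed

lemma mult_zero_left: "(\<lambda>_. \<zero>) \<star> g = (\<lambda>_. \<zero>)"
  unfolding free_algebra_simps(2) by simp

lemma mult_zero_right: "g \<star> (\<lambda>_. \<zero>) = (\<lambda>_. \<zero>)"
  unfolding free_algebra_simps(2) by simp

lemma mult_linear_left:
  assumes c: "c \<in> carrier R" and f: "f \<in> finsupp R B" and g: "g \<in> finsupp R B" and h: "h \<in> finsupp R B"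
  shows "(\<lambda>w. c \<otimes> f w \<oplus> g w) \<star> h = (\<lambda>w. c \<otimes> (f \<star> h) w \<oplus> (g \<star> h) w)"
proof
  fix w
  let ?U = "{x. f x \<noteq> \<zero>} \<union> {x. g x \<noteq> \<zero>}" and ?V = "{x. h x \<noteq> \<zero>}"
  note [simp] = c finsuppD(1)[OF f] finsuppD(1)[OF g] finsuppD(1)[OF h]
  have U: "finite ?U" "?U \<subseteq> B" and V: "finite ?V" "?V \<subseteq> B"
    using finsuppD[OF f] finsuppD[OF g] finsuppD[OF h] by auto
  have m: "m u v w \<in> carrier R" if "u \<in> ?U" "v \<in> ?V" for u v
    using that U V m_closed by (blast intro: finsuppD(1))
  have "((\<lambda>w. c \<otimes> f w \<oplus> g w) \<star> h) w = (\<Oplus>u\<in>?U. \<Oplus>v\<in>?V. (c \<otimes> f u \<oplus> g u) \<otimes> h v \<otimes> m u v w)"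
    by (rule mult_eq) (use U V add_finsupp[OF smult_finsupp[OF c f] g] h in auto)
  also have "\<dots> = (\<Oplus>u\<in>?U. \<Oplus>v\<in>?V. c \<otimes> (f u \<otimes> h v \<otimes> m u v w) \<oplus> g u \<otimes> h v \<otimes> m u v w)"
    by (rule double_finsum_cong) (simp_all add: m l_distr r_distr m_ac)
  also have "\<dots> = (\<Oplus>u\<in>?U. \<Oplus>v\<in>?V. c \<otimes> (f u \<otimes> h v \<otimes> m u v w)) \<oplus> (\<Oplus>u\<in>?U. \<Oplus>v\<in>?V. g u \<otimes> h v \<otimes> m u v w)"
    by (rule double_finsum_add) (simp_all add: m)
  also have "(\<Oplus>u\<in>?U. \<Oplus>v\<in>?V. c \<otimes> (f u \<otimes> h v \<otimes> m u v w)) = c \<otimes> (\<Oplus>u\<in>?U. \<Oplus>v\<in>?V. f u \<otimes> h v \<otimes> m u v w)"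
    by (rule double_finsum_smult) (use U V m in auto)
  also have "(\<Oplus>u\<in>?U. \<Oplus>v\<in>?V. f u \<otimes> h v \<otimes> m u v w) = (f \<star> h) w"
    by (rule mult_eq[symmetric]) (use U V f h in auto)
  also have "(\<Oplus>u\<in>?U. \<Oplus>v\<in>?V. g u \<otimes> h v \<otimes> m u v w) = (g \<star> h) w"
    by (rule mult_eq[symmetric]) (use U V g h in auto)
  finally show "((\<lambda>w. c \<otimes> f w \<oplus> g w) \<star> h) w = c \<otimes> (f \<star> h) w \<oplus> (g \<star> h) w" .
qed

lemma mult_linear_right:
  assumes c: "c \<in> carrier R" and f: "f \<in> finsupp R B" and g: "g \<in> finsupp R B" and h: "h \<in> finsupp R B"
  shows "h \<star> (\<lambda>w. c \<otimes> f w \<oplus> g w) = (\<lambda>w. c \<otimes> (h \<star> f) w \<oplus> (h \<star> g) w)"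
proof
  fix w
  let ?U = "{x. f x \<noteq> \<zero>} \<union> {x. g x \<noteq> \<zero>}" and ?V = "{x. h x \<noteq> \<zero>}"
  note [simp] = c finsuppD(1)[OF f] finsuppD(1)[OF g] finsuppD(1)[OF h]
  have U: "finite ?U" "?U \<subseteq> B" and V: "finite ?V" "?V \<subseteq> B"
    using finsuppD[OF f] finsuppD[OF g] finsuppD[OF h] by auto
  have m: "m v u w \<in> carrier R" if "u \<in> ?U" "v \<in> ?V" for u v
    using that U V m_closed by (blast intro: finsuppD(1))
  have "(h \<star> (\<lambda>w. c \<otimes> f w \<oplus> g w)) w = (\<Oplus>v\<in>?V. \<Oplus>u\<in>?U. h v \<otimes> (c \<otimes> f u \<oplus> g u) \<otimes> m v u w)"
    by (rule mult_eq) (use U V add_finsupp[OF smult_finsupp[OF c f] g] h in auto)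
  also have "\<dots> = (\<Oplus>v\<in>?V. \<Oplus>u\<in>?U. c \<otimes> (h v \<otimes> f u \<otimes> m v u w) \<oplus> h v \<otimes> g u \<otimes> m v u w)"
    by (rule double_finsum_cong) (simp_all add: m l_distr r_distr m_ac)
  also have "\<dots> = (\<Oplus>v\<in>?V. \<Oplus>u\<in>?U. c \<otimes> (h v \<otimes> f u \<otimes> m v u w)) \<oplus> (\<Oplus>v\<in>?V. \<Oplus>u\<in>?U. h v \<otimes> g u \<otimes> m v u w)"
    by (rule double_finsum_add) (simp_all add: m)
  also have "(\<Oplus>v\<in>?V. \<Oplus>u\<in>?U. c \<otimes> (h v \<otimes> f u \<otimes> m v u w)) = c \<otimes> (\<Oplus>v\<in>?V. \<Oplus>u\<in>?U. h v \<otimes> f u \<otimes> m v u w)"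
    by (rule double_finsum_smult) (use U V m in auto)
  also have "(\<Oplus>v\<in>?V. \<Oplus>u\<in>?U. h v \<otimes> f u \<otimes> m v u w) = (h \<star> f) w"
    by (rule mult_eq[symmetric]) (use U V f h in auto)
  also have "(\<Oplus>v\<in>?V. \<Oplus>u\<in>?U. h v \<otimes> g u \<otimes> m v u w) = (h \<star> g) w"
    by (rule mult_eq[symmetric]) (use U V g h in auto)
  finally show "(h \<star> (\<lambda>w. c \<otimes> f w \<oplus> g w)) w = c \<otimes> (h \<star> f) w \<oplus> (h \<star> g) w" .
qed

lemma mult_value_closed:
  assumes f: "f \<in> finsupp R B" and g: "g \<in> finsupp R B"
  shows "(f \<star> g) w \<in> carrier R"
  unfolding free_algebra_simps(2)
proof (intro finsum_closed Pi_I)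
  fix u v assume "u \<in> {u. f u \<noteq> \<zero>}" "v \<in> {v. g v \<noteq> \<zero>}"
  then have "m u v \<in> finsupp R B" using finsuppD(4)[OF f] finsuppD(4)[OF g] by (blast intro: m_closed)
  then show "f u \<otimes> g v \<otimes> m u v w \<in> carrier R"
    using finsuppD(1)[OF f] finsuppD(1)[OF g] by (simp add: finsuppD(1)[of "m u v"])
qed

lemma mult_add_left:
  assumes f: "f \<in> finsupp R B" and g: "g \<in> finsupp R B" and h: "h \<in> finsupp R B"
  shows "(\<lambda>w. f w \<oplus> g w) \<star> h = (\<lambda>w. (f \<star> h) w \<oplus> (g \<star> h) w)"
  using mult_linear_left[OF one_closed assms] finsuppD(1)[OF f] mult_value_closed[OF f h] by simp

lemma mult_add_right:
  assumes f: "f \<in> finsupp R B" and g: "g \<in> finsupp R B" and h: "h \<in> finsupp R B"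
  shows "h \<star> (\<lambda>w. f w \<oplus> g w) = (\<lambda>w. (h \<star> f) w \<oplus> (h \<star> g) w)"
  using mult_linear_right[OF one_closed assms] finsuppD(1)[OF f] mult_value_closed[OF h f] by simp

lemma mult_smult_left:
  assumes c: "c \<in> carrier R" and f: "f \<in> finsupp R B" and g: "g \<in> finsupp R B"
  shows "(\<lambda>w. c \<otimes> f w) \<star> g = (\<lambda>w. c \<otimes> (f \<star> g) w)"
  using mult_linear_left[OF c f zero_finsupp g] c finsuppD(1)[OF f] mult_value_closed[OF f g]
  by (simp add: mult_zero_left)

lemma mult_smult_right:
  assumes c: "c \<in> carrier R" and f: "f \<in> finsupp R B" and g: "g \<in> finsupp R B"
  shows "f \<star> (\<lambda>w. c \<otimes> g w) = (\<lambda>w. c \<otimes> (f \<star> g) w)"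
  using mult_linear_right[OF c g zero_finsupp f] c finsuppD(1)[OF g] mult_value_closed[OF f g]
  by (simp add: mult_zero_right)

lemma mult_gen_gen:
  assumes u: "u \<in> B" and v: "v \<in> B"
  shows "free_gen R u \<star> free_gen R v = m u v"
proof (rule ext)
  fix w
  have m: "m u v w \<in> carrier R" by (rule finsuppD(1)[OF m_closed[OF u v]])
  have zero: "free_gen R b x = \<zero>" if "x \<notin> {b}" for b x :: 'x
    using that by (simp add: free_gen_def)
  have one: "free_gen R b b = \<one>" for b :: 'x by (simp add: free_gen_def)
  have "(free_gen R u \<star> free_gen R v) w =
      (\<Oplus>x\<in>{u}. \<Oplus>y\<in>{v}. free_gen R x x \<otimes> free_gen R y y \<otimes> m x y w)"
    by (subst mult_eq[where U = "{u}" and V = "{v}"])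
      (use u v m free_gen_closed[OF u] free_gen_closed[OF v] zero in
        \<open>auto intro!: double_finsum_cong simp only: one l_one one_closed\<close>)
  also have "\<dots> = (\<Oplus>y\<in>{v}. free_gen R u u \<otimes> free_gen R y y \<otimes> m u y w)"
    by (rule finsum_single, subst finsum_single) (use m in \<open>auto simp only: one l_one one_closed\<close>)
  also have "\<dots> = free_gen R u u \<otimes> free_gen R v v \<otimes> m u v w"
    by (rule finsum_single) (use m in \<open>auto simp only: one l_one one_closed\<close>)
  also have "\<dots> = m u v w" using m by (simp only: one l_one one_closed)
  finally show "(free_gen R u \<star> free_gen R v) w = m u v w" .
qed

lemma mult_closed:
  assumes "f \<in> finsupp R B" "g \<in> finsupp R B"
  shows "f \<star> g \<in> finsupp R B"
  using assms(1)
proof (induction rule: finsupp_induct)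
  case zero
  show ?case by (simp add: mult_zero_left zero_finsupp)
next
  case (add c u f)
  have "free_gen R u \<star> g \<in> finsupp R B"
    using assms(2)
  proof (induction rule: finsupp_induct)
    case zero
    show ?case by (simp add: mult_zero_right zero_finsupp)
  next
    case (add d v g)
    then show ?case using \<open>u \<in> B\<close>
      by (simp add: mult_add_right smult_finsupp free_gen_closed mult_smult_right mult_gen_gen m_closed add_finsupp)
  qed
  with add assms(2) show ?case
    by (simp add: mult_add_left smult_finsupp free_gen_closed mult_smult_left add_finsupp)
qed

end

text \<open>
The axioms of a commutative algebra are multilinear in the elements that they mention, so it is
enough to require them for basis elements.
\<close>

locale free_comm_algebra = free_bilinear +
  assumes basis_comm: "u \<in> B \<Longrightarrow> v \<in> B \<Longrightarrow> m u v = m v u"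
    and basis_unit: "u \<in> B \<Longrightarrow> m e u = free_gen R u"
    and basis_assoc: "u \<in> B \<Longrightarrow> v \<in> B \<Longrightarrow> w \<in> B \<Longrightarrow> m u v \<star> free_gen R w = free_gen R u \<star> m v w"
begin

lemmas bilinear_simps = mult_add_left mult_add_right mult_smult_left mult_smult_right mult_zero_left
  mult_zero_right mult_gen_gen mult_closed free_gen_closed smult_finsupp add_finsupp m_closed zero_finsupp

lemma mult_commute:
  assumes "f \<in> finsupp R B" "g \<in> finsupp R B"
  shows "f \<star> g = g \<star> f"
  using assms(1)
proof (induction rule: finsupp_induct)
  case (add c u f)
  have "free_gen R u \<star> g = g \<star> free_gen R u"
    using assms(2) add(2) by (induction rule: finsupp_induct) (simp_all add: bilinear_simps basis_comm[of u])
  with add assms(2) show ?case by (simp add: bilinear_simps)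
qed (simp add: bilinear_simps)

lemma mult_unit:
  assumes "f \<in> finsupp R B"
  shows "free_gen R e \<star> f = f"
  using assms by (induction rule: finsupp_induct) (simp_all add: bilinear_simps basis_unit e_closed)

lemma mult_assoc:
  assumes "f \<in> finsupp R B" "g \<in> finsupp R B" "h \<in> finsupp R B"
  shows "f \<star> g \<star> h = f \<star> (g \<star> h)"
  using assms(1)
proof (induction rule: finsupp_induct)
  case (add c u f)
  have "free_gen R u \<star> g \<star> h = free_gen R u \<star> (g \<star> h)"
    using assms(2)
  proof (induction rule: finsupp_induct)
    case (add d v g)
    have "m u v \<star> h = free_gen R u \<star> (free_gen R v \<star> h)"
      using assms(3) \<open>u \<in> B\<close> \<open>v \<in> B\<close>
      by (induction rule: finsupp_induct) (simp_all add: bilinear_simps basis_assoc)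
    with add assms(3) \<open>u \<in> B\<close> show ?case by (simp add: bilinear_simps)
  qed (simp add: bilinear_simps)
  with add assms(2,3) show ?case by (simp add: bilinear_simps)
qed (simp add: bilinear_simps)

lemma algebra: "algebra R A"
proof -
  interpret M: module R A by (rule free_module)
  show ?thesis
  proof (rule algebraI)
    show "cring A"
    proof (rule cringI[OF M.abelian_group_axioms])
      show "comm_monoid A"
      proof (rule comm_monoidI; unfold free_algebra_simps(1,3))
        show "f \<star> g = g \<star> f" if "f \<in> finsupp R B" "g \<in> finsupp R B" for f g
          using that by (rule mult_commute)
      qed (simp_all add: bilinear_simps mult_assoc mult_unit e_closed)
    qed (simp add: free_algebra_simps(1,5) mult_add_left)
    show "c \<odot>\<^bsub>A\<^esub> f \<star> g = c \<odot>\<^bsub>A\<^esub> (f \<star> g)"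
      if "c \<in> carrier R" "f \<in> carrier A" "g \<in> carrier A" for c f g
      using that by (simp add: free_algebra_simps(1,6) mult_smult_left)
  qed (simp_all add: M.smult_l_distr M.smult_r_distr M.smult_assoc1 is_cring)
qed

end

lemma monoid_algebra_algebra:
  assumes "cring R" "comm_monoid M"
  shows "algebra R (monoid_algebra R M)"
proof -
  interpret cring R by fact
  interpret M: comm_monoid M by fact
  interpret free_bilinear R "carrier M" "\<one>\<^bsub>M\<^esub>" "\<lambda>x y. free_gen R (x \<otimes>\<^bsub>M\<^esub> y)"
    by unfold_locales (auto intro: free_gen_closed)
  interpret free_comm_algebra R "carrier M" "\<one>\<^bsub>M\<^esub>" "\<lambda>x y. free_gen R (x \<otimes>\<^bsub>M\<^esub> y)"
    by unfold_locales (auto simp: mult_gen_gen M.m_ac)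
  show ?thesis using algebra by (simp add: monoid_algebra_def)
qed

lemma monoid_algebra_simps:
  "carrier (monoid_algebra R M) = finsupp R (carrier M)"
  "\<one>\<^bsub>monoid_algebra R M\<^esub> = free_gen R \<one>\<^bsub>M\<^esub>"
  "\<zero>\<^bsub>monoid_algebra R M\<^esub> = (\<lambda>_. \<zero>\<^bsub>R\<^esub>)"
  "f \<oplus>\<^bsub>monoid_algebra R M\<^esub> g = (\<lambda>w. f w \<oplus>\<^bsub>R\<^esub> g w)"
  "c \<odot>\<^bsub>monoid_algebra R M\<^esub> f = (\<lambda>w. c \<otimes>\<^bsub>R\<^esub> f w)"
  by (simp_all add: monoid_algebra_def free_algebra_simps)

lemma monoid_algebra_gen_mult:
  assumes "cring R" "comm_monoid M" "x \<in> carrier M" "y \<in> carrier M"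
  shows "free_gen R x \<otimes>\<^bsub>monoid_algebra R M\<^esub> free_gen R y = free_gen R (x \<otimes>\<^bsub>M\<^esub> y)"
proof -
  interpret cring R by fact
  interpret M: comm_monoid M by fact
  interpret free_bilinear R "carrier M" "\<one>\<^bsub>M\<^esub>" "\<lambda>x y. free_gen R (x \<otimes>\<^bsub>M\<^esub> y)"
    by unfold_locales (auto intro: free_gen_closed)
  show ?thesis using mult_gen_gen[OF assms(3,4)] by (simp add: monoid_algebra_def)
qed

section \<open>Homomorphisms of algebras\<close>

definition alg_hom ::
  "('k, 'c) ring_scheme \<Rightarrow> ('k, 'a, 'd) module_scheme \<Rightarrow> ('k, 'b, 'e) module_scheme \<Rightarrow> ('a \<Rightarrow> 'b) set"
  where "alg_hom R A B =
    {h \<in> ring_hom A B. \<forall>c \<in> carrier R. \<forall>x \<in> carrier A. h (c \<odot>\<^bsub>A\<^esub> x) = c \<odot>\<^bsub>B\<^esub> h x}"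

lemma alg_homI:
  assumes "\<And>x. x \<in> carrier A \<Longrightarrow> h x \<in> carrier B"
    and "\<And>x y. x \<in> carrier A \<Longrightarrow> y \<in> carrier A \<Longrightarrow> h (x \<otimes>\<^bsub>A\<^esub> y) = h x \<otimes>\<^bsub>B\<^esub> h y"
    and "\<And>x y. x \<in> carrier A \<Longrightarrow> y \<in> carrier A \<Longrightarrow> h (x \<oplus>\<^bsub>A\<^esub> y) = h x \<oplus>\<^bsub>B\<^esub> h y"
    and "h \<one>\<^bsub>A\<^esub> = \<one>\<^bsub>B\<^esub>"
    and "\<And>c x. c \<in> carrier R \<Longrightarrow> x \<in> carrier A \<Longrightarrow> h (c \<odot>\<^bsub>A\<^esub> x) = c \<odot>\<^bsub>B\<^esub> h x"
  shows "h \<in> alg_hom R A B"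
  using assms by (auto simp: alg_hom_def intro!: ring_hom_memI)

lemma alg_homD:
  assumes "h \<in> alg_hom R A B"
  shows "x \<in> carrier A \<Longrightarrow> h x \<in> carrier B"
    and "x \<in> carrier A \<Longrightarrow> y \<in> carrier A \<Longrightarrow> h (x \<otimes>\<^bsub>A\<^esub> y) = h x \<otimes>\<^bsub>B\<^esub> h y"
    and "x \<in> carrier A \<Longrightarrow> y \<in> carrier A \<Longrightarrow> h (x \<oplus>\<^bsub>A\<^esub> y) = h x \<oplus>\<^bsub>B\<^esub> h y"
    and "h \<one>\<^bsub>A\<^esub> = \<one>\<^bsub>B\<^esub>"
    and "c \<in> carrier R \<Longrightarrow> x \<in> carrier A \<Longrightarrow> h (c \<odot>\<^bsub>A\<^esub> x) = c \<odot>\<^bsub>B\<^esub> h x"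
  using assms by (auto simp: alg_hom_def ring_hom_memE)

lemma alg_hom_comp: "h \<in> alg_hom R A B \<Longrightarrow> g \<in> alg_hom R B C \<Longrightarrow> (\<lambda>x. g (h x)) \<in> alg_hom R A C"
  by (intro alg_homI) (simp_all add: alg_homD)

lemma alg_hom_zero:
  assumes "algebra R A" "algebra R B" "h \<in> alg_hom R A B"
  shows "h \<zero>\<^bsub>A\<^esub> = \<zero>\<^bsub>B\<^esub>"
proof -
  interpret A: algebra R A by fact
  interpret B: algebra R B by fact
  have "h (\<zero>\<^bsub>R\<^esub> \<odot>\<^bsub>A\<^esub> \<zero>\<^bsub>A\<^esub>) = \<zero>\<^bsub>R\<^esub> \<odot>\<^bsub>B\<^esub> h \<zero>\<^bsub>A\<^esub>"
    by (rule alg_homD(5)[OF assms(3)]) auto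
  then show ?thesis using alg_homD(1)[OF assms(3)] by simp
qed

lemma alg_isoI:
  assumes h: "h \<in> alg_hom R A B" and g: "g \<in> alg_hom R B A"
    and "\<And>x. x \<in> carrier A \<Longrightarrow> g (h x) = x" "\<And>y. y \<in> carrier B \<Longrightarrow> h (g y) = y"
  shows "h \<in> alg_iso R A B"
proof -
  have "bij_betw h (carrier A) (carrier B)"
    by (rule bij_betwI[of _ _ _ g]) (use assms in \<open>auto simp: alg_homD(1)\<close>)
  then show ?thesis using h by (auto simp: alg_iso_def alg_hom_def ring_iso_def)
qed

lemma alg_iso_inverse:
  assumes "algebra R A" and h: "h \<in> alg_hom R A B" and bij: "bij_betw h (carrier A) (carrier B)"
  shows "inv_into (carrier A) h \<in> alg_iso R B A"
proof -
  interpret A: algebra R A by fact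
  let ?g = "inv_into (carrier A) h"
  have inv: "?g y \<in> carrier A" "h (?g y) = y" if "y \<in> carrier B" for y
    using that bij by (auto simp: bij_betw_def inv_into_into f_inv_into_f)
  have left: "?g (h x) = x" if "x \<in> carrier A" for x
    using that bij by (auto simp: bij_betw_def)
  have "?g \<in> alg_hom R B A"
  proof (rule alg_homI)
    fix x y assume xy: "x \<in> carrier B" "y \<in> carrier B"
    have "x \<otimes>\<^bsub>B\<^esub> y = h (?g x \<otimes>\<^bsub>A\<^esub> ?g y)" "x \<oplus>\<^bsub>B\<^esub> y = h (?g x \<oplus>\<^bsub>A\<^esub> ?g y)"
      using xy inv by (simp_all add: alg_homD[OF h])
    then show "?g (x \<otimes>\<^bsub>B\<^esub> y) = ?g x \<otimes>\<^bsub>A\<^esub> ?g y" "?g (x \<oplus>\<^bsub>B\<^esub> y) = ?g x \<oplus>\<^bsub>A\<^esub> ?g y"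
      using xy inv left by simp_all
  next
    show "?g \<one>\<^bsub>B\<^esub> = \<one>\<^bsub>A\<^esub>" using left[of "\<one>\<^bsub>A\<^esub>"] alg_homD(4)[OF h] by simp
  next
    fix c x assume c: "c \<in> carrier R" "x \<in> carrier B"
    then have "c \<odot>\<^bsub>B\<^esub> x = h (c \<odot>\<^bsub>A\<^esub> ?g x)" using inv by (simp add: alg_homD[OF h])
    then show "?g (c \<odot>\<^bsub>B\<^esub> x) = c \<odot>\<^bsub>A\<^esub> ?g x" using c inv left by simp
  qed (rule inv)
  then show ?thesis by (rule alg_isoI[OF _ h]) (use inv left in auto)
qed

lemma alg_hom_linear:
  assumes MA: "algebra R (monoid_algebra R M)" and k: "k \<in> alg_hom R (monoid_algebra R M) B"
    and c: "c \<in> carrier R" and b: "b \<in> carrier M" and f: "f \<in> finsupp R (carrier M)"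
  shows "k (\<lambda>x. c \<otimes>\<^bsub>R\<^esub> free_gen R b x \<oplus>\<^bsub>R\<^esub> f x) = c \<odot>\<^bsub>B\<^esub> k (free_gen R b) \<oplus>\<^bsub>B\<^esub> k f"
proof -
  interpret A: algebra R "monoid_algebra R M" by (rule MA)
  have mem: "free_gen R b \<in> carrier (monoid_algebra R M)" "f \<in> carrier (monoid_algebra R M)"
    "(\<lambda>w. c \<otimes>\<^bsub>R\<^esub> free_gen R b w) \<in> carrier (monoid_algebra R M)"
    using b c f by (simp_all add: monoid_algebra_simps A.R.free_gen_closed A.R.smult_finsupp)
  show ?thesis using alg_homD(3)[OF k mem(3,2)] alg_homD(5)[OF k c mem(1)]
    by (simp add: monoid_algebra_simps)
qed

lemma free_alg_hom_eqI:
  assumes "algebra R (monoid_algebra R M)"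
    and h: "h \<in> alg_hom R (monoid_algebra R M) B" and g: "g \<in> alg_hom R (monoid_algebra R M) B"
    and "algebra R B" and eq: "\<And>x. x \<in> carrier M \<Longrightarrow> h (free_gen R x) = g (free_gen R x)"
    and x: "x \<in> carrier (monoid_algebra R M)"
  shows "h x = g x"
proof -
  let ?A = "monoid_algebra R M"
  interpret A: algebra R ?A by fact
  have "x \<in> finsupp R (carrier M)" using x by (simp add: monoid_algebra_simps)
  then show ?thesis
  proof (induction rule: A.R.finsupp_induct)
    case zero
    then show ?case
      using alg_hom_zero[OF assms(1,4) h] alg_hom_zero[OF assms(1,4) g] by (simp add: monoid_algebra_simps)
  next
    case (add c b f)
    show ?case
      by (simp only: alg_hom_linear[OF assms(1) h add(1-3)] alg_hom_linear[OF assms(1) g add(1-3)] add(4) eq[OF add(2)])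
  qed
qed

definition linear_extension ::
  "('k, 'c) ring_scheme \<Rightarrow> ('k, 'a, 'd) module_scheme \<Rightarrow> ('b \<Rightarrow> 'a) \<Rightarrow> ('b \<Rightarrow> 'k) \<Rightarrow> 'a" where
  "linear_extension R B f x = (\<Oplus>\<^bsub>B\<^esub>u\<in>{u. x u \<noteq> \<zero>\<^bsub>R\<^esub>}. x u \<odot>\<^bsub>B\<^esub> f u)"

context
  fixes R (structure) and N (structure) and X :: "'x set" and f :: "'x \<Rightarrow> 'y"
  assumes N: "algebra R N" and f: "\<And>b. b \<in> X \<Longrightarrow> f b \<in> carrier N"
begin

interpretation N: algebra R N by (rule N)

lemma linear_extension_eq:
  assumes "x \<in> finsupp R X" "finite U" "U \<subseteq> X" "\<And>u. u \<notin> U \<Longrightarrow> x u = \<zero>\<^bsub>R\<^esub>"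
  shows "linear_extension R N f x = (\<Oplus>\<^bsub>N\<^esub>u\<in>U. x u \<odot>\<^bsub>N\<^esub> f u)"
  unfolding linear_extension_def
  by (rule N.add.finprod_mono_neutral_cong_left[OF assms(2)])
    (use assms N.R.finsuppD[OF assms(1)] f in auto)

lemma linear_extension_closed: "x \<in> finsupp R X \<Longrightarrow> linear_extension R N f x \<in> carrier N"
  unfolding linear_extension_def
  by (rule N.M.finsum_closed) (use N.R.finsuppD[of x X] f in auto)

lemma linear_extension_add:
  assumes x: "x \<in> finsupp R X" and y: "y \<in> finsupp R X"
  shows "linear_extension R N f (\<lambda>u. x u \<oplus>\<^bsub>R\<^esub> y u) = linear_extension R N f x \<oplus>\<^bsub>N\<^esub> linear_extension R N f y"
proof -
  let ?U = "{u. x u \<noteq> \<zero>\<^bsub>R\<^esub>} \<union> {u. y u \<noteq> \<zero>\<^bsub>R\<^esub>}"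
  note [simp] = N.R.finsuppD(1)[OF x] N.R.finsuppD(1)[OF y]
  have U: "finite ?U" "?U \<subseteq> X" using N.R.finsuppD[OF x] N.R.finsuppD[OF y] by auto
  have f': "f u \<in> carrier N" if "u \<in> ?U" for u using that U(2) f by blast
  have "linear_extension R N f (\<lambda>u. x u \<oplus>\<^bsub>R\<^esub> y u) = (\<Oplus>\<^bsub>N\<^esub>u\<in>?U. (x u \<oplus>\<^bsub>R\<^esub> y u) \<odot>\<^bsub>N\<^esub> f u)"
    by (rule linear_extension_eq) (use U N.R.add_finsupp[OF x y] in auto)
  also have "\<dots> = (\<Oplus>\<^bsub>N\<^esub>u\<in>?U. x u \<odot>\<^bsub>N\<^esub> f u \<oplus>\<^bsub>N\<^esub> y u \<odot>\<^bsub>N\<^esub> f u)"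
    using f' by (intro N.M.finsum_cong') (auto simp: N.smult_l_distr)
  also have "\<dots> = (\<Oplus>\<^bsub>N\<^esub>u\<in>?U. x u \<odot>\<^bsub>N\<^esub> f u) \<oplus>\<^bsub>N\<^esub> (\<Oplus>\<^bsub>N\<^esub>u\<in>?U. y u \<odot>\<^bsub>N\<^esub> f u)"
    using f' by (intro N.M.finsum_addf) auto
  also have "(\<Oplus>\<^bsub>N\<^esub>u\<in>?U. x u \<odot>\<^bsub>N\<^esub> f u) = linear_extension R N f x"
    by (rule linear_extension_eq[symmetric]) (use U x in auto)
  also have "(\<Oplus>\<^bsub>N\<^esub>u\<in>?U. y u \<odot>\<^bsub>N\<^esub> f u) = linear_extension R N f y"
    by (rule linear_extension_eq[symmetric]) (use U y in auto)
  finally show ?thesis .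
qed

lemma linear_extension_smult:
  assumes c: "c \<in> carrier R" and x: "x \<in> finsupp R X"
  shows "linear_extension R N f (\<lambda>u. c \<otimes>\<^bsub>R\<^esub> x u) = c \<odot>\<^bsub>N\<^esub> linear_extension R N f x"
proof -
  let ?U = "{u. x u \<noteq> \<zero>\<^bsub>R\<^esub>}"
  note [simp] = N.R.finsuppD(1)[OF x] c
  have U: "finite ?U" "?U \<subseteq> X" using N.R.finsuppD[OF x] by auto
  have f': "f u \<in> carrier N" if "u \<in> ?U" for u using that U(2) f by blast
  have "linear_extension R N f (\<lambda>u. c \<otimes>\<^bsub>R\<^esub> x u) = (\<Oplus>\<^bsub>N\<^esub>u\<in>?U. (c \<otimes>\<^bsub>R\<^esub> x u) \<odot>\<^bsub>N\<^esub> f u)"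
    by (rule linear_extension_eq) (use U N.R.smult_finsupp[OF c x] in auto)
  also have "\<dots> = (\<Oplus>\<^bsub>N\<^esub>u\<in>?U. c \<odot>\<^bsub>N\<^esub> (x u \<odot>\<^bsub>N\<^esub> f u))"
    using f' by (intro N.M.finsum_cong') (auto simp: N.smult_assoc1)
  also have "\<dots> = c \<odot>\<^bsub>N\<^esub> (\<Oplus>\<^bsub>N\<^esub>u\<in>?U. x u \<odot>\<^bsub>N\<^esub> f u)"
    using f' U by (intro N.finsum_smult_ldistr[symmetric]) auto
  finally show ?thesis by (simp add: linear_extension_def)
qed

lemma linear_extension_gen: "b \<in> X \<Longrightarrow> linear_extension R N f (free_gen R b) = f b"
  by (subst linear_extension_eq[of _ "{b}"]) (use f in \<open>auto simp: N.R.free_gen_closed\<close>, auto simp: free_gen_def)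

lemma linear_extension_zero: "linear_extension R N f (\<lambda>_. \<zero>\<^bsub>R\<^esub>) = \<zero>\<^bsub>N\<^esub>"
  by (simp add: linear_extension_def)

end

text \<open>
The universal property of monoid algebras: multiplicative maps extend to algebra homomorphisms.
\<close>

lemma linear_extension_alg_hom:
  assumes "algebra R N" "comm_monoid M"
    and f: "\<And>x. x \<in> carrier M \<Longrightarrow> f x \<in> carrier N"
    and one: "f \<one>\<^bsub>M\<^esub> = \<one>\<^bsub>N\<^esub>"
    and mult: "\<And>x y. x \<in> carrier M \<Longrightarrow> y \<in> carrier M \<Longrightarrow> f (x \<otimes>\<^bsub>M\<^esub> y) = f x \<otimes>\<^bsub>N\<^esub> f y"
  shows "linear_extension R N f \<in> alg_hom R (monoid_algebra R M) N"
proof -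
  interpret N: algebra R N by fact
  interpret M: comm_monoid M by fact
  interpret A: algebra R "monoid_algebra R M"
    by (rule monoid_algebra_algebra) (use N.R_cring assms in auto)
  interpret F: free_bilinear R "carrier M" "\<one>\<^bsub>M\<^esub>" "\<lambda>x y. free_gen R (x \<otimes>\<^bsub>M\<^esub> y)"
    by unfold_locales (auto intro: N.R.free_gen_closed)
  note ext = linear_extension_add[OF assms(1) f] linear_extension_smult[OF assms(1) f]
    linear_extension_closed[OF assms(1) f] linear_extension_gen[OF assms(1) f] linear_extension_zero[OF assms(1) f]
  note bil = F.mult_add_left F.mult_add_right F.mult_smult_left F.mult_smult_right F.mult_zero_left
    F.mult_zero_right F.mult_gen_gen F.mult_closed N.R.free_gen_closed N.R.smult_finsupp
    N.R.add_finsupp F.m_closed N.R.zero_finsupp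
  let ?h = "linear_extension R N f"
  have "?h (x \<otimes>\<^bsub>F.A\<^esub> y) = ?h x \<otimes>\<^bsub>N\<^esub> ?h y"
    if x: "x \<in> finsupp R (carrier M)" and y: "y \<in> finsupp R (carrier M)" for x y
    using x
  proof (induction rule: N.R.finsupp_induct)
    case zero
    then show ?case using y by (simp add: bil ext)
  next
    case (add c u x)
    have "?h (free_gen R u \<otimes>\<^bsub>F.A\<^esub> y) = f u \<otimes>\<^bsub>N\<^esub> ?h y"
      using y
    proof (induction rule: N.R.finsupp_induct)
      case zero
      then show ?case using \<open>u \<in> _\<close> f by (simp add: bil ext)
    next
      case (add d v y)
      then show ?case using \<open>u \<in> _\<close>
        by (simp add: bil ext f mult N.r_distr N.smult_assoc2
            N.m_comm[of "f u"] N.smult_closed)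
    qed
    with add y show ?case
      by (simp add: bil ext f N.l_distr N.smult_assoc2 N.smult_closed)
  qed
  then show ?thesis
    by (intro alg_homI) (simp_all add: monoid_algebra_simps ext one, simp_all add: monoid_algebra_def)
qed

text \<open>
The image of a homomorphism is a submodule, so it contains every element whose support
consists of basis elements in the image.
\<close>

lemma alg_hom_image_contains:
  assumes R: "cring R" and A: "algebra R A" and h: "h \<in> alg_hom R A (free_algebra R B e m)"
    and f: "f \<in> finsupp R B" and gen: "\<And>b. f b \<noteq> \<zero>\<^bsub>R\<^esub> \<Longrightarrow> free_gen R b \<in> h ` carrier A"
  shows "f \<in> h ` carrier A"
proof -
  interpret cring R by (rule R)
  interpret A: algebra R A by (rule A)
  have "f \<in> finsupp R {b. f b \<noteq> \<zero>\<^bsub>R\<^esub>}" using f by (auto simp: finsupp_def)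
  then show ?thesis
  proof (induction rule: finsupp_induct)
    case zero
    have "h \<zero>\<^bsub>A\<^esub> = h (\<zero>\<^bsub>R\<^esub> \<odot>\<^bsub>A\<^esub> \<one>\<^bsub>A\<^esub>)" by simp
    also have "\<dots> = \<zero>\<^bsub>R\<^esub> \<odot>\<^bsub>free_algebra R B e m\<^esub> h \<one>\<^bsub>A\<^esub>" by (rule alg_homD(5)[OF h]) simp_all
    also have "\<dots> = (\<lambda>_. \<zero>\<^bsub>R\<^esub>)"
      using alg_homD(1)[OF h A.one_closed] by (simp add: free_algebra_simps finsuppD(1)[of _ B])
    finally show ?case by (metis A.zero_closed imageI)
  next
    case (add c b g)
    from gen[of b] add(2) obtain x where x: "x \<in> carrier A" "free_gen R b = h x" by auto
    from add obtain y where y: "y \<in> carrier A" "g = h y" by auto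
    have "h (c \<odot>\<^bsub>A\<^esub> x \<oplus>\<^bsub>A\<^esub> y) = c \<odot>\<^bsub>free_algebra R B e m\<^esub> h x \<oplus>\<^bsub>free_algebra R B e m\<^esub> h y"
      using x y add(1) by (simp add: alg_homD[OF h])
    also have "\<dots> = (\<lambda>w. c \<otimes>\<^bsub>R\<^esub> free_gen R b w \<oplus>\<^bsub>R\<^esub> g w)"
      using x y by (simp add: free_algebra_simps)
    finally show ?case using x y add(1) by (metis A.M.add.m_closed A.smult_closed imageI)
  qed
qed

section \<open>Quotients of algebras\<close>

context
  fixes R (structure) and N (structure) and I
  assumes N: "algebra R N" and I: "ideal I N"
begin

interpretation N: algebra R N by (rule N)
interpretation I: ideal I N by (rule I)

text \<open>
All members of the union that defines scalar multiplication coincide, because an ideal of an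
algebra is closed under scalar multiplication.
\<close>

lemma quot_algebra_smult:
  assumes c: "c \<in> carrier R" and x: "x \<in> carrier N"
  shows "c \<odot>\<^bsub>quot_algebra N I\<^esub> (I +>\<^bsub>N\<^esub> x) = I +>\<^bsub>N\<^esub> (c \<odot>\<^bsub>N\<^esub> x)"
proof -
  have eq: "I +>\<^bsub>N\<^esub> (c \<odot>\<^bsub>N\<^esub> y) = I +>\<^bsub>N\<^esub> (c \<odot>\<^bsub>N\<^esub> x)" if "y \<in> I +>\<^bsub>N\<^esub> x" for y
  proof -
    from that obtain i where i: "i \<in> I" "y = i \<oplus>\<^bsub>N\<^esub> x" by (auto simp: a_r_coset_def')
    have iN: "i \<in> carrier N" using i(1) by (rule I.Icarr)
    have "c \<odot>\<^bsub>N\<^esub> i = (c \<odot>\<^bsub>N\<^esub> \<one>\<^bsub>N\<^esub>) \<otimes>\<^bsub>N\<^esub> i" using c iN by (simp add: N.smult_assoc2)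
    then have "c \<odot>\<^bsub>N\<^esub> i \<in> I" using i c by (simp add: I.I_l_closed)
    then have "c \<odot>\<^bsub>N\<^esub> y \<in> I +>\<^bsub>N\<^esub> (c \<odot>\<^bsub>N\<^esub> x)"
      using c x i iN by (auto simp: N.smult_r_distr a_r_coset_def')
    then show ?thesis using I.a_repr_independence'[of "c \<odot>\<^bsub>N\<^esub> y" "c \<odot>\<^bsub>N\<^esub> x"] c x by simp
  qed
  have "(\<Union>y\<in>I +>\<^bsub>N\<^esub> x. I +>\<^bsub>N\<^esub> (c \<odot>\<^bsub>N\<^esub> y)) = (\<Union>y\<in>I +>\<^bsub>N\<^esub> x. I +>\<^bsub>N\<^esub> (c \<odot>\<^bsub>N\<^esub> x))"
    by (rule SUP_cong[OF refl eq])
  also have "\<dots> = I +>\<^bsub>N\<^esub> (c \<odot>\<^bsub>N\<^esub> x)" using I.a_rcos_self[OF x] by blast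
  finally show ?thesis by (simp add: quot_algebra_def)
qed

lemma quot_algebra_simps:
  "carrier (quot_algebra N I) = (\<lambda>x. I +>\<^bsub>N\<^esub> x) ` carrier N"
  "\<one>\<^bsub>quot_algebra N I\<^esub> = I +>\<^bsub>N\<^esub> \<one>\<^bsub>N\<^esub>"
  "\<zero>\<^bsub>quot_algebra N I\<^esub> = I +>\<^bsub>N\<^esub> \<zero>\<^bsub>N\<^esub>"
  "x \<in> carrier N \<Longrightarrow> y \<in> carrier N \<Longrightarrow>
    (I +>\<^bsub>N\<^esub> x) \<otimes>\<^bsub>quot_algebra N I\<^esub> (I +>\<^bsub>N\<^esub> y) = I +>\<^bsub>N\<^esub> (x \<otimes>\<^bsub>N\<^esub> y)"
  "x \<in> carrier N \<Longrightarrow> y \<in> carrier N \<Longrightarrow>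
    (I +>\<^bsub>N\<^esub> x) \<oplus>\<^bsub>quot_algebra N I\<^esub> (I +>\<^bsub>N\<^esub> y) = I +>\<^bsub>N\<^esub> (x \<oplus>\<^bsub>N\<^esub> y)"
  by (auto simp: quot_algebra_def FactRing_def A_RCOSETS_def' I.rcoset_mult_add I.a_rcos_sum I.a_rcos_const)

lemma quot_algebra_algebra: "algebra R (quot_algebra N I)"
proof -
  let ?Q = "quot_algebra N I"
  have grp: "abelian_group ?Q"
  proof (rule abelian_groupI)
    fix x assume "x \<in> carrier ?Q"
    then obtain y where "y \<in> carrier N" "x = I +>\<^bsub>N\<^esub> y" by (auto simp: quot_algebra_simps)
    then show "\<exists>z \<in> carrier ?Q. z \<oplus>\<^bsub>?Q\<^esub> x = \<zero>\<^bsub>?Q\<^esub>"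
      by (intro bexI[of _ "I +>\<^bsub>N\<^esub> (\<ominus>\<^bsub>N\<^esub> y)"]) (auto simp: quot_algebra_simps N.M.l_neg)
  qed (auto simp: quot_algebra_simps N.M.a_ac)
  have mon: "comm_monoid ?Q"
    by (rule comm_monoidI) (auto simp: quot_algebra_simps N.m_ac)
  have "cring ?Q"
    by (rule cringI[OF grp mon]) (auto simp: quot_algebra_simps N.l_distr)
  then show ?thesis
    by (intro algebraI)
      (auto simp: quot_algebra_simps quot_algebra_smult N.smult_l_distr N.smult_r_distr N.smult_assoc1
        N.smult_assoc2 intro: N.R_cring)
qed

lemma quot_map_alg_hom: "(\<lambda>x. I +>\<^bsub>N\<^esub> x) \<in> alg_hom R N (quot_algebra N I)"
  by (intro alg_homI) (auto simp: quot_algebra_simps quot_algebra_smult)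

text \<open>
The universal property of the quotient.
\<close>

lemma quot_alg_hom_lift:
  assumes L: "algebra R L" and h: "h \<in> alg_hom R N L" and ker: "\<And>x. x \<in> I \<Longrightarrow> h x = \<zero>\<^bsub>L\<^esub>"
  obtains k where "k \<in> alg_hom R (quot_algebra N I) L" "\<And>x. x \<in> carrier N \<Longrightarrow> k (I +>\<^bsub>N\<^esub> x) = h x"
proof -
  interpret L: algebra R L by (rule L)
  define k where "k C = h (SOME x. x \<in> carrier N \<and> C = I +>\<^bsub>N\<^esub> x)" for C
  have k: "k (I +>\<^bsub>N\<^esub> x) = h x" if x: "x \<in> carrier N" for x
  proof -
    define y where "y = (SOME y. y \<in> carrier N \<and> I +>\<^bsub>N\<^esub> x = I +>\<^bsub>N\<^esub> y)"
    have y: "y \<in> carrier N" "I +>\<^bsub>N\<^esub> x = I +>\<^bsub>N\<^esub> y"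
      unfolding y_def using someI[of "\<lambda>y. y \<in> carrier N \<and> I +>\<^bsub>N\<^esub> x = I +>\<^bsub>N\<^esub> y" x] x by auto
    from I.a_rcos_self[OF y(1)] y(2) obtain i where i: "i \<in> I" "y = i \<oplus>\<^bsub>N\<^esub> x"
      by (auto simp: a_r_coset_def')
    then have "h y = h i \<oplus>\<^bsub>L\<^esub> h x" using x I.Icarr by (simp add: alg_homD(3)[OF h])
    then have "h y = h x" using ker[OF i(1)] alg_homD(1)[OF h x] by simp
    then show ?thesis by (simp add: k_def y_def)
  qed
  have "k \<in> alg_hom R (quot_algebra N I) L"
    by (intro alg_homI) (auto simp: quot_algebra_simps quot_algebra_smult k alg_homD[OF h])
  with k that show ?thesis by blast
qed

end

lemma alg_hom_kernel_ideal:
  assumes N: "algebra R N" and L: "algebra R L" and h: "h \<in> alg_hom R N L"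
  shows "ideal {x \<in> carrier N. h x = \<zero>\<^bsub>L\<^esub>} N"
proof -
  interpret N: algebra R N by (rule N)
  interpret L: algebra R L by (rule L)
  have "ring_hom_ring N L h"
    by (rule ring_hom_ringI2[OF N.ring_axioms L.ring_axioms]) (use h in \<open>simp add: alg_hom_def\<close>)
  from ring_hom_ring.kernel_is_ideal[OF this] show ?thesis by (simp add: a_kernel_def')
qed

lemma alg_hom_genideal_zero:
  assumes N: "algebra R N" and L: "algebra R L" and h: "h \<in> alg_hom R N L"
    and Y: "Y \<subseteq> carrier N" "\<And>y. y \<in> Y \<Longrightarrow> h y = \<zero>\<^bsub>L\<^esub>" and x: "x \<in> Idl\<^bsub>N\<^esub> Y"
  shows "h x = \<zero>\<^bsub>L\<^esub>"
proof -
  interpret N: algebra R N by (rule N)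
  have "Idl\<^bsub>N\<^esub> Y \<subseteq> {x \<in> carrier N. h x = \<zero>\<^bsub>L\<^esub>}"
    by (rule N.genideal_minimal[OF alg_hom_kernel_ideal[OF N L h]]) (use Y in auto)
  with x show ?thesis by auto
qed

lemma alg_hom_pow:
  assumes N: "algebra R N" and L: "algebra R L" and h: "h \<in> alg_hom R N L" and x: "x \<in> carrier N"
  shows "h (x [^]\<^bsub>N\<^esub> (n::nat)) = h x [^]\<^bsub>L\<^esub> n"
proof -
  interpret N: algebra R N by (rule N)
  interpret L: algebra R L by (rule L)
  show ?thesis using x by (induction n) (simp_all add: alg_homD[OF h])
qed

lemma alg_hom_minus:
  assumes N: "algebra R N" and L: "algebra R L" and h: "h \<in> alg_hom R N L"
    and xy: "x \<in> carrier N" "y \<in> carrier N"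
  shows "h (x \<ominus>\<^bsub>N\<^esub> y) = h x \<ominus>\<^bsub>L\<^esub> h y"
proof -
  interpret N: algebra R N by (rule N)
  interpret L: algebra R L by (rule L)
  interpret H: ring_hom_ring N L h
    by (rule ring_hom_ringI2[OF N.ring_axioms L.ring_axioms]) (use h in \<open>simp add: alg_hom_def\<close>)
  show ?thesis using xy by (simp add: a_minus_def)
qed

lemma alg_hom_finprod:
  assumes N: "algebra R N" and L: "algebra R L" and h: "h \<in> alg_hom R N L"
    and f: "f \<in> J \<rightarrow> carrier N" and J: "finite J"
  shows "h (finprod N f J) = finprod L (\<lambda>i. h (f i)) J"
  using J f
proof (induction J rule: finite_induct)
  interpret N: algebra R N by (rule N)
  interpret L: algebra R L by (rule L)
  case empty
  show ?case by (simp add: alg_homD(4)[OF h])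
next
  interpret N: algebra R N by (rule N)
  interpret L: algebra R L by (rule L)
  case (insert j J)
  then have J: "f \<in> J \<rightarrow> carrier N" "f j \<in> carrier N" by auto
  then have hJ: "(\<lambda>i. h (f i)) \<in> J \<rightarrow> carrier L" "h (f j) \<in> carrier L" by (auto intro!: alg_homD(1)[OF h])
  show ?case
    using insert.hyps insert.IH[OF J(1)] J hJ N.finprod_closed[OF J(1)]
    by (simp add: N.finprod_insert L.finprod_insert alg_homD(2)[OF h])
qed

section \<open>Truncated polynomial algebras\<close>

lemma monomials_simps [simp]:
  "carrier (monomials X) = {m. set_mset m \<subseteq> X}"
  "x \<otimes>\<^bsub>monomials X\<^esub> y = x + y"
  "\<one>\<^bsub>monomials X\<^esub> = {#}"
  by (simp_all add: monomials_def)

lemma monomials_comm_monoid: "comm_monoid (monomials X)"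
  by (rule comm_monoidI) (auto simp: ac_simps)

lemma poly_algebra_algebra: "cring R \<Longrightarrow> algebra R (poly_algebra R X)"
  unfolding poly_algebra_def by (rule monoid_algebra_algebra[OF _ monomials_comm_monoid])

lemma poly_gen_closed: "cring R \<Longrightarrow> set_mset m \<subseteq> X \<Longrightarrow> free_gen R m \<in> carrier (poly_algebra R X)"
  by (simp add: poly_algebra_def monoid_algebra_simps cring.free_gen_closed)

lemma var_closed: "cring R \<Longrightarrow> x \<in> X \<Longrightarrow> var R x \<in> carrier (poly_algebra R X)"
  by (simp add: var_def poly_gen_closed)

lemma poly_gen_mult:
  assumes "cring R" "set_mset m \<subseteq> X" "set_mset n \<subseteq> X"
  shows "free_gen R m \<otimes>\<^bsub>poly_algebra R X\<^esub> free_gen R n = free_gen R (m + n)"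
  using monoid_algebra_gen_mult[OF assms(1) monomials_comm_monoid, of m X n] assms(2,3)
  by (simp add: poly_algebra_def)

lemma poly_gen_empty: "free_gen R {#} = \<one>\<^bsub>poly_algebra R X\<^esub>"
  by (simp add: poly_algebra_def monoid_algebra_simps)

lemma poly_gen_add_mset:
  "cring R \<Longrightarrow> x \<in> X \<Longrightarrow> set_mset m \<subseteq> X \<Longrightarrow>
    free_gen R (add_mset x m) = var R x \<otimes>\<^bsub>poly_algebra R X\<^esub> free_gen R m"
  by (simp add: var_def poly_gen_mult)

lemma var_pow:
  assumes "cring R" "x \<in> X"
  shows "var R x [^]\<^bsub>poly_algebra R X\<^esub> n = free_gen R (replicate_mset n x)"
proof -
  interpret P: algebra R "poly_algebra R X" by (rule poly_algebra_algebra[OF assms(1)])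
  show ?thesis
  proof (induction n)
    case (Suc n)
    have "set_mset (replicate_mset n x) \<subseteq> X" using assms(2) by (auto split: if_splits)
    with Suc assms show ?case by (simp add: var_def poly_gen_mult)
  qed (simp add: poly_gen_empty[of R X])
qed

lemma poly_alg_hom_exists:
  assumes N: "algebra R N" and g: "\<And>x. x \<in> X \<Longrightarrow> g x \<in> carrier N"
  obtains h where "h \<in> alg_hom R (poly_algebra R X) N" "\<And>x. x \<in> X \<Longrightarrow> h (var R x) = g x"
proof -
  interpret N: algebra R N by (rule N)
  define f where "f m = finprod N (\<lambda>x. g x [^]\<^bsub>N\<^esub> count m x) (set_mset m)" for m
  have eq: "f m = finprod N (\<lambda>x. g x [^]\<^bsub>N\<^esub> count m x) Y"
    if "set_mset m \<subseteq> Y" "Y \<subseteq> X" "finite Y" for m Y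
    unfolding f_def using that g
    by (intro N.finprod_mono_neutral_cong_left) (auto simp: not_in_iff)
  let ?h = "linear_extension R N f"
  have closed: "f m \<in> carrier N" if "set_mset m \<subseteq> X" for m
    unfolding f_def using that g by (intro N.finprod_closed) auto
  have "?h \<in> alg_hom R (monoid_algebra R (monomials X)) N"
  proof (rule linear_extension_alg_hom[OF N monomials_comm_monoid])
    fix m n assume "m \<in> carrier (monomials X)" "n \<in> carrier (monomials X)"
    then have mn: "set_mset m \<subseteq> X" "set_mset n \<subseteq> X" by auto
    let ?Y = "set_mset m \<union> set_mset n"
    have "f (m + n) = finprod N (\<lambda>x. g x [^]\<^bsub>N\<^esub> count (m + n) x) ?Y"
      by (rule eq) (use mn in auto)
    also have "\<dots> = finprod N (\<lambda>x. g x [^]\<^bsub>N\<^esub> count m x \<otimes>\<^bsub>N\<^esub> g x [^]\<^bsub>N\<^esub> count n x) ?Y"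
      by (rule N.finprod_cong') (use mn g in \<open>auto simp: N.nat_pow_mult subsetD\<close>)
    also have "\<dots> = finprod N (\<lambda>x. g x [^]\<^bsub>N\<^esub> count m x) ?Y \<otimes>\<^bsub>N\<^esub> finprod N (\<lambda>x. g x [^]\<^bsub>N\<^esub> count n x) ?Y"
      by (rule N.finprod_multf) (use mn g in auto)
    also have "\<dots> = f m \<otimes>\<^bsub>N\<^esub> f n" using eq[of m ?Y] eq[of n ?Y] mn by simp
    finally show "f (m \<otimes>\<^bsub>monomials X\<^esub> n) = f m \<otimes>\<^bsub>N\<^esub> f n" by simp
  next
    show "f \<one>\<^bsub>monomials X\<^esub> = \<one>\<^bsub>N\<^esub>" by (simp add: f_def)
  qed (simp add: closed)
  moreover have "?h (var R x) = g x" if "x \<in> X" for x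
  proof -
    have "?h (var R x) = f {#x#}" unfolding var_def
      by (rule linear_extension_gen[OF N, of "{m. set_mset m \<subseteq> X}"]) (use closed that in auto)
    also have "\<dots> = g x" using that g by (simp add: f_def)
    finally show ?thesis .
  qed
  ultimately show ?thesis using that by (simp add: poly_algebra_def)
qed

lemma poly_alg_hom_eqI:
  assumes R: "cring R" and N: "algebra R N"
    and h: "h \<in> alg_hom R (poly_algebra R X) N" and k: "k \<in> alg_hom R (poly_algebra R X) N"
    and eq: "\<And>x. x \<in> X \<Longrightarrow> h (var R x) = k (var R x)"
    and f: "f \<in> carrier (poly_algebra R X)"
  shows "h f = k f"
proof -
  have gen: "h (free_gen R m) = k (free_gen R m)" if "set_mset m \<subseteq> X" for m
    using that
  proof (induction m)
    case empty
    show ?case unfolding poly_gen_empty[of R X] by (simp only: alg_homD(4)[OF h] alg_homD(4)[OF k])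
  next
    case (add x m)
    then have "x \<in> X" "set_mset m \<subseteq> X" by auto
    with add.IH eq[of x] R show ?case
      by (simp add: poly_gen_add_mset var_closed poly_gen_closed alg_homD(2)[OF h] alg_homD(2)[OF k])
  qed
  show ?thesis
    by (rule free_alg_hom_eqI[OF poly_algebra_algebra[OF R, unfolded poly_algebra_def]
          h[unfolded poly_algebra_def] k[unfolded poly_algebra_def] N _ f[unfolded poly_algebra_def]])
      (simp add: gen)
qed

lemma power_ideal_ideal: "cring R \<Longrightarrow> ideal (power_ideal R p X) (poly_algebra R X)"
proof -
  assume R: "cring R"
  interpret P: algebra R "poly_algebra R X" by (rule poly_algebra_algebra[OF R])
  show ?thesis unfolding power_ideal_def
    by (rule P.genideal_ideal) (auto simp: var_closed[OF R])
qed

lemma truncated_poly_algebra: "cring R \<Longrightarrow> algebra R (truncated_poly R p X)"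
  unfolding truncated_poly_def by (rule quot_algebra_algebra[OF poly_algebra_algebra power_ideal_ideal])

lemma truncated_map_alg_hom:
  "cring R \<Longrightarrow> (\<lambda>f. power_ideal R p X +>\<^bsub>poly_algebra R X\<^esub> f) \<in> alg_hom R (poly_algebra R X) (truncated_poly R p X)"
  unfolding truncated_poly_def by (rule quot_map_alg_hom[OF poly_algebra_algebra power_ideal_ideal])

lemma truncated_carrier:
  "cring R \<Longrightarrow> carrier (truncated_poly R p X) =
    (\<lambda>f. power_ideal R p X +>\<^bsub>poly_algebra R X\<^esub> f) ` carrier (poly_algebra R X)"
  unfolding truncated_poly_def by (rule quot_algebra_simps(1)[OF poly_algebra_algebra power_ideal_ideal])

lemma truncated_var_closed: "cring R \<Longrightarrow> x \<in> X \<Longrightarrow> truncated_var R p X x \<in> carrier (truncated_poly R p X)"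
  by (auto simp: truncated_var_def truncated_carrier var_closed)

lemma var_pow_in_power_ideal:
  assumes "cring R" "x \<in> X"
  shows "var R x [^]\<^bsub>poly_algebra R X\<^esub> p \<in> power_ideal R p X"
proof -
  interpret P: algebra R "poly_algebra R X" by (rule poly_algebra_algebra[OF assms(1)])
  have "{var R x [^]\<^bsub>poly_algebra R X\<^esub> p | x. x \<in> X} \<subseteq> power_ideal R p X"
    unfolding power_ideal_def by (rule P.genideal_self) (auto simp: var_closed assms(1))
  with assms(2) show ?thesis by blast
qed

lemma truncated_var_pow:
  assumes "cring R" "x \<in> X"
  shows "truncated_var R p X x [^]\<^bsub>truncated_poly R p X\<^esub> p = \<zero>\<^bsub>truncated_poly R p X\<^esub>"
proof -
  interpret I: ideal "power_ideal R p X" "poly_algebra R X" by (rule power_ideal_ideal[OF assms(1)])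
  have "truncated_var R p X x [^]\<^bsub>truncated_poly R p X\<^esub> p =
    power_ideal R p X +>\<^bsub>poly_algebra R X\<^esub> (var R x [^]\<^bsub>poly_algebra R X\<^esub> p)"
    unfolding truncated_var_def
    by (rule alg_hom_pow[symmetric, OF poly_algebra_algebra truncated_poly_algebra truncated_map_alg_hom var_closed])
      (use assms in auto)
  also have "\<dots> = power_ideal R p X"
    by (rule I.a_rcos_const[OF var_pow_in_power_ideal[OF assms]])
  finally show ?thesis by (simp add: truncated_poly_def quot_algebra_def FactRing_def)
qed

text \<open>
Together with \<open>truncated_alg_hom_eqI\<close>: a truncated polynomial algebra is free on generators whose
\<open>p\<close>-th powers vanish.
\<close>

lemma truncated_alg_hom_exists:
  assumes N: "algebra R N" and g: "\<And>x. x \<in> X \<Longrightarrow> g x \<in> carrier N"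
    and pow: "\<And>x. x \<in> X \<Longrightarrow> g x [^]\<^bsub>N\<^esub> p = \<zero>\<^bsub>N\<^esub>"
  obtains h where "h \<in> alg_hom R (truncated_poly R p X) N"
    "\<And>x. x \<in> X \<Longrightarrow> h (truncated_var R p X x) = g x"
proof -
  interpret N: algebra R N by (rule N)
  have R: "cring R" by (rule N.R_cring)
  have P: "algebra R (poly_algebra R X)" by (rule poly_algebra_algebra[OF R])
  interpret P: algebra R "poly_algebra R X" by (rule P)
  obtain h where h: "h \<in> alg_hom R (poly_algebra R X) N" "\<And>x. x \<in> X \<Longrightarrow> h (var R x) = g x"
    by (rule poly_alg_hom_exists[of R N X g, OF N g], assumption, rule that)
  have ker: "h f = \<zero>\<^bsub>N\<^esub>" if f: "f \<in> power_ideal R p X" for f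
  proof (rule alg_hom_genideal_zero[OF P N h(1) _ _ f[unfolded power_ideal_def]])
    show "{var R x [^]\<^bsub>poly_algebra R X\<^esub> p | x. x \<in> X} \<subseteq> carrier (poly_algebra R X)"
      by (auto simp: var_closed R)
    show "h y = \<zero>\<^bsub>N\<^esub>" if "y \<in> {var R x [^]\<^bsub>poly_algebra R X\<^esub> p | x. x \<in> X}" for y
      using that by (auto simp: var_closed R alg_hom_pow[OF P N h(1)] h(2) pow)
  qed
  obtain k where k: "k \<in> alg_hom R (truncated_poly R p X) N"
    "\<And>f. f \<in> carrier (poly_algebra R X) \<Longrightarrow> k (power_ideal R p X +>\<^bsub>poly_algebra R X\<^esub> f) = h f"
    unfolding truncated_poly_def
    by (rule quot_alg_hom_lift[OF P power_ideal_ideal[OF R] N h(1) ker], assumption,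
        rule that[unfolded truncated_poly_def])
  have "k (truncated_var R p X x) = g x" if "x \<in> X" for x
    unfolding truncated_var_def using k(2)[OF var_closed[OF R that]] h(2)[OF that] by simp
  with k(1) show ?thesis by (rule that)
qed

lemma truncated_alg_hom_eqI:
  assumes R: "cring R" and N: "algebra R N"
    and h: "h \<in> alg_hom R (truncated_poly R p X) N" and k: "k \<in> alg_hom R (truncated_poly R p X) N"
    and eq: "\<And>x. x \<in> X \<Longrightarrow> h (truncated_var R p X x) = k (truncated_var R p X x)"
    and f: "f \<in> carrier (truncated_poly R p X)"
  shows "h f = k f"
proof -
  obtain f' where f': "f' \<in> carrier (poly_algebra R X)" "f = power_ideal R p X +>\<^bsub>poly_algebra R X\<^esub> f'"
    using f by (auto simp: truncated_carrier[OF R])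
  have "h (power_ideal R p X +>\<^bsub>poly_algebra R X\<^esub> f') = k (power_ideal R p X +>\<^bsub>poly_algebra R X\<^esub> f')"
    by (rule poly_alg_hom_eqI[OF R N alg_hom_comp[OF truncated_map_alg_hom[OF R] h]
          alg_hom_comp[OF truncated_map_alg_hom[OF R] k] _ f'(1)])
      (use eq in \<open>simp add: truncated_var_def\<close>)
  with f' show ?thesis by simp
qed

section \<open>The shuffle algebra over a commutative ring\<close>

context cring
begin

text \<open>
Shuffle coefficients over any ring are images of natural numbers, so their vanishing is a matter of
counting.
\<close>

lemma shuffle_words_eq: "shuffle_words R u v w = [shuffle_count u v w] \<cdot> \<one>"
proof (induction w arbitrary: u v)
  case Nil
  then show ?case by (cases u; cases v) (auto simp: free_gen_def prepend_def)
next
  case (Cons c w)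
  show ?case
  proof (cases "u = [] \<or> v = []")
    case True
    then show ?thesis
    proof
      assume "u = []"
      then show ?thesis by (auto simp only: shuffle_words.simps shuffle_count_Nil_left free_gen_def split: if_splits) simp_all
    next
      assume v: "v = []"
      have "shuffle_words R u v = free_gen R u" unfolding v by (cases u) auto
      then show ?thesis unfolding v shuffle_count_Nil_right free_gen_def by simp
    qed
  next
    case False
    then obtain a u' b v' where uv: "u = a # u'" "v = b # v'" by (auto simp: neq_Nil_conv)
    show ?thesis unfolding uv
      by (auto simp: prepend_def Cons.IH[unfolded shuffle_words.simps] Cons.IH add.nat_pow_mult)
  qed
qed

lemma shuffle_words_Nil: "shuffle_words R u v [] = (if u = [] \<and> v = [] then \<one> else \<zero>)"
  by (simp add: shuffle_words_eq)

lemma shuffle_words_Cons: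
  "shuffle_words R u v (c # w) =
    (if u \<noteq> [] \<and> hd u = c then shuffle_words R (tl u) v w else \<zero>) \<oplus>
    (if v \<noteq> [] \<and> hd v = c then shuffle_words R u (tl v) w else \<zero>)"
  by (auto simp: shuffle_words_eq add.nat_pow_mult)

lemma shuffle_words_closed:
  assumes "u \<in> lists S" "v \<in> lists S"
  shows "shuffle_words R u v \<in> finsupp R (lists S)"
proof (rule finsuppI[of _ "shuffles u v"])
  show "shuffles u v \<subseteq> lists S" using assms by (auto dest!: set_shuffles)
  show "shuffle_words R u v w = \<zero>" if "w \<notin> shuffles u v" for w
    using that by (simp add: shuffle_words_eq flip: shuffle_count_eq_0_iff)
qed (auto simp: shuffle_words_eq)

end

text \<open>
The derivation that removes a leading letter \<open>c\<close> and kills the words that do not start with \<open>c\<close>.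
\<close>

definition tail_after :: "'s \<Rightarrow> ('s list \<Rightarrow> 'k) \<Rightarrow> 's list \<Rightarrow> 'k" where
  "tail_after c f w = f (c # w)"

locale shuffle_ring = cring R for R (structure) + fixes S :: "'s set"
begin

sublocale free_bilinear R "lists S" "[]" "shuffle_words R"
  by unfold_locales (auto intro: shuffle_words_closed)

abbreviation Sh where "Sh \<equiv> free_algebra R (lists S) [] (shuffle_words R)"

abbreviation shuffle_product (infixl \<open>\<star>\<close> 70) where "f \<star> g \<equiv> f \<otimes>\<^bsub>Sh\<^esub> g"

lemma tail_after_closed:
  assumes "f \<in> finsupp R (lists S)"
  shows "tail_after c f \<in> finsupp R (lists S)"
proof -
  have "finite ((#) c -` {w. f w \<noteq> \<zero>})"
    by (rule finite_vimageI) (use finsuppD(3)[OF assms] in \<open>auto simp: inj_def\<close>)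
  moreover have "(#) c -` {w. f w \<noteq> \<zero>} \<subseteq> lists S"
    using finsuppD(4)[OF assms] by auto
  ultimately show ?thesis
    by (intro finsuppI[of _ "(#) c -` {w. f w \<noteq> \<zero>}"])
      (auto simp: tail_after_def finsuppD(1)[OF assms])
qed

lemma tail_after_simps:
  "tail_after c (\<lambda>_. \<zero>) = (\<lambda>_. \<zero>)"
  "tail_after c (\<lambda>w. f w \<oplus> g w) = (\<lambda>w. tail_after c f w \<oplus> tail_after c g w)"
  "tail_after c (\<lambda>w. d \<otimes> f w) = (\<lambda>w. d \<otimes> tail_after c f w)"
  "tail_after c (free_gen R u) = (if u \<noteq> [] \<and> hd u = c then free_gen R (tl u) else (\<lambda>_. \<zero>))"
  by (cases u; auto simp: tail_after_def free_gen_def)+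

lemmas sh_simps = mult_add_left mult_add_right mult_smult_left mult_smult_right mult_zero_left
  mult_zero_right mult_gen_gen mult_closed free_gen_closed smult_finsupp add_finsupp zero_finsupp
  shuffle_words_closed tail_after_closed tail_after_simps

lemma mult_Nil:
  assumes f: "f \<in> finsupp R (lists S)" and g: "g \<in> finsupp R (lists S)"
  shows "(f \<star> g) [] = f [] \<otimes> g []"
  using f
proof (induction rule: finsupp_induct)
  case zero
  show ?case using finsuppD(1)[OF g] by (simp add: sh_simps)
next
  case (add c u f)
  have "(free_gen R u \<star> g) [] = free_gen R u [] \<otimes> g []"
    using g
  proof (induction rule: finsupp_induct)
    case zero
    show ?case using \<open>u \<in> lists S\<close> by (simp add: sh_simps free_gen_def)
  next
    case (add d v g)
    note [simp] = finsuppD(1)[OF \<open>g \<in> _\<close>]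
    show ?case using add \<open>u \<in> lists S\<close>
      by (simp add: sh_simps) (auto simp: shuffle_words_Nil free_gen_def)
  qed
  moreover have "free_gen R u [] \<in> carrier R" by (simp add: free_gen_def)
  ultimately show ?case using add g finsuppD(1)[OF g] finsuppD(1)[OF \<open>f \<in> _\<close>]
    by (simp add: sh_simps l_distr m_assoc)
qed

text \<open>
The Leibniz rule. By bilinearity it suffices to verify it for two words, where it is the
recursion for shuffles.
\<close>

lemma tail_after_mult:
  assumes f: "f \<in> finsupp R (lists S)" and g: "g \<in> finsupp R (lists S)"
  shows "tail_after c (f \<star> g) =
    (\<lambda>w. (tail_after c f \<star> g) w \<oplus> (f \<star> tail_after c g) w)"
  using f
proof (induction rule: finsupp_induct)
  case zero
  show ?case by (simp add: sh_simps)
next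
  case (add d u f)
  have gen: "tail_after c (free_gen R u \<star> g) =
    (\<lambda>w. (tail_after c (free_gen R u) \<star> g) w \<oplus> (free_gen R u \<star> tail_after c g) w)"
    using g
  proof (induction rule: finsupp_induct)
    case zero
    show ?case by (simp add: sh_simps)
  next
    case (add d v g)
    have uv: "free_gen R u \<in> finsupp R (lists S)" "free_gen R v \<in> finsupp R (lists S)"
      using add \<open>u \<in> lists S\<close> by (auto intro: free_gen_closed)
    have tails: "tl u \<in> lists S" "tl v \<in> lists S"
      using add(2) \<open>u \<in> lists S\<close> by (cases u; cases v; simp)+
    have vv: "tail_after c (shuffle_words R u v) =
      (\<lambda>w. (tail_after c (free_gen R u) \<star> free_gen R v) w \<oplus> (free_gen R u \<star> tail_after c (free_gen R v)) w)"
    proof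
      fix w
      have "tail_after c (free_gen R u) \<star> free_gen R v =
        (if u \<noteq> [] \<and> hd u = c then shuffle_words R (tl u) v else (\<lambda>_. \<zero>))"
        using add(2) tails by (simp add: tail_after_simps(4) mult_gen_gen mult_zero_left)
      moreover have "free_gen R u \<star> tail_after c (free_gen R v) =
        (if v \<noteq> [] \<and> hd v = c then shuffle_words R u (tl v) else (\<lambda>_. \<zero>))"
        using \<open>u \<in> lists S\<close> tails by (simp add: tail_after_simps(4) mult_gen_gen mult_zero_right)
      ultimately show "tail_after c (shuffle_words R u v) w =
        (tail_after c (free_gen R u) \<star> free_gen R v) w \<oplus> (free_gen R u \<star> tail_after c (free_gen R v)) w"
        by (simp only: tail_after_def[of c "shuffle_words R u v"] shuffle_words_Cons) (simp split: if_split)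
    qed
    note tc = tail_after_closed[OF uv(1), of c] tail_after_closed[OF uv(2), of c] tail_after_closed[OF add(3), of c]
    note cl = finsuppD(1)[OF mult_closed[OF uv(1) tc(2)]] finsuppD(1)[OF mult_closed[OF uv(1) tc(3)]]
      finsuppD(1)[OF mult_closed[OF tc(1) uv(2)]] finsuppD(1)[OF mult_closed[OF tc(1) add(3)]]
    show ?case using add uv tc cl
      by (simp add: mult_add_right mult_smult_right smult_finsupp mult_gen_gen[OF \<open>u \<in> lists S\<close> add(2)]
          tail_after_simps(2,3) vv r_distr a_ac)
  qed
  have u: "free_gen R u \<in> finsupp R (lists S)" using add by (auto intro: free_gen_closed)
  note tc = tail_after_closed[OF u, of c] tail_after_closed[OF add(3), of c] tail_after_closed[OF g, of c]
  note cl = finsuppD(1)[OF mult_closed[OF u tc(3)]] finsuppD(1)[OF mult_closed[OF add(3) tc(3)]]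
    finsuppD(1)[OF mult_closed[OF tc(1) g]] finsuppD(1)[OF mult_closed[OF tc(2) g]]
  show ?case using add u tc g cl
    by (simp add: mult_add_left mult_smult_left smult_finsupp gen tail_after_simps(2,3) r_distr a_ac)
qed

lemma mult_Cons:
  assumes "f \<in> finsupp R (lists S)" "g \<in> finsupp R (lists S)"
  shows "(f \<star> g) (c # w) = (tail_after c f \<star> g) w \<oplus> (f \<star> tail_after c g) w"
  using fun_cong[OF tail_after_mult[OF assms], of c w] by (simp add: tail_after_def)

lemma sh_commute:
  assumes "f \<in> finsupp R (lists S)" "g \<in> finsupp R (lists S)"
  shows "f \<star> g = g \<star> f"
proof
  fix w
  show "(f \<star> g) w = (g \<star> f) w"
    using assms
  proof (induction w arbitrary: f g)
    case Nil
    then show ?case by (simp add: mult_Nil finsuppD(1)[of _ "lists S"] m_comm)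
  next
    case (Cons c w)
    note tc = tail_after_closed[OF Cons.prems(1), of c] tail_after_closed[OF Cons.prems(2), of c]
    have "(g \<star> tail_after c f) w \<in> carrier R" "(tail_after c g \<star> f) w \<in> carrier R"
      using Cons.prems tc by (auto intro: finsuppD(1)[OF mult_closed])
    then show ?case
      using Cons.prems tc Cons.IH[OF tc(1) Cons.prems(2)] Cons.IH[OF Cons.prems(1) tc(2)]
      by (simp add: mult_Cons a_comm)
  qed
qed

text \<open>
Two elements are equal if their constant terms and all their derivatives agree. By the Leibniz rule
the derivatives of a product are sums of products of the same form, evaluated at a shorter word.
\<close>

lemma sh_assoc:
  assumes "f \<in> finsupp R (lists S)" "g \<in> finsupp R (lists S)" "h \<in> finsupp R (lists S)"
  shows "f \<star> g \<star> h = f \<star> (g \<star> h)"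
proof
  fix w
  show "(f \<star> g \<star> h) w = (f \<star> (g \<star> h)) w"
    using assms
  proof (induction w arbitrary: f g h)
    case Nil
    then show ?case by (simp add: mult_Nil mult_closed finsuppD(1)[of _ "lists S"] m_assoc)
  next
    case (Cons c w)
    let ?T = "tail_after c"
    note fgh = Cons.prems
    note tc = tail_after_closed[OF fgh(1), of c] tail_after_closed[OF fgh(2), of c] tail_after_closed[OF fgh(3), of c]
    note cl = finsuppD(1)[OF mult_closed[OF tc(1) mult_closed[OF fgh(2,3)]]]
      finsuppD(1)[OF mult_closed[OF fgh(1) mult_closed[OF tc(2) fgh(3)]]]
      finsuppD(1)[OF mult_closed[OF fgh(1) mult_closed[OF fgh(2) tc(3)]]]
    have "(f \<star> g \<star> h) (c # w) =
      (?T f \<star> g \<star> h) w \<oplus> (f \<star> ?T g \<star> h) w \<oplus> (f \<star> g \<star> ?T h) w"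
      using fgh tc by (simp add: mult_Cons tail_after_mult mult_closed mult_add_left)
    moreover have "(f \<star> (g \<star> h)) (c # w) =
      (?T f \<star> (g \<star> h)) w \<oplus> ((f \<star> (?T g \<star> h)) w \<oplus> (f \<star> (g \<star> ?T h)) w)"
      using fgh tc by (simp add: mult_Cons tail_after_mult mult_closed mult_add_right)
    ultimately show ?case
      using Cons.IH[OF tc(1) fgh(2,3)] Cons.IH[OF fgh(1) tc(2) fgh(3)] Cons.IH[OF fgh(1,2) tc(3)] cl
      by (simp add: a_assoc)
  qed
qed

sublocale sh: free_comm_algebra R "lists S" "[]" "shuffle_words R"
proof unfold_locales
  fix u v w assume uvw: "u \<in> lists S" "v \<in> lists S"
  note gen = free_gen_closed[of _ "lists S"]
  show "shuffle_words R u v = shuffle_words R v u"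
    using sh_commute[OF gen[OF uvw(1)] gen[OF uvw(2)]] uvw by (simp only: mult_gen_gen)
  assume w: "w \<in> lists S"
  show "shuffle_words R u v \<star> free_gen R w = free_gen R u \<star> shuffle_words R v w"
    using sh_assoc[OF gen[OF uvw(1)] gen[OF uvw(2)] gen[OF w]] uvw w by (simp only: mult_gen_gen)
qed simp

sublocale Sh: algebra R Sh by (rule sh.algebra)

text \<open>
The derivative of a power, as for any derivation of a commutative algebra.
\<close>

lemma tail_after_pow:
  assumes f: "f \<in> finsupp R (lists S)"
  shows "tail_after c (f [^]\<^bsub>Sh\<^esub> Suc n) = ([Suc n] \<cdot> \<one>) \<odot>\<^bsub>Sh\<^esub> (f [^]\<^bsub>Sh\<^esub> n \<star> tail_after c f)"
proof -
  have fc: "f \<in> carrier Sh" "tail_after c f \<in> carrier Sh"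
    using f tail_after_closed[OF f] by (simp_all add: free_algebra_simps(1))
  have tail: "tail_after c (x \<star> f) = tail_after c x \<star> f \<oplus>\<^bsub>Sh\<^esub> x \<star> tail_after c f"
    if "x \<in> carrier Sh" for x
    using tail_after_mult[OF _ f, of x c] that by (simp add: free_algebra_simps(1,5))
  show ?thesis
  proof (induction n)
    case 0
    show ?case using fc by simp
  next
    case (Suc n)
    have p: "f [^]\<^bsub>Sh\<^esub> Suc n \<in> carrier Sh" "f [^]\<^bsub>Sh\<^esub> n \<in> carrier Sh" using fc by simp_all
    have k: "[Suc n] \<cdot> \<one> \<in> carrier R" by simp
    have "tail_after c (f [^]\<^bsub>Sh\<^esub> Suc (Suc n)) = tail_after c (f [^]\<^bsub>Sh\<^esub> Suc n) \<star> f \<oplus>\<^bsub>Sh\<^esub> f [^]\<^bsub>Sh\<^esub> Suc n \<star> tail_after c f"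
      using tail[OF p(1)] by (simp only: Sh.nat_pow_Suc)
    also have "tail_after c (f [^]\<^bsub>Sh\<^esub> Suc n) \<star> f =
      ([Suc n] \<cdot> \<one>) \<odot>\<^bsub>Sh\<^esub> ((f [^]\<^bsub>Sh\<^esub> n \<star> tail_after c f) \<star> f)"
      unfolding Suc using fc p k by (intro Sh.smult_assoc2) auto
    also have "(f [^]\<^bsub>Sh\<^esub> n \<star> tail_after c f) \<star> f = f [^]\<^bsub>Sh\<^esub> Suc n \<star> tail_after c f"
      using fc p by (simp add: Sh.m_ac)
    also have "([Suc n] \<cdot> \<one>) \<odot>\<^bsub>Sh\<^esub> (f [^]\<^bsub>Sh\<^esub> Suc n \<star> tail_after c f) \<oplus>\<^bsub>Sh\<^esub> f [^]\<^bsub>Sh\<^esub> Suc n \<star> tail_after c f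
      = ([Suc n] \<cdot> \<one> \<oplus> \<one>) \<odot>\<^bsub>Sh\<^esub> (f [^]\<^bsub>Sh\<^esub> Suc n \<star> tail_after c f)"
      using fc p k by (subst Sh.smult_l_distr) auto
    also have "[Suc n] \<cdot> \<one> \<oplus> \<one> = [Suc (Suc n)] \<cdot> \<one>" by simp
    finally show ?case .
  qed
qed

text \<open>
All derivatives of \<open>f^p\<close> carry the factor \<open>p\<close>, and its constant term is a power of that of \<open>f\<close>.
\<close>

lemma pow_char_eq_zero:
  assumes f: "f \<in> finsupp R (lists S)" "f [] = \<zero>" and p: "0 < (p::nat)" "[p] \<cdot> \<one> = \<zero>"
  shows "f [^]\<^bsub>Sh\<^esub> p = \<zero>\<^bsub>Sh\<^esub>"
proof -
  obtain n where n: "p = Suc n" using p(1) by (cases p) auto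
  have fc: "f \<in> carrier Sh" "tail_after c f \<in> carrier Sh" for c
    using f(1) tail_after_closed[OF f(1)] by (simp_all add: free_algebra_simps(1))
  have pow: "f [^]\<^bsub>Sh\<^esub> n \<in> finsupp R (lists S)" using Sh.nat_pow_closed[OF fc(1), of n] by (simp add: free_algebra_simps(1))
  have "(f [^]\<^bsub>Sh\<^esub> p) w = \<zero>" for w
  proof (cases w)
    case Nil
    show ?thesis using mult_Nil[OF pow f(1)] finsuppD(1)[OF pow] f(2) by (simp add: Nil n)
  next
    case (Cons c v)
    have "tail_after c (f [^]\<^bsub>Sh\<^esub> p) = \<zero>\<^bsub>Sh\<^esub>"
      using tail_after_pow[OF f(1), of c n] p(2) fc(2)[of c] Sh.nat_pow_closed[OF fc(1), of n] unfolding n by simp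
    from fun_cong[OF this, of v] show ?thesis by (simp add: tail_after_def Cons free_algebra_simps(4))
  qed
  then show ?thesis by (auto simp: free_algebra_simps(4))
qed

end

section \<open>The shuffle algebra over a prime field\<close>

locale lyndon_shuffle =
  fixes p :: nat and S :: "'s::linorder set" and F :: "int ring" (structure)
  assumes p: "Factorial_Ring.prime p" and S: "finite S"
  defines "F \<equiv> residue_ring (int p)"
begin

sublocale residues_prime p F
  using p by unfold_locales (simp_all add: F_def)

sublocale shuffle_ring F S
  by unfold_locales

lemma char_F: "[n] \<cdot> \<one> = int n mod int p"
proof (induction n)
  case 0
  have "\<zero> = 0" by (simp add: F_def residue_ring_def)
  then show ?case by simp
next
  case (Suc n)
  have "1 < p" using p by (rule prime_gt_1_nat)
  then have "\<one> = 1" by (simp add: F_def residue_ring_def)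
  with Suc show ?case by (simp add: res_add_eq mod_simps ac_simps)
qed

lemma char_F_eq_zero_iff: "[n] \<cdot> \<one> = \<zero> \<longleftrightarrow> p dvd n"
proof -
  have "\<zero> = 0" by (simp add: F_def residue_ring_def)
  then show ?thesis by (simp add: char_F flip: zmod_int) presburger
qed

lemma TL_lists: "TL p S \<subseteq> lists S"
  by (auto simp: TL_def Lyn_eq split: if_splits)

lemma TL_nonempty: "t \<in> TL p S \<Longrightarrow> t \<noteq> []"
  using p by (auto simp: TL_def Lyn_eq lyndon_def prime_gt_0_nat)

lemma gen_mult_eval:
  assumes t: "t \<in> lists S" and g: "g \<in> finsupp F (lists S)"
  shows "(free_gen F t \<otimes>\<^bsub>Sh\<^esub> g) w =
    (\<Oplus>v\<in>{v. g v \<noteq> \<zero>}. g v \<otimes> shuffle_words F t v w)"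
proof -
  let ?V = "{v. g v \<noteq> \<zero>}"
  note [simp] = finsuppD(1)[OF g]
  have V: "finite ?V" "?V \<subseteq> lists S" using finsuppD[OF g] by auto
  have sw: "shuffle_words F t v w \<in> carrier F" for v by (simp add: shuffle_words_eq)
  have one: "free_gen F t t = \<one>" and zero: "x \<notin> {t} \<Longrightarrow> free_gen F t x = \<zero>" for x
    by (simp_all add: free_gen_def)
  have "(free_gen F t \<otimes>\<^bsub>Sh\<^esub> g) w =
      (\<Oplus>u\<in>{t}. \<Oplus>v\<in>?V. free_gen F t u \<otimes> g v \<otimes> shuffle_words F u v w)"
    by (rule mult_eq[OF free_gen_closed[OF t] _ _ zero g V]) (use t in auto)
  also have "\<dots> = (\<Oplus>v\<in>?V. free_gen F t t \<otimes> g v \<otimes> shuffle_words F t v w)"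
    by (rule finsum_single, rule finsum_closed) (simp add: one sw)
  also have "\<dots> = (\<Oplus>v\<in>?V. g v \<otimes> shuffle_words F t v w)"
    by (simp add: one)
  finally show ?thesis .
qed

definition word_hom :: "('s list multiset \<Rightarrow> int) \<Rightarrow> 's list \<Rightarrow> int" where
  "word_hom = (SOME h. h \<in> alg_hom F (poly_algebra F (TL p S)) Sh \<and> (\<forall>t \<in> TL p S. h (var F t) = free_gen F t))"

lemma word_hom:
  shows word_hom_alg_hom: "word_hom \<in> alg_hom F (poly_algebra F (TL p S)) Sh"
    and word_hom_var: "t \<in> TL p S \<Longrightarrow> word_hom (var F t) = free_gen F t"
proof -
  have gen: "free_gen F t \<in> carrier Sh" if "t \<in> TL p S" for t
    using free_gen_closed[OF subsetD[OF TL_lists that]] by (simp add: free_algebra_simps(1))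
  obtain h where h: "h \<in> alg_hom F (poly_algebra F (TL p S)) Sh" "\<And>t. t \<in> TL p S \<Longrightarrow> h (var F t) = free_gen F t"
    by (rule poly_alg_hom_exists[OF Sh.algebra_axioms, of "TL p S" "free_gen F", OF gen], assumption, rule that)
  have "\<exists>h. h \<in> alg_hom F (poly_algebra F (TL p S)) Sh \<and> (\<forall>t \<in> TL p S. h (var F t) = free_gen F t)"
    by (intro exI[of _ h] conjI ballI h)
  note word = someI_ex[OF this, folded word_hom_def]
  show "word_hom \<in> alg_hom F (poly_algebra F (TL p S)) Sh" by (rule conjunct1[OF word])
  show "t \<in> TL p S \<Longrightarrow> word_hom (var F t) = free_gen F t" by (rule bspec[OF conjunct2[OF word]])
qed

text \<open>
Triangularity. Remove a variable \<open>t\<close> with maximal Lyndon word. Shuffling \<open>t\<close> with words below the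
leading word of the rest stays below the leading word of the whole monomial, so only the leading
term of the rest contributes to the top coefficient, with a factor that is not divisible by \<open>p\<close>.
\<close>

lemma word_hom_leading:
  assumes "m \<in> reduced_monomials p (TL p S)"
  shows "word_hom (free_gen F m) \<in> finsupp F (lists S)"
    and "word_hom (free_gen F m) (leading_word m) \<noteq> \<zero>"
    and "word_hom (free_gen F m) w \<noteq> \<zero> \<Longrightarrow> length w = length (leading_word m) \<and> w \<le> leading_word m"
proof -
  have p1: "1 < p" using p by (rule prime_gt_1_nat)
  have "word_hom (free_gen F m) \<in> finsupp F (lists S) \<and>
    word_hom (free_gen F m) (leading_word m) \<noteq> \<zero> \<and>
    (\<forall>w. word_hom (free_gen F m) w \<noteq> \<zero> \<longrightarrow> length w = length (leading_word m) \<and> w \<le> leading_word m)"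
    using assms
  proof (induction "size m" arbitrary: m)
    case 0
    then have m: "m = {#}" by simp
    have "word_hom (free_gen F m) = free_gen F []"
      unfolding m poly_gen_empty[of F "TL p S"]
      using alg_homD(4)[OF word_hom_alg_hom] by (simp add: free_algebra_simps(3))
    moreover have "leading_word m = []" by (simp add: m lyndon_product_def)
    ultimately show ?case using free_gen_closed[of "[]" "lists S"] by (simp add: free_gen_def)
  next
    case (Suc n)
    have sub: "set_mset m \<subseteq> TL p S" using Suc.prems by (simp add: reduced_monomials_def)
    obtain l k m' where m: "m = add_mset (lyndon_power p l k) m'" and l: "l \<in> Lyn S"
      and le: "\<And>x. x \<in># all_lyndon_factors m' \<Longrightarrow> x \<le> l"
      using remove_largest_factor[OF p1 sub] Suc.hyps(2) by (metis size_empty nat.distinct(1))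
    let ?t = "lyndon_power p l k" and ?g = "word_hom (free_gen F m')"
    let ?v = "leading_word m'" and ?w = "leading_word m"
    have sub': "set_mset m' \<subseteq> TL p S" "?t \<in> TL p S" using sub m by auto
    have "count m' x < p" for x
    proof -
      have "count m' x \<le> count m x" by (simp add: m)
      also have "count m x < p" using Suc.prems by (simp add: reduced_monomials_def)
      finally show ?thesis .
    qed
    then have red: "m' \<in> reduced_monomials p (TL p S)"
      using sub' by (simp add: reduced_monomials_def)
    have "n = size m'" using Suc.hyps(2) by (simp add: m)
    note IH = Suc.hyps(1)[OF this red]
    have g: "?g \<in> finsupp F (lists S)" "?g ?v \<noteq> \<zero>"
      and g_le: "\<And>v. ?g v \<noteq> \<zero> \<Longrightarrow> length v = length ?v \<and> v \<le> ?v"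
      using IH by blast+
    note [simp] = finsuppD(1)[OF g(1)]
    have t: "?t \<in> lists S" using sub'(2) TL_lists by blast
    have "word_hom (free_gen F m) = free_gen F ?t \<otimes>\<^bsub>Sh\<^esub> ?g"
      unfolding m poly_gen_add_mset[OF is_cring sub'(2,1)]
      using sub' by (simp add: alg_homD(2)[OF word_hom_alg_hom] var_closed poly_gen_closed is_cring word_hom_var)
    then have eval: "word_hom (free_gen F m) w = (\<Oplus>v\<in>{v. ?g v \<noteq> \<zero>}. ?g v \<otimes> shuffle_words F ?t v w)"
      and closed: "word_hom (free_gen F m) \<in> finsupp F (lists S)" for w
      using gen_mult_eval[OF t g(1)] mult_closed[OF free_gen_closed[OF t] g(1)] by simp_all
    have sw: "shuffle_words F ?t v w \<in> carrier F" for v w by (simp add: shuffle_words_eq)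
    have sw0: "shuffle_words F ?t v w = \<zero>" if "w \<notin> shuffles ?t v" for v w
      using that by (simp add: shuffle_words_eq flip: shuffle_count_eq_0_iff)
    have "word_hom (free_gen F m) ?w = (\<Oplus>v\<in>{v. ?g v \<noteq> \<zero>}.
      if v = ?v then ?g v \<otimes> shuffle_words F ?t v ?w else \<zero>)"
      unfolding eval
    proof (rule finsum_cong'[OF refl])
      fix v assume "v \<in> {v. ?g v \<noteq> \<zero>}"
      then have v: "length v = length ?v" "v \<le> ?v" using g_le by auto
      have "shuffle_words F ?t v ?w = \<zero>" if "v \<noteq> ?v"
      proof (rule sw0)
        show "?w \<notin> shuffles ?t v"
          using shuffles_less_leading_word[OF l sub'(1) le v(1), of ?w k] v(2) that
          by (auto simp: m order_le_less)
      qed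
      then show "?g v \<otimes> shuffle_words F ?t v ?w =
        (if v = ?v then ?g v \<otimes> shuffle_words F ?t v ?w else \<zero>)" by simp
    qed (simp add: sw)
    also have "\<dots> = ?g ?v \<otimes> shuffle_words F ?t ?v ?w"
      by (rule add.finprod_singleton_swap) (use g finsuppD(3)[OF g(1)] sw in auto)
    finally have top: "word_hom (free_gen F m) ?w = ?g ?v \<otimes> shuffle_words F ?t ?v ?w" .
    have "shuffle_words F ?t ?v ?w \<noteq> \<zero>"
      unfolding shuffle_words_eq char_F_eq_zero_iff m
      by (rule shuffle_count_leading_word[OF l sub'(1) le p Suc.prems[unfolded m]])
    then have nonzero: "word_hom (free_gen F m) ?w \<noteq> \<zero>"
      unfolding top using integral[of "?g ?v" "shuffle_words F ?t ?v ?w"] g(2) sw by auto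
    have "length w = length ?w \<and> w \<le> ?w" if w: "word_hom (free_gen F m) w \<noteq> \<zero>" for w
    proof -
      have "\<exists>v. ?g v \<noteq> \<zero> \<and> w \<in> shuffles ?t v"
      proof (rule ccontr)
        assume "\<nexists>v. ?g v \<noteq> \<zero> \<and> w \<in> shuffles ?t v"
        then have "(\<Oplus>v\<in>{v. ?g v \<noteq> \<zero>}. ?g v \<otimes> shuffle_words F ?t v w) = (\<Oplus>v\<in>{v. ?g v \<noteq> \<zero>}. \<zero>)"
          using sw0 by (intro finsum_cong') auto
        with w show False unfolding eval by simp
      qed
      then obtain v where v: "?g v \<noteq> \<zero>" "w \<in> shuffles ?t v" by blast
      have "w \<le> ?w" unfolding m
        by (rule shuffles_le_leading_word[OF l sub'(1) le _ _ v(2)]) (use g_le[OF v(1)] in auto)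
      moreover have "length w = length (?t @ ?v)" using length_shuffles[OF v(2)] g_le[OF v(1)] by simp
      then have "length w = length ?w" using leading_word_add[OF l sub'(1) le] by (simp only: m)
      ultimately show ?thesis by simp
    qed
    with closed nonzero show ?case by blast
  qed
  then show "word_hom (free_gen F m) \<in> finsupp F (lists S)"
    "word_hom (free_gen F m) (leading_word m) \<noteq> \<zero>"
    "word_hom (free_gen F m) w \<noteq> \<zero> \<Longrightarrow> length w = length (leading_word m) \<and> w \<le> leading_word m"
    by blast+
qed

abbreviation TP where "TP \<equiv> truncated_poly F p (TL p S)"

text \<open>
The \<open>p\<close>-th shuffle powers of the words in \<^term>\<open>TL p S\<close> vanish, so the evaluation of polynomials
factors through the truncated polynomial algebra.
\<close>

lemma truncated_word_hom_exists:
  obtains k where "k \<in> alg_hom F TP Sh"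
    "\<And>f. f \<in> carrier (poly_algebra F (TL p S)) \<Longrightarrow>
      k (power_ideal F p (TL p S) +>\<^bsub>poly_algebra F (TL p S)\<^esub> f) = word_hom f"
proof -
  let ?P = "poly_algebra F (TL p S)"
  have P: "algebra F ?P" by (rule poly_algebra_algebra[OF is_cring])
  interpret P: algebra F ?P by (rule P)
  have "word_hom f = \<zero>\<^bsub>Sh\<^esub>" if f: "f \<in> power_ideal F p (TL p S)" for f
  proof (rule alg_hom_genideal_zero[OF P Sh.algebra_axioms word_hom_alg_hom _ _ f[unfolded power_ideal_def]])
    show "{var F t [^]\<^bsub>?P\<^esub> p | t. t \<in> TL p S} \<subseteq> carrier ?P"
      by (auto simp: var_closed is_cring)
    fix y assume "y \<in> {var F t [^]\<^bsub>?P\<^esub> p | t. t \<in> TL p S}"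
    then obtain t where t: "t \<in> TL p S" "y = var F t [^]\<^bsub>?P\<^esub> p" by blast
    have "word_hom y = free_gen F t [^]\<^bsub>Sh\<^esub> p"
      unfolding t(2) word_hom_var[OF t(1), symmetric]
      by (rule alg_hom_pow[OF P Sh.algebra_axioms word_hom_alg_hom var_closed[OF is_cring t(1)]])
    also have "\<dots> = \<zero>\<^bsub>Sh\<^esub>"
    proof (rule pow_char_eq_zero)
      show "free_gen F t \<in> finsupp F (lists S)" using t(1) TL_lists by (blast intro: free_gen_closed)
      show "free_gen F t [] = \<zero>" using TL_nonempty[OF t(1)] by (simp add: free_gen_def)
      show "0 < p" using p by (rule prime_gt_0_nat)
      show "[p] \<cdot> \<one> = \<zero>" by (simp add: char_F_eq_zero_iff)
    qed
    finally show "word_hom y = \<zero>\<^bsub>Sh\<^esub>" .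
  qed
  from quot_alg_hom_lift[OF P power_ideal_ideal[OF is_cring] Sh.algebra_axioms word_hom_alg_hom this]
  show ?thesis using that unfolding truncated_poly_def by metis
qed

lemma gen_nonreduced:
  assumes "set_mset m \<subseteq> X" "m \<notin> reduced_monomials p X"
  shows "free_gen F m \<in> power_ideal F p X"
proof -
  interpret I: ideal "power_ideal F p X" "poly_algebra F X" by (rule power_ideal_ideal[OF is_cring])
  obtain x where x: "p \<le> count m x" using assms by (auto simp: reduced_monomials_def not_less)
  then have "replicate_mset p x \<subseteq># m" by (simp add: count_le_replicate_mset_subset_eq)
  then obtain n where n: "m = replicate_mset p x + n" by (metis subset_mset.add_diff_inverse)
  have "x \<in># m" using x p by (metis count_greater_zero_iff less_le_trans prime_gt_0_nat)
  then have xX: "x \<in> X" using assms(1) by blast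
  have "free_gen F m = var F x [^]\<^bsub>poly_algebra F X\<^esub> p \<otimes>\<^bsub>poly_algebra F X\<^esub> free_gen F n"
    unfolding var_pow[OF is_cring xX]
    by (subst poly_gen_mult[OF is_cring]) (use assms(1) n xX in auto)
  also have "\<dots> \<in> power_ideal F p X"
    by (rule I.I_r_closed[OF var_pow_in_power_ideal[OF is_cring xX]])
      (use assms(1) n in \<open>simp add: poly_gen_closed is_cring\<close>)
  finally show ?thesis .
qed

text \<open>
Monomials in which some exponent reaches \<open>p\<close> lie in the ideal, so they can be dropped.
\<close>

lemma reduced_representative:
  assumes "f \<in> carrier (poly_algebra F X)"
  shows "\<exists>r \<in> finsupp F (reduced_monomials p X).
    power_ideal F p X +>\<^bsub>poly_algebra F X\<^esub> f = power_ideal F p X +>\<^bsub>poly_algebra F X\<^esub> r"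
proof -
  let ?q = "\<lambda>f. power_ideal F p X +>\<^bsub>poly_algebra F X\<^esub> f" and ?T = "truncated_poly F p X"
  interpret T: algebra F ?T by (rule truncated_poly_algebra[OF is_cring])
  interpret I: ideal "power_ideal F p X" "poly_algebra F X" by (rule power_ideal_ideal[OF is_cring])
  have q: "?q \<in> alg_hom F (poly_algebra F X) ?T" by (rule truncated_map_alg_hom[OF is_cring])
  have sub: "reduced_monomials p X \<subseteq> {m. set_mset m \<subseteq> X}" by (auto simp: reduced_monomials_def)
  have carr: "g \<in> carrier (poly_algebra F X)" if "g \<in> finsupp F {m. set_mset m \<subseteq> X}" for g
    using that by (simp add: poly_algebra_def monoid_algebra_simps)
  have lin: "?q (\<lambda>x. c \<otimes> free_gen F m x \<oplus> g x) = c \<odot>\<^bsub>?T\<^esub> ?q (free_gen F m) \<oplus>\<^bsub>?T\<^esub> ?q g"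
    if "c \<in> carrier F" "set_mset m \<subseteq> X" "g \<in> finsupp F {m. set_mset m \<subseteq> X}" for c m g
    using alg_hom_linear[OF poly_algebra_algebra[OF is_cring, unfolded poly_algebra_def] q[unfolded poly_algebra_def]] that
    by (simp add: poly_algebra_def)
  have "f \<in> finsupp F {m. set_mset m \<subseteq> X}" using assms by (simp add: poly_algebra_def monoid_algebra_simps)
  then show ?thesis
  proof (induction rule: finsupp_induct)
    case zero
    then show ?case using zero_finsupp by blast
  next
    case (add c m g)
    then obtain r where r: "r \<in> finsupp F (reduced_monomials p X)" "?q g = ?q r" by blast
    have rX: "r \<in> finsupp F {m. set_mset m \<subseteq> X}" by (rule finsupp_mono[OF sub r(1)])
    have m: "set_mset m \<subseteq> X" using add(2) by simp
    show ?case
    proof (cases "m \<in> reduced_monomials p X")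
      case True
      have "(\<lambda>x. c \<otimes> free_gen F m x \<oplus> r x) \<in> finsupp F (reduced_monomials p X)"
        by (intro add_finsupp smult_finsupp free_gen_closed True r(1) add(1))
      moreover have "?q (\<lambda>x. c \<otimes> free_gen F m x \<oplus> g x) = ?q (\<lambda>x. c \<otimes> free_gen F m x \<oplus> r x)"
        by (simp only: lin[OF add(1) m add(3)] lin[OF add(1) m rX] r(2))
      ultimately show ?thesis by blast
    next
      case False
      have "?q (free_gen F m) = power_ideal F p X" by (rule I.a_rcos_const[OF gen_nonreduced[OF m False]])
      then have "?q (free_gen F m) = \<zero>\<^bsub>?T\<^esub>" by (simp add: truncated_poly_def quot_algebra_def FactRing_def)
      moreover have "?q g \<in> carrier ?T" by (rule alg_homD(1)[OF q carr[OF add(3)]])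
      ultimately have "?q (\<lambda>x. c \<otimes> free_gen F m x \<oplus> g x) = ?q r"
        using add(1) r(2) by (simp add: lin[OF add(1) m add(3)])
      with r(1) show ?thesis by blast
    qed
  qed
qed

lemma word_hom_linear:
  assumes "c \<in> carrier F" "set_mset m \<subseteq> TL p S" "f \<in> finsupp F {m. set_mset m \<subseteq> TL p S}"
  shows "word_hom (\<lambda>x. c \<otimes> free_gen F m x \<oplus> f x) w =
    c \<otimes> word_hom (free_gen F m) w \<oplus> word_hom f w"
  using alg_hom_linear[OF poly_algebra_algebra[OF is_cring, unfolded poly_algebra_def]
      word_hom_alg_hom[unfolded poly_algebra_def]] assms
  by (simp add: free_algebra_simps)

lemma word_hom_zero: "word_hom (\<lambda>_. \<zero>) w = \<zero>"
proof -
  have "word_hom \<zero>\<^bsub>poly_algebra F (TL p S)\<^esub> = \<zero>\<^bsub>Sh\<^esub>"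
    by (rule alg_hom_zero[OF poly_algebra_algebra[OF is_cring] Sh.algebra_axioms word_hom_alg_hom])
  then show ?thesis by (simp add: poly_algebra_def monoid_algebra_simps free_algebra_simps)
qed

lemma leading_word_inj:
  assumes "m \<in> reduced_monomials p (TL p S)" "n \<in> reduced_monomials p (TL p S)" "leading_word m = leading_word n"
  shows "m = n"
proof (rule all_lyndon_factors_inj[OF prime_gt_1_nat[OF p] assms(1,2)])
  have "set_mset (all_lyndon_factors m) \<subseteq> Lyn S" "set_mset (all_lyndon_factors n) \<subseteq> Lyn S"
    using assms(1,2) by (auto simp: reduced_monomials_def dest!: set_all_lyndon_factors)
  then show "all_lyndon_factors m = all_lyndon_factors n" using assms(3) by (rule lyndon_product_inj)
qed

text \<open>
Add the monomials of the support one at a time in increasing order of their leading words. The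
coefficient at the leading word of the last one cannot be cancelled by the earlier ones.
\<close>

lemma word_hom_reduced_inj:
  assumes "r \<in> finsupp F (reduced_monomials p (TL p S))" "word_hom r = (\<lambda>_. \<zero>)"
  shows "r = (\<lambda>_. \<zero>)"
proof -
  let ?red = "reduced_monomials p (TL p S)"
  have sub: "?red \<subseteq> {m. set_mset m \<subseteq> TL p S}" by (auto simp: reduced_monomials_def)
  have "\<forall>r \<in> finsupp F ?red. {m. r m \<noteq> \<zero>} \<subseteq> U \<longrightarrow>
    (\<forall>w. (\<forall>m \<in> U. leading_word m < w) \<longrightarrow> word_hom r w = \<zero>) \<and>
    (word_hom r = (\<lambda>_. \<zero>) \<longrightarrow> r = (\<lambda>_. \<zero>))"
    if "finite U" "U \<subseteq> ?red" for U
    using that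
  proof (induction U rule: finite_ranking_induct[where f = leading_word])
    case empty
    then show ?case using word_hom_zero by (auto simp: fun_eq_iff)
  next
    case (insert b U)
    show ?case
    proof (cases "b \<in> U")
      case True
      with insert show ?thesis by (simp add: insert_absorb)
    next
      case False
      have b: "b \<in> ?red" "set_mset b \<subseteq> TL p S" and U: "U \<subseteq> ?red" using insert.prems sub by auto
      note IH = insert.IH[OF U]
      have lead_less: "leading_word m < leading_word b" if "m \<in> U" for m
        using insert.hyps(2)[OF that] leading_word_inj[of m b] b U that False by (force simp: order_le_less)
      show ?thesis
      proof (intro ballI impI)
        fix r assume r: "r \<in> finsupp F ?red" "{m. r m \<noteq> \<zero>} \<subseteq> insert b U"
        note [simp] = finsuppD(1)[OF r(1)]
        define r' where "r' = r(b := \<zero>)"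
        have r': "r' \<in> finsupp F ?red" "{m. r' m \<noteq> \<zero>} \<subseteq> U"
          using r by (auto simp: r'_def finsupp_def intro: finite_subset[of _ "{x. r x \<noteq> \<zero>}"])
        have r_eq: "r = (\<lambda>x. r b \<otimes> free_gen F b x \<oplus> r' x)"
          by (auto simp: r'_def free_gen_def)
        have val: "word_hom r w = r b \<otimes> word_hom (free_gen F b) w \<oplus> word_hom r' w" for w
          using word_hom_linear[OF _ b(2) finsupp_mono[OF sub r'(1)], of "r b" w] r_eq by simp
        have top: "word_hom r' w = \<zero>" if "\<forall>m\<in>U. leading_word m < w" for w
          using IH r' that by blast
        have gen: "word_hom (free_gen F b) w \<in> carrier F" for w
          by (rule finsuppD(1)[OF word_hom_leading(1)[OF b(1)]])
        show "(\<forall>w. (\<forall>m \<in> insert b U. leading_word m < w) \<longrightarrow> word_hom r w = \<zero>) \<and>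
          (word_hom r = (\<lambda>_. \<zero>) \<longrightarrow> r = (\<lambda>_. \<zero>))"
        proof (intro conjI allI impI)
          fix w assume w: "\<forall>m \<in> insert b U. leading_word m < w"
          then have "word_hom (free_gen F b) w = \<zero>"
            using word_hom_leading(3)[OF b(1), of w] by (auto simp: not_le[symmetric])
          with w top show "word_hom r w = \<zero>" by (simp add: val)
        next
          assume zero: "word_hom r = (\<lambda>_. \<zero>)"
          have prod: "r b \<otimes> word_hom (free_gen F b) (leading_word b) = \<zero>"
            using val[of "leading_word b"] zero top lead_less gen by simp
          have "r b = \<zero>"
            using integral[OF prod finsuppD(1)[OF r(1)] gen] word_hom_leading(2)[OF b(1)] by blast
          then have "r' = r" by (simp add: r'_def fun_upd_idem)
          with IH r' zero show "r = (\<lambda>_. \<zero>)" by blast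
        qed
      qed
    qed
  qed
  from this[of "{m. r m \<noteq> \<zero>}"] finsuppD(3,4)[OF assms(1)] assms show ?thesis by blast
qed

text \<open>
Induction on the number of smaller words of the same length, which is finite because \<open>S\<close> is. The
word \<open>w\<close> is the leading word of some reduced monomial; up to an invertible factor it is the image of
this monomial minus smaller words, which are in the image already.
\<close>

lemma gen_in_image:
  assumes "w \<in> lists S"
  shows "free_gen F w \<in> word_hom ` carrier (poly_algebra F (TL p S))"
  using assms
proof (induction "card {u \<in> lists S. length u = length w \<and> u < w}" arbitrary: w rule: less_induct)
  case less
  let ?P = "poly_algebra F (TL p S)"
  interpret P: algebra F ?P by (rule poly_algebra_algebra[OF is_cring])
  have smaller: "free_gen F u \<in> word_hom ` carrier ?P" if "u \<in> lists S" "length u = length w" "u < w" for u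
  proof (rule less.hyps[OF _ that(1)])
    have "{u \<in> lists S. length u = length w \<and> u < w} \<subseteq> {xs. set xs \<subseteq> S \<and> length xs = length w}" by auto
    then have "finite {u \<in> lists S. length u = length w \<and> u < w}"
      by (rule finite_subset) (rule finite_lists_length_eq[OF S])
    then show "card {v \<in> lists S. length v = length u \<and> v < u} < card {u \<in> lists S. length u = length w \<and> u < w}"
      by (rule psubset_card_mono) (use that in auto)
  qed
  obtain M where M: "set_mset M \<subseteq> Lyn S" "lyndon_product M = w" using lyndon_product_surj[OF less.prems] .
  obtain m where m: "m \<in> reduced_monomials p (TL p S)" "all_lyndon_factors m = M"
    using all_lyndon_factors_surj[OF prime_gt_1_nat[OF p] M(1)] .
  have w: "leading_word m = w" using M m by simp
  let ?h = "word_hom (free_gen F m)"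
  note h = word_hom_leading[OF m(1), unfolded w]
  note [simp] = finsuppD(1)[OF h(1)]
  \<comment> \<open>The image of the monomial without its leading term.\<close>
  define g where "g = ?h(w := \<zero>)"
  have g: "g \<in> finsupp F (lists S)"
    using h(1) by (auto simp: g_def finsupp_def intro: finite_subset[of _ "{x. ?h x \<noteq> \<zero>}"])
  have "g \<in> word_hom ` carrier ?P"
  proof (rule alg_hom_image_contains[OF is_cring P.algebra_axioms word_hom_alg_hom g])
    fix u assume "g u \<noteq> \<zero>"
    then have "?h u \<noteq> \<zero>" "u \<noteq> w" by (auto simp: g_def split: if_splits)
    then show "free_gen F u \<in> word_hom ` carrier ?P"
      using h(3)[of u] finsuppD(2)[OF h(1), of u] by (intro smaller) auto
  qed
  then obtain y where y: "y \<in> carrier ?P" "g = word_hom y" by auto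
  define d where "d = inv\<^bsub>F\<^esub> (?h w)"
  have unit: "?h w \<in> Units F" using h(2) by (simp add: field_Units)
  then have d: "d \<in> carrier F" "d \<otimes> ?h w = \<one>" by (simp_all add: d_def)
  have m_carr: "free_gen F m \<in> carrier ?P"
    using m(1) by (intro poly_gen_closed[OF is_cring]) (simp add: reduced_monomials_def)
  let ?x = "d \<odot>\<^bsub>?P\<^esub> free_gen F m \<oplus>\<^bsub>?P\<^esub> (\<ominus> d) \<odot>\<^bsub>?P\<^esub> y"
  have "word_hom ?x = d \<odot>\<^bsub>Sh\<^esub> ?h \<oplus>\<^bsub>Sh\<^esub> (\<ominus> d) \<odot>\<^bsub>Sh\<^esub> g"
    using m_carr y d(1) by (simp add: alg_homD[OF word_hom_alg_hom])
  also have "\<dots> = free_gen F w"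
  proof
    fix u
    have "free_gen F w u = (if u = w then \<one> else \<zero>)" by (simp add: free_gen_def)
    then show "(d \<odot>\<^bsub>Sh\<^esub> ?h \<oplus>\<^bsub>Sh\<^esub> (\<ominus> d) \<odot>\<^bsub>Sh\<^esub> g) u = free_gen F w u"
      using d by (cases "u = w") (simp_all add: free_algebra_simps(5,6) g_def l_minus r_neg)
  qed
  finally have "word_hom ?x = free_gen F w" .
  moreover have "?x \<in> carrier ?P" using m_carr y d(1) by simp
  ultimately show ?case by (metis imageI)
qed

theorem shuffle_iso_truncated_poly:
  "\<exists>h. h \<in> alg_iso F Sh TP"
proof -
  let ?P = "poly_algebra F (TL p S)"
  let ?q = "\<lambda>f. power_ideal F p (TL p S) +>\<^bsub>?P\<^esub> f"
  have TP: "algebra F TP" by (rule truncated_poly_algebra[OF is_cring])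
  interpret TP: algebra F TP by (rule TP)
  interpret P: algebra F ?P by (rule poly_algebra_algebra[OF is_cring])
  obtain k where k: "k \<in> alg_hom F TP Sh" "\<And>f. f \<in> carrier ?P \<Longrightarrow> k (?q f) = word_hom f"
    by (rule truncated_word_hom_exists) (rule that)
  have red: "f \<in> carrier ?P" if "f \<in> finsupp F (reduced_monomials p (TL p S))" for f
    using finsupp_mono[OF _ that, of "{m. set_mset m \<subseteq> TL p S}"]
    by (simp add: poly_algebra_def monoid_algebra_simps reduced_monomials_def subset_iff)
  have repr: "\<exists>r \<in> finsupp F (reduced_monomials p (TL p S)). x = ?q r" if "x \<in> carrier TP" for x
  proof -
    from that obtain f where "f \<in> carrier ?P" "x = ?q f" by (auto simp: truncated_carrier[OF is_cring])
    with reduced_representative show ?thesis by auto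
  qed
  have "inj_on k (carrier TP)"
  proof (rule inj_onI)
    fix x y assume xy: "x \<in> carrier TP" "y \<in> carrier TP" "k x = k y"
    have d: "x \<ominus>\<^bsub>TP\<^esub> y \<in> carrier TP" using xy by simp
    from repr[OF d] obtain r where r: "r \<in> finsupp F (reduced_monomials p (TL p S))" "x \<ominus>\<^bsub>TP\<^esub> y = ?q r" by blast
    have "k x = k (x \<ominus>\<^bsub>TP\<^esub> y) \<oplus>\<^bsub>Sh\<^esub> k y"
      using alg_homD(3)[OF k(1) d xy(2)] xy(1,2) by (simp add: TP.minus_eq TP.M.a_assoc TP.M.l_neg)
    then have "k (x \<ominus>\<^bsub>TP\<^esub> y) = \<zero>\<^bsub>Sh\<^esub>"
      using xy(3) alg_homD(1)[OF k(1) d] alg_homD(1)[OF k(1) xy(2)]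
      by (metis Sh.M.add.r_cancel_one')
    then have "word_hom r = (\<lambda>_. \<zero>)"
      using k(2)[OF red[OF r(1)]] r(2) by (simp add: free_algebra_simps(4))
    from word_hom_reduced_inj[OF r(1) this] have "r = \<zero>\<^bsub>?P\<^esub>"
      by (simp add: poly_algebra_def monoid_algebra_simps)
    then have "x \<ominus>\<^bsub>TP\<^esub> y = \<zero>\<^bsub>TP\<^esub>"
      using r(2) alg_hom_zero[OF P.algebra_axioms TP truncated_map_alg_hom[OF is_cring]] by simp
    then show "x = y" using xy(1,2) by simp
  qed
  moreover have "k ` carrier TP = carrier Sh"
  proof
    show "k ` carrier TP \<subseteq> carrier Sh" using alg_homD(1)[OF k(1)] by auto
    show "carrier Sh \<subseteq> k ` carrier TP"
    proof
      fix f assume "f \<in> carrier Sh"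
      then have f: "f \<in> finsupp F (lists S)" by (simp add: free_algebra_simps(1))
      have "f \<in> word_hom ` carrier ?P"
        by (rule alg_hom_image_contains[OF is_cring P.algebra_axioms word_hom_alg_hom f])
          (use finsuppD(2)[OF f] in \<open>blast intro: gen_in_image\<close>)
      then obtain y where y: "y \<in> carrier ?P" "f = word_hom y" by auto
      have "?q y \<in> carrier TP" using y(1) by (auto simp: truncated_carrier[OF is_cring])
      with k(2)[OF y(1)] y(2) show "f \<in> k ` carrier TP" by (metis imageI)
    qed
  qed
  ultimately have "inv_into (carrier TP) k \<in> alg_iso F Sh TP"
    by (intro alg_iso_inverse[OF TP k(1)]) (simp add: bij_betw_def)
  then show ?thesis by blast
qed

end

section \<open>Tensor products of truncated polynomial algebras\<close>

lemma restricted_product_simps: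
  "carrier (restricted_product I A) = {x \<in> \<Pi>\<^sub>E i\<in>I. carrier (A i). finite {i \<in> I. x i \<noteq> \<one>\<^bsub>A i\<^esub>}}"
  "x \<otimes>\<^bsub>restricted_product I A\<^esub> y = (\<lambda>i\<in>I. x i \<otimes>\<^bsub>A i\<^esub> y i)"
  "\<one>\<^bsub>restricted_product I A\<^esub> = (\<lambda>i\<in>I. \<one>\<^bsub>A i\<^esub>)"
  by (simp_all add: restricted_product_def)

locale algebra_family = cring R for R (structure) +
  fixes I :: "'i set" and A :: "'i \<Rightarrow> ('a, 'c, 'd) module_scheme"
  assumes factors: "i \<in> I \<Longrightarrow> algebra R (A i)"
begin

abbreviation P where "P \<equiv> restricted_product I A"
abbreviation MP where "MP \<equiv> monoid_algebra R P"
abbreviation T where "T \<equiv> tensor_algebra R I A"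

abbreviation support where "support x \<equiv> {i \<in> I. x i \<noteq> \<one>\<^bsub>A i\<^esub>}"
abbreviation pure_tensor where "pure_tensor x \<equiv> tensor_ideal R I A +>\<^bsub>MP\<^esub> free_gen R x"

lemma factor_monoid: "i \<in> I \<Longrightarrow> comm_monoid (A i)"
  using algebra.M_cring[OF factors] cring.axioms(2) by blast

lemma factor_closed:
  assumes "i \<in> I"
  shows "\<one>\<^bsub>A i\<^esub> \<in> carrier (A i)"
    and "a \<in> carrier (A i) \<Longrightarrow> b \<in> carrier (A i) \<Longrightarrow> a \<otimes>\<^bsub>A i\<^esub> b \<in> carrier (A i)"
    and "a \<in> carrier (A i) \<Longrightarrow> b \<in> carrier (A i) \<Longrightarrow> a \<oplus>\<^bsub>A i\<^esub> b \<in> carrier (A i)"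
    and "c \<in> carrier R \<Longrightarrow> a \<in> carrier (A i) \<Longrightarrow> c \<odot>\<^bsub>A i\<^esub> a \<in> carrier (A i)"
proof -
  interpret Ai: algebra R "A i" by (rule factors[OF assms])
  show "\<one>\<^bsub>A i\<^esub> \<in> carrier (A i)"
    "a \<in> carrier (A i) \<Longrightarrow> b \<in> carrier (A i) \<Longrightarrow> a \<otimes>\<^bsub>A i\<^esub> b \<in> carrier (A i)"
    "a \<in> carrier (A i) \<Longrightarrow> b \<in> carrier (A i) \<Longrightarrow> a \<oplus>\<^bsub>A i\<^esub> b \<in> carrier (A i)"
    "c \<in> carrier R \<Longrightarrow> a \<in> carrier (A i) \<Longrightarrow> c \<odot>\<^bsub>A i\<^esub> a \<in> carrier (A i)"
    by simp_all
qed

lemma P_D: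
  assumes "x \<in> carrier P"
  shows "i \<in> I \<Longrightarrow> x i \<in> carrier (A i)" "i \<notin> I \<Longrightarrow> x i = undefined" "finite (support x)"
  using assms by (auto simp: restricted_product_simps PiE_iff extensional_def)

lemma P_I:
  assumes "\<And>i. i \<in> I \<Longrightarrow> x i \<in> carrier (A i)" "\<And>i. i \<notin> I \<Longrightarrow> x i = undefined"
    "finite J" "\<And>i. i \<in> I \<Longrightarrow> i \<notin> J \<Longrightarrow> x i = \<one>\<^bsub>A i\<^esub>"
  shows "x \<in> carrier P"
proof -
  have "support x \<subseteq> J" using assms(4) by blast
  then have "finite (support x)" using assms(3) by (rule finite_subset)
  then show ?thesis using assms(1,2) by (simp add: restricted_product_simps PiE_iff extensional_def)
qed

lemma one_P: "i \<in> I \<Longrightarrow> \<one>\<^bsub>P\<^esub> i = \<one>\<^bsub>A i\<^esub>"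
  by (simp add: restricted_product_simps)

lemma P_comm_monoid: "comm_monoid P"
proof (rule comm_monoidI)
  fix x y assume x: "x \<in> carrier P" and y: "y \<in> carrier P"
  show "x \<otimes>\<^bsub>P\<^esub> y \<in> carrier P"
  proof (rule P_I[where J = "support x \<union> support y"])
    show "(x \<otimes>\<^bsub>P\<^esub> y) i = \<one>\<^bsub>A i\<^esub>" if "i \<in> I" "i \<notin> support x \<union> support y" for i
      using that monoid.l_one[OF comm_monoid.axioms(1)[OF factor_monoid[OF that(1)]] factor_closed(1)[OF that(1)]]
      by (simp add: restricted_product_simps(2))
  qed (use P_D[OF x] P_D[OF y] in \<open>simp_all add: restricted_product_simps(2) factor_closed\<close>)
  show "x \<otimes>\<^bsub>P\<^esub> y = y \<otimes>\<^bsub>P\<^esub> x"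
    using P_D(1)[OF x] P_D(1)[OF y] by (auto simp: restricted_product_simps(2) comm_monoid.m_comm[OF factor_monoid])
next
  show "\<one>\<^bsub>P\<^esub> \<in> carrier P"
    by (rule P_I[where J = "{}"]) (simp_all add: restricted_product_simps(3) factor_closed)
next
  fix x assume x: "x \<in> carrier P"
  show "\<one>\<^bsub>P\<^esub> \<otimes>\<^bsub>P\<^esub> x = x"
    using P_D(1,2)[OF x]
    by (auto simp: restricted_product_simps(2,3) monoid.l_one[OF comm_monoid.axioms(1)[OF factor_monoid]])
next
  fix x y z assume x: "x \<in> carrier P" and y: "y \<in> carrier P" and z: "z \<in> carrier P"
  show "x \<otimes>\<^bsub>P\<^esub> y \<otimes>\<^bsub>P\<^esub> z = x \<otimes>\<^bsub>P\<^esub> (y \<otimes>\<^bsub>P\<^esub> z)"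
    using P_D(1)[OF x] P_D(1)[OF y] P_D(1)[OF z]
    by (auto simp: restricted_product_simps(2) monoid.m_assoc[OF comm_monoid.axioms(1)[OF factor_monoid]])
qed

lemma upd_closed: "x \<in> carrier P \<Longrightarrow> i \<in> I \<Longrightarrow> a \<in> carrier (A i) \<Longrightarrow> x(i := a) \<in> carrier P"
  by (rule P_I[where J = "insert i (support x)"]) (use P_D[of x] in auto)

lemma one_P_closed: "\<one>\<^bsub>P\<^esub> \<in> carrier P"
  using comm_monoid.axioms(1)[OF P_comm_monoid] by (rule monoid.one_closed)

lemma MP_algebra: "algebra R MP"
  by (rule monoid_algebra_algebra[OF is_cring P_comm_monoid])

lemma gen_MP: "x \<in> carrier P \<Longrightarrow> free_gen R x \<in> carrier MP"
  by (simp add: monoid_algebra_simps free_gen_closed)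

lemma tensor_rels_closed: "tensor_rels R I A \<subseteq> carrier MP"
proof -
  interpret MP: algebra R MP by (rule MP_algebra)
  show ?thesis
    unfolding tensor_rels_def Let_def by (auto simp: gen_MP upd_closed factor_closed)
qed

lemma tensor_ideal_ideal: "ideal (tensor_ideal R I A) MP"
proof -
  interpret MP: algebra R MP by (rule MP_algebra)
  show ?thesis unfolding tensor_ideal_def by (rule MP.genideal_ideal[OF tensor_rels_closed])
qed

lemma tensor_algebra_algebra: "algebra R T"
  unfolding tensor_algebra_def by (rule quot_algebra_algebra[OF MP_algebra tensor_ideal_ideal])

lemma tensor_quot_map: "(\<lambda>f. tensor_ideal R I A +>\<^bsub>MP\<^esub> f) \<in> alg_hom R MP T"
  unfolding tensor_algebra_def by (rule quot_map_alg_hom[OF MP_algebra tensor_ideal_ideal])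

lemma pure_tensor_closed: "x \<in> carrier P \<Longrightarrow> pure_tensor x \<in> carrier T"
  by (rule alg_homD(1)[OF tensor_quot_map gen_MP])

lemma pure_tensor_one: "pure_tensor \<one>\<^bsub>P\<^esub> = \<one>\<^bsub>T\<^esub>"
  using alg_homD(4)[OF tensor_quot_map] by (simp add: monoid_algebra_simps(2))

lemma pure_tensor_mult:
  assumes "x \<in> carrier P" "y \<in> carrier P"
  shows "pure_tensor (x \<otimes>\<^bsub>P\<^esub> y) = pure_tensor x \<otimes>\<^bsub>T\<^esub> pure_tensor y"
  unfolding monoid_algebra_gen_mult[OF is_cring P_comm_monoid assms, symmetric]
  by (rule alg_homD(2)[OF tensor_quot_map gen_MP[OF assms(1)] gen_MP[OF assms(2)]])

lemma pure_tensor_add: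
  assumes "x \<in> carrier P" "i \<in> I" "a \<in> carrier (A i)" "b \<in> carrier (A i)"
  shows "pure_tensor (x(i := a \<oplus>\<^bsub>A i\<^esub> b)) = pure_tensor (x(i := a)) \<oplus>\<^bsub>T\<^esub> pure_tensor (x(i := b))"
proof -
  interpret MP: algebra R MP by (rule MP_algebra)
  note gen = gen_MP[OF upd_closed[OF assms(1,2)]]
  have ab: "a \<oplus>\<^bsub>A i\<^esub> b \<in> carrier (A i)" by (rule factor_closed(3)[OF assms(2-4)])
  have "free_gen R (x(i := a \<oplus>\<^bsub>A i\<^esub> b)) \<ominus>\<^bsub>MP\<^esub> (free_gen R (x(i := a)) \<oplus>\<^bsub>MP\<^esub> free_gen R (x(i := b)))
      \<in> tensor_rels R I A"
    unfolding tensor_rels_def Let_def using assms by blast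
  then have "free_gen R (x(i := a \<oplus>\<^bsub>A i\<^esub> b)) \<ominus>\<^bsub>MP\<^esub> (free_gen R (x(i := a)) \<oplus>\<^bsub>MP\<^esub> free_gen R (x(i := b)))
      \<in> tensor_ideal R I A"
    unfolding tensor_ideal_def using MP.genideal_self[OF tensor_rels_closed] by blast
  then have "pure_tensor (x(i := a \<oplus>\<^bsub>A i\<^esub> b)) =
      tensor_ideal R I A +>\<^bsub>MP\<^esub> (free_gen R (x(i := a)) \<oplus>\<^bsub>MP\<^esub> free_gen R (x(i := b)))"
    by (subst (asm) MP.quotient_eq_iff_same_a_r_cos[OF tensor_ideal_ideal gen[OF ab]
          MP.M.add.m_closed[OF gen[OF assms(3)] gen[OF assms(4)]]])
  also have "\<dots> = pure_tensor (x(i := a)) \<oplus>\<^bsub>T\<^esub> pure_tensor (x(i := b))"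
    by (rule alg_homD(3)[OF tensor_quot_map gen[OF assms(3)] gen[OF assms(4)]])
  finally show ?thesis .
qed

lemma pure_tensor_smult:
  assumes "x \<in> carrier P" "i \<in> I" "c \<in> carrier R" "a \<in> carrier (A i)"
  shows "pure_tensor (x(i := c \<odot>\<^bsub>A i\<^esub> a)) = c \<odot>\<^bsub>T\<^esub> pure_tensor (x(i := a))"
proof -
  interpret MP: algebra R MP by (rule MP_algebra)
  note gen = gen_MP[OF upd_closed[OF assms(1,2)]]
  have ca: "c \<odot>\<^bsub>A i\<^esub> a \<in> carrier (A i)" by (rule factor_closed(4)[OF assms(2-4)])
  have "free_gen R (x(i := c \<odot>\<^bsub>A i\<^esub> a)) \<ominus>\<^bsub>MP\<^esub> c \<odot>\<^bsub>MP\<^esub> free_gen R (x(i := a)) \<in> tensor_rels R I A"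
    unfolding tensor_rels_def Let_def using assms by blast
  then have "free_gen R (x(i := c \<odot>\<^bsub>A i\<^esub> a)) \<ominus>\<^bsub>MP\<^esub> c \<odot>\<^bsub>MP\<^esub> free_gen R (x(i := a)) \<in> tensor_ideal R I A"
    unfolding tensor_ideal_def using MP.genideal_self[OF tensor_rels_closed] by blast
  then have "pure_tensor (x(i := c \<odot>\<^bsub>A i\<^esub> a)) = tensor_ideal R I A +>\<^bsub>MP\<^esub> (c \<odot>\<^bsub>MP\<^esub> free_gen R (x(i := a)))"
    by (subst (asm) MP.quotient_eq_iff_same_a_r_cos[OF tensor_ideal_ideal gen[OF ca]
          MP.smult_closed[OF assms(3) gen[OF assms(4)]]])
  also have "\<dots> = c \<odot>\<^bsub>T\<^esub> pure_tensor (x(i := a))"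
    by (rule alg_homD(5)[OF tensor_quot_map assms(3) gen[OF assms(4)]])
  finally show ?thesis .
qed

lemma tensor_in_alg_hom:
  assumes i: "i \<in> I"
  shows "tensor_in R I A i \<in> alg_hom R (A i) T"
proof (rule alg_homI; unfold tensor_in_def)
  note upd = upd_closed[OF one_P_closed i]
  show "pure_tensor (\<one>\<^bsub>P\<^esub>(i := a)) \<in> carrier T" if "a \<in> carrier (A i)" for a
    by (rule pure_tensor_closed[OF upd[OF that]])
  show "pure_tensor (\<one>\<^bsub>P\<^esub>(i := a \<otimes>\<^bsub>A i\<^esub> b)) = pure_tensor (\<one>\<^bsub>P\<^esub>(i := a)) \<otimes>\<^bsub>T\<^esub> pure_tensor (\<one>\<^bsub>P\<^esub>(i := b))"
    if "a \<in> carrier (A i)" "b \<in> carrier (A i)" for a b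
  proof -
    have "\<one>\<^bsub>P\<^esub>(i := a \<otimes>\<^bsub>A i\<^esub> b) = \<one>\<^bsub>P\<^esub>(i := a) \<otimes>\<^bsub>P\<^esub> \<one>\<^bsub>P\<^esub>(i := b)"
      using i monoid.l_one[OF comm_monoid.axioms(1)[OF factor_monoid] factor_closed(1)]
      by (auto simp: restricted_product_simps(2,3))
    then show ?thesis by (simp only: pure_tensor_mult[OF upd[OF that(1)] upd[OF that(2)]])
  qed
  show "pure_tensor (\<one>\<^bsub>P\<^esub>(i := \<one>\<^bsub>A i\<^esub>)) = \<one>\<^bsub>T\<^esub>"
    using one_P[OF i] pure_tensor_one by (simp add: fun_upd_idem)
qed (simp_all add: pure_tensor_add pure_tensor_smult one_P_closed i)

text \<open>
Pure tensors are products of elements of the single factors, because almost all entries are \<open>1\<close>.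
\<close>

lemma pure_tensor_eq_finprod:
  assumes "finite J" "J \<subseteq> I" "x \<in> carrier P" "\<And>i. i \<in> I \<Longrightarrow> i \<notin> J \<Longrightarrow> x i = \<one>\<^bsub>A i\<^esub>"
  shows "pure_tensor x = finprod T (\<lambda>i. tensor_in R I A i (x i)) J"
  using assms
proof (induction J arbitrary: x rule: finite_induct)
  case empty
  have "x = \<one>\<^bsub>P\<^esub>"
  proof
    fix i show "x i = \<one>\<^bsub>P\<^esub> i"
      using empty(3)[of i] P_D(2)[OF empty(2), of i] by (cases "i \<in> I") (simp_all add: restricted_product_simps(3))
  qed
  interpret T: algebra R T by (rule tensor_algebra_algebra)
  show ?case using \<open>x = \<one>\<^bsub>P\<^esub>\<close> pure_tensor_one by simp
next
  case (insert j J)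
  interpret T: algebra R T by (rule tensor_algebra_algebra)
  have j: "j \<in> I" "J \<subseteq> I" using insert.prems(1) by auto
  define y where "y = x(j := \<one>\<^bsub>A j\<^esub>)"
  have xj: "x j \<in> carrier (A j)" by (rule P_D(1)[OF insert.prems(2) j(1)])
  have y: "y \<in> carrier P" unfolding y_def by (rule upd_closed[OF insert.prems(2) j(1) factor_closed(1)[OF j(1)]])
  have x: "x = \<one>\<^bsub>P\<^esub>(j := x j) \<otimes>\<^bsub>P\<^esub> y"
  proof
    fix i
    consider "i = j" | "i \<in> I" "i \<noteq> j" | "i \<notin> I" by blast
    then show "x i = (\<one>\<^bsub>P\<^esub>(j := x j) \<otimes>\<^bsub>P\<^esub> y) i"
    proof cases
      case 1
      then show ?thesis using j(1) monoid.r_one[OF comm_monoid.axioms(1)[OF factor_monoid[OF j(1)]] xj]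
        by (simp add: restricted_product_simps(2) y_def)
    next
      case 2
      then show ?thesis
        using monoid.l_one[OF comm_monoid.axioms(1)[OF factor_monoid[OF 2(1)]] P_D(1)[OF insert.prems(2) 2(1)]]
        by (simp add: restricted_product_simps(2,3) y_def)
    next
      case 3
      then show ?thesis using P_D(2)[OF insert.prems(2)] by (simp add: restricted_product_simps(2))
    qed
  qed
  have closed: "tensor_in R I A i (x i) \<in> carrier T" if "i \<in> I" for i
    by (rule alg_homD(1)[OF tensor_in_alg_hom[OF that] P_D(1)[OF insert.prems(2) that]])
  have "pure_tensor x = pure_tensor (\<one>\<^bsub>P\<^esub>(j := x j)) \<otimes>\<^bsub>T\<^esub> pure_tensor y"
    by (subst x) (rule pure_tensor_mult[OF upd_closed[OF one_P_closed j(1) xj] y])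
  also have "pure_tensor y = finprod T (\<lambda>i. tensor_in R I A i (y i)) J"
    by (rule insert.IH[OF j(2) y]) (use insert.prems(3) in \<open>auto simp: y_def\<close>)
  also have "\<dots> = finprod T (\<lambda>i. tensor_in R I A i (x i)) J"
    by (rule T.finprod_cong'[OF refl]) (use insert.hyps(2) j(2) closed in \<open>auto simp: y_def\<close>)
  also have "pure_tensor (\<one>\<^bsub>P\<^esub>(j := x j)) \<otimes>\<^bsub>T\<^esub> finprod T (\<lambda>i. tensor_in R I A i (x i)) J
      = finprod T (\<lambda>i. tensor_in R I A i (x i)) (insert j J)"
    by (subst T.finprod_insert) (use insert.hyps j closed in \<open>auto simp: tensor_in_def\<close>)
  finally show ?case .
qed

text \<open>
The factors generate the tensor product.
\<close>

lemma tensor_alg_hom_eqI: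
  assumes N: "algebra R N" and h: "h \<in> alg_hom R T N" and k: "k \<in> alg_hom R T N"
    and eq: "\<And>i a. i \<in> I \<Longrightarrow> a \<in> carrier (A i) \<Longrightarrow> h (tensor_in R I A i a) = k (tensor_in R I A i a)"
    and z: "z \<in> carrier T"
  shows "h z = k z"
proof -
  interpret N: algebra R N by (rule N)
  have pure: "h (pure_tensor x) = k (pure_tensor x)" if x: "x \<in> carrier P" for x
  proof -
    let ?J = "support x"
    have fin: "finite ?J" by (rule P_D(3)[OF x])
    have pt: "pure_tensor x = finprod T (\<lambda>i. tensor_in R I A i (x i)) ?J"
      by (rule pure_tensor_eq_finprod[OF fin _ x]) auto
    have closed: "(\<lambda>i. tensor_in R I A i (x i)) \<in> ?J \<rightarrow> carrier T"
      using P_D(1)[OF x] by (auto intro: alg_homD(1)[OF tensor_in_alg_hom])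
    have "finprod N (\<lambda>i. h (tensor_in R I A i (x i))) ?J = finprod N (\<lambda>i. k (tensor_in R I A i (x i))) ?J"
      by (rule N.finprod_cong'[OF refl])
        (use closed eq P_D(1)[OF x] in \<open>auto intro!: alg_homD(1)[OF k]\<close>)
    then show ?thesis
      unfolding pt alg_hom_finprod[OF tensor_algebra_algebra N h closed fin]
        alg_hom_finprod[OF tensor_algebra_algebra N k closed fin] .
  qed
  obtain f where f: "f \<in> carrier MP" "z = tensor_ideal R I A +>\<^bsub>MP\<^esub> f"
    using z unfolding tensor_algebra_def quot_algebra_simps(1)[OF MP_algebra tensor_ideal_ideal] by blast
  have "h (tensor_ideal R I A +>\<^bsub>MP\<^esub> f) = k (tensor_ideal R I A +>\<^bsub>MP\<^esub> f)"
    by (rule free_alg_hom_eqI[OF MP_algebra alg_hom_comp[OF tensor_quot_map h]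
          alg_hom_comp[OF tensor_quot_map k] N pure f(1)])
  with f(2) show ?thesis by simp
qed

text \<open>
The tensor product is the coproduct of commutative algebras: homomorphisms out of the factors are
combined by multiplying their values.
\<close>

lemma tensor_alg_hom_exists:
  assumes N: "algebra R N" and \<kappa>: "\<And>i. i \<in> I \<Longrightarrow> \<kappa> i \<in> alg_hom R (A i) N"
  shows "\<exists>h \<in> alg_hom R T N. \<forall>i \<in> I. \<forall>a \<in> carrier (A i). h (tensor_in R I A i a) = \<kappa> i a"
proof -
  interpret N: algebra R N by (rule N)
  interpret MP: algebra R MP by (rule MP_algebra)
  define f where "f x = finprod N (\<lambda>i. \<kappa> i (x i)) (support x)" for x
  have \<kappa>_closed: "\<kappa> i (x i) \<in> carrier N" if "x \<in> carrier P" "i \<in> I" for x i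
    by (rule alg_homD(1)[OF \<kappa>[OF that(2)] P_D(1)[OF that]])
  have f_eq: "f x = finprod N (\<lambda>i. \<kappa> i (x i)) J"
    if "x \<in> carrier P" "finite J" "J \<subseteq> I" "support x \<subseteq> J" for x J
    unfolding f_def
  proof (rule N.finprod_mono_neutral_cong_left[OF that(2,4)])
    fix i assume "i \<in> J - support x"
    with that(3) have "i \<in> I" "x i = \<one>\<^bsub>A i\<^esub>" by auto
    then show "\<kappa> i (x i) = \<one>\<^bsub>N\<^esub>" using alg_homD(4)[OF \<kappa>] by simp
  qed (use \<kappa>_closed[OF that(1)] that(3) in auto)
  have f_closed: "f x \<in> carrier N" if "x \<in> carrier P" for x
    unfolding f_def using \<kappa>_closed[OF that] by (intro N.finprod_closed) auto
  have f_upd: "f (x(i := a)) = \<kappa> i a \<otimes>\<^bsub>N\<^esub> finprod N (\<lambda>i. \<kappa> i (x i)) (support x - {i})"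
    and rest_closed: "finprod N (\<lambda>i. \<kappa> i (x i)) (support x - {i}) \<in> carrier N"
    if x: "x \<in> carrier P" and i: "i \<in> I" and a: "a \<in> carrier (A i)" for x i a
  proof -
    let ?J = "support x - {i}"
    have J: "finite ?J" "?J \<subseteq> I" "i \<notin> ?J" using P_D(3)[OF x] by auto
    have closed: "(\<lambda>i. \<kappa> i (x i)) \<in> ?J \<rightarrow> carrier N" using \<kappa>_closed[OF x] by auto
    then show "finprod N (\<lambda>i. \<kappa> i (x i)) ?J \<in> carrier N" by (rule N.finprod_closed)
    have "f (x(i := a)) = finprod N (\<lambda>j. \<kappa> j ((x(i := a)) j)) (insert i ?J)"
      by (rule f_eq[OF upd_closed[OF x i a]]) (use J i in auto)
    also have "\<dots> = \<kappa> i ((x(i := a)) i) \<otimes>\<^bsub>N\<^esub> finprod N (\<lambda>j. \<kappa> j ((x(i := a)) j)) ?J"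
      by (rule N.finprod_insert[OF J(1,3)]) (use \<kappa>_closed[OF upd_closed[OF x i a]] J(2) i alg_homD(1)[OF \<kappa>[OF i] a] in auto)
    also have "finprod N (\<lambda>j. \<kappa> j ((x(i := a)) j)) ?J = finprod N (\<lambda>j. \<kappa> j (x j)) ?J"
      by (rule N.finprod_cong'[OF refl closed]) auto
    finally show "f (x(i := a)) = \<kappa> i a \<otimes>\<^bsub>N\<^esub> finprod N (\<lambda>i. \<kappa> i (x i)) ?J" by (simp only: fun_upd_same)
  qed
  let ?h = "linear_extension R N f"
  have h: "?h \<in> alg_hom R MP N"
  proof (rule linear_extension_alg_hom[OF N P_comm_monoid f_closed])
    show "f \<one>\<^bsub>P\<^esub> = \<one>\<^bsub>N\<^esub>" using f_eq[OF one_P_closed, of "{}"] by (simp add: one_P)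
    fix x y assume x: "x \<in> carrier P" and y: "y \<in> carrier P"
    let ?J = "support x \<union> support y"
    have J: "finite ?J" "?J \<subseteq> I" using P_D(3)[OF x] P_D(3)[OF y] by auto
    have xy: "x \<otimes>\<^bsub>P\<^esub> y \<in> carrier P" by (rule monoid.m_closed[OF comm_monoid.axioms(1)[OF P_comm_monoid] x y])
    have one: "\<one>\<^bsub>A i\<^esub> \<otimes>\<^bsub>A i\<^esub> \<one>\<^bsub>A i\<^esub> = \<one>\<^bsub>A i\<^esub>" if "i \<in> I" for i
      by (rule monoid.l_one[OF comm_monoid.axioms(1)[OF factor_monoid[OF that]] factor_closed(1)[OF that]])
    have "f (x \<otimes>\<^bsub>P\<^esub> y) = finprod N (\<lambda>i. \<kappa> i ((x \<otimes>\<^bsub>P\<^esub> y) i)) ?J"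
      by (rule f_eq[OF xy J]) (use one in \<open>auto simp: restricted_product_simps(2)\<close>)
    also have "\<dots> = finprod N (\<lambda>i. \<kappa> i (x i) \<otimes>\<^bsub>N\<^esub> \<kappa> i (y i)) ?J"
    proof (rule N.finprod_cong'[OF refl])
      show "(\<lambda>i. \<kappa> i (x i) \<otimes>\<^bsub>N\<^esub> \<kappa> i (y i)) \<in> ?J \<rightarrow> carrier N"
        using \<kappa>_closed[OF x] \<kappa>_closed[OF y] by auto
      fix i assume "i \<in> ?J"
      then have i: "i \<in> I" by blast
      show "\<kappa> i ((x \<otimes>\<^bsub>P\<^esub> y) i) = \<kappa> i (x i) \<otimes>\<^bsub>N\<^esub> \<kappa> i (y i)"
        using alg_homD(2)[OF \<kappa>[OF i] P_D(1)[OF x i] P_D(1)[OF y i]] i by (simp add: restricted_product_simps(2))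
    qed
    also have "\<dots> = finprod N (\<lambda>i. \<kappa> i (x i)) ?J \<otimes>\<^bsub>N\<^esub> finprod N (\<lambda>i. \<kappa> i (y i)) ?J"
      by (rule N.finprod_multf) (use \<kappa>_closed[OF x] \<kappa>_closed[OF y] in auto)
    also have "\<dots> = f x \<otimes>\<^bsub>N\<^esub> f y" using f_eq[OF x J] f_eq[OF y J] by simp
    finally show "f (x \<otimes>\<^bsub>P\<^esub> y) = f x \<otimes>\<^bsub>N\<^esub> f y" .
  qed
  have h_gen: "?h (free_gen R x) = f x" if "x \<in> carrier P" for x
    by (rule linear_extension_gen[OF N _ that]) (rule f_closed)
  have h_ideal: "?h r = \<zero>\<^bsub>N\<^esub>" if r: "r \<in> tensor_ideal R I A" for r
  proof (rule alg_hom_genideal_zero[OF MP_algebra N h tensor_rels_closed _ r[unfolded tensor_ideal_def]])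
    fix r assume "r \<in> tensor_rels R I A"
    then consider x i a b where "r = free_gen R (x(i := a \<oplus>\<^bsub>A i\<^esub> b)) \<ominus>\<^bsub>MP\<^esub> (free_gen R (x(i := a)) \<oplus>\<^bsub>MP\<^esub> free_gen R (x(i := b)))"
        "x \<in> carrier P" "i \<in> I" "a \<in> carrier (A i)" "b \<in> carrier (A i)"
      | x i c a where "r = free_gen R (x(i := c \<odot>\<^bsub>A i\<^esub> a)) \<ominus>\<^bsub>MP\<^esub> c \<odot>\<^bsub>MP\<^esub> free_gen R (x(i := a))"
        "x \<in> carrier P" "i \<in> I" "c \<in> carrier R" "a \<in> carrier (A i)"
      unfolding tensor_rels_def Let_def by blast
    then show "?h r = \<zero>\<^bsub>N\<^esub>"
    proof cases
      case 1
      note upd = upd_closed[OF 1(2,3)] and gen = gen_MP[OF upd_closed[OF 1(2,3)]]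
      have ab: "a \<oplus>\<^bsub>A i\<^esub> b \<in> carrier (A i)" by (rule factor_closed(3)[OF 1(3-5)])
      have \<kappa>ab: "\<kappa> i a \<in> carrier N" "\<kappa> i b \<in> carrier N" by (rule alg_homD(1)[OF \<kappa>[OF 1(3)]], fact)+
      have "?h r = f (x(i := a \<oplus>\<^bsub>A i\<^esub> b)) \<ominus>\<^bsub>N\<^esub> (f (x(i := a)) \<oplus>\<^bsub>N\<^esub> f (x(i := b)))"
        unfolding 1(1) alg_hom_minus[OF MP_algebra N h gen[OF ab] MP.M.add.m_closed[OF gen[OF 1(4)] gen[OF 1(5)]]]
          alg_homD(3)[OF h gen[OF 1(4)] gen[OF 1(5)]]
        by (simp only: h_gen upd ab 1(4,5))
      also have "f (x(i := a \<oplus>\<^bsub>A i\<^esub> b)) = f (x(i := a)) \<oplus>\<^bsub>N\<^esub> f (x(i := b))"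
        unfolding f_upd[OF 1(2,3) ab] f_upd[OF 1(2,3,4)] f_upd[OF 1(2,3,5)] alg_homD(3)[OF \<kappa>[OF 1(3)] 1(4,5)]
        by (rule N.l_distr[OF \<kappa>ab rest_closed[OF 1(2-4)]])
      finally show ?thesis
        by (simp only: N.minus_eq
            N.M.r_neg[OF N.M.add.m_closed[OF f_closed[OF upd[OF 1(4)]] f_closed[OF upd[OF 1(5)]]]])
    next
      case 2
      note upd = upd_closed[OF 2(2,3)] and gen = gen_MP[OF upd_closed[OF 2(2,3)]]
      have ca: "c \<odot>\<^bsub>A i\<^esub> a \<in> carrier (A i)" by (rule factor_closed(4)[OF 2(3-5)])
      have \<kappa>a: "\<kappa> i a \<in> carrier N" by (rule alg_homD(1)[OF \<kappa>[OF 2(3)] 2(5)])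
      have "?h r = f (x(i := c \<odot>\<^bsub>A i\<^esub> a)) \<ominus>\<^bsub>N\<^esub> c \<odot>\<^bsub>N\<^esub> f (x(i := a))"
        unfolding 2(1) alg_hom_minus[OF MP_algebra N h gen[OF ca] MP.smult_closed[OF 2(4) gen[OF 2(5)]]]
          alg_homD(5)[OF h 2(4) gen[OF 2(5)]]
        by (simp only: h_gen upd ca 2(5))
      also have "f (x(i := c \<odot>\<^bsub>A i\<^esub> a)) = c \<odot>\<^bsub>N\<^esub> f (x(i := a))"
        unfolding f_upd[OF 2(2,3) ca] f_upd[OF 2(2,3,5)] alg_homD(5)[OF \<kappa>[OF 2(3)] 2(4,5)]
        by (rule N.smult_assoc2[OF 2(4) \<kappa>a rest_closed[OF 2(2,3,5)]])
      finally show ?thesis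
        by (simp only: N.minus_eq N.M.r_neg[OF N.smult_closed[OF 2(4) f_closed[OF upd[OF 2(5)]]]])
    qed
  qed
  obtain k where k: "k \<in> alg_hom R T N" "\<And>x. x \<in> carrier MP \<Longrightarrow> k (tensor_ideal R I A +>\<^bsub>MP\<^esub> x) = ?h x"
    unfolding tensor_algebra_def
    by (rule quot_alg_hom_lift[OF MP_algebra tensor_ideal_ideal N h h_ideal], assumption,
        rule that[unfolded tensor_algebra_def])
  have "k (tensor_in R I A i a) = \<kappa> i a" if i: "i \<in> I" and a: "a \<in> carrier (A i)" for i a
  proof -
    have "k (tensor_in R I A i a) = f (\<one>\<^bsub>P\<^esub>(i := a))"
      unfolding tensor_in_def k(2)[OF gen_MP[OF upd_closed[OF one_P_closed i a]]]
      by (rule h_gen[OF upd_closed[OF one_P_closed i a]])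
    also have "\<dots> = \<kappa> i a"
    proof -
      have "support \<one>\<^bsub>P\<^esub> - {i} = {}" using one_P by blast
      then show ?thesis
        unfolding f_upd[OF one_P_closed i a]
        by (simp only: N.finprod_empty N.r_one alg_homD(1)[OF \<kappa>[OF i] a])
    qed
    finally show ?thesis .
  qed
  with k(1) show ?thesis by blast
qed

end

text \<open>
The map in each direction comes from a universal property. The two composites fix the variables and
the elements of the single factors, respectively, and these generate.
\<close>

theorem truncated_poly_iso_tensor:
  fixes R :: "('k, 'c) ring_scheme" and X :: "'x set" and p :: nat
  assumes R: "cring R"
  defines "A \<equiv> \<lambda>w. truncated_poly R p {w}"
  shows "\<exists>h. h \<in> alg_iso R (truncated_poly R p X) (tensor_algebra R X A) \<and>
    (\<forall>w \<in> X. h (truncated_var R p X w) = tensor_in R X A w (truncated_var R p {w} w))"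
proof -
  interpret algebra_family R X A
    by (intro algebra_family.intro algebra_family_axioms.intro R, unfold A_def) (rule truncated_poly_algebra[OF R])
  let ?Q = "truncated_poly R p X"
  have Q: "algebra R ?Q" by (rule truncated_poly_algebra[OF R])
  have T: "algebra R T" by (rule tensor_algebra_algebra)
  have A: "algebra R (A w)" for w unfolding A_def by (rule truncated_poly_algebra[OF R])
  have v: "truncated_var R p {w} w \<in> carrier (A w)" for w
    unfolding A_def by (rule truncated_var_closed[OF R]) simp
  define g where "g w = tensor_in R X A w (truncated_var R p {w} w)" for w
  have g: "g w \<in> carrier T" if "w \<in> X" for w
    unfolding g_def by (rule alg_homD(1)[OF tensor_in_alg_hom[OF that] v])
  have g_pow: "g w [^]\<^bsub>T\<^esub> p = \<zero>\<^bsub>T\<^esub>" if w: "w \<in> X" for w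
  proof -
    have "g w [^]\<^bsub>T\<^esub> p = tensor_in R X A w (truncated_var R p {w} w [^]\<^bsub>A w\<^esub> p)"
      unfolding g_def by (rule alg_hom_pow[OF A T tensor_in_alg_hom[OF w] v, symmetric])
    also have "truncated_var R p {w} w [^]\<^bsub>A w\<^esub> p = \<zero>\<^bsub>A w\<^esub>"
      unfolding A_def by (rule truncated_var_pow[OF R]) simp
    also have "tensor_in R X A w \<zero>\<^bsub>A w\<^esub> = \<zero>\<^bsub>T\<^esub>"
      by (rule alg_hom_zero[OF A T tensor_in_alg_hom[OF w]])
    finally show ?thesis .
  qed
  obtain h where h: "h \<in> alg_hom R ?Q T" "\<And>w. w \<in> X \<Longrightarrow> h (truncated_var R p X w) = g w"
    by (rule truncated_alg_hom_exists[of R T X g p, OF T g g_pow], assumption, assumption, rule that)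
  have "\<exists>\<kappa>. \<kappa> \<in> alg_hom R (A w) ?Q \<and> \<kappa> (truncated_var R p {w} w) = truncated_var R p X w" if w: "w \<in> X" for w
  proof -
    have "truncated_var R p X x \<in> carrier ?Q" "truncated_var R p X x [^]\<^bsub>?Q\<^esub> p = \<zero>\<^bsub>?Q\<^esub>" if "x \<in> {w}" for x
      using that w by (simp_all add: truncated_var_closed[OF R] truncated_var_pow[OF R])
    from truncated_alg_hom_exists[of R ?Q "{w}" "truncated_var R p X" p, OF Q this]
    show ?thesis unfolding A_def by (metis singletonI)
  qed
  then obtain \<kappa> where \<kappa>: "\<And>w. w \<in> X \<Longrightarrow> \<kappa> w \<in> alg_hom R (A w) ?Q"
    "\<And>w. w \<in> X \<Longrightarrow> \<kappa> w (truncated_var R p {w} w) = truncated_var R p X w" by metis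
  obtain k where k: "k \<in> alg_hom R T ?Q"
    "\<And>w a. w \<in> X \<Longrightarrow> a \<in> carrier (A w) \<Longrightarrow> k (tensor_in R X A w a) = \<kappa> w a"
    using tensor_alg_hom_exists[OF Q \<kappa>(1)] by blast
  have id_hom: "(\<lambda>x. x) \<in> alg_hom R N N" for N :: "('k, 'n, 'm) module_scheme" by (rule alg_homI) auto
  have "h \<in> alg_iso R ?Q T"
  proof (rule alg_isoI[OF h(1) k(1)])
    fix x assume x: "x \<in> carrier ?Q"
    show "k (h x) = x"
      by (rule truncated_alg_hom_eqI[OF R Q alg_hom_comp[OF h(1) k(1)] id_hom _ x])
        (simp add: h(2) g_def k(2) v \<kappa>(2))
  next
    fix y assume y: "y \<in> carrier T"
    show "h (k y) = y"
    proof (rule tensor_alg_hom_eqI[OF T alg_hom_comp[OF k(1) h(1)] id_hom _ y])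
      fix w a assume w: "w \<in> X" and a: "a \<in> carrier (A w)"
      have "h (\<kappa> w a) = tensor_in R X A w a"
      proof (rule truncated_alg_hom_eqI[OF R T alg_hom_comp[OF \<kappa>(1)[OF w, unfolded A_def] h(1)]
            tensor_in_alg_hom[OF w, unfolded A_def, folded A_def] _ a[unfolded A_def]])
        fix x assume "x \<in> {w}"
        then show "h (\<kappa> w (truncated_var R p {w} x)) = tensor_in R X A w (truncated_var R p {w} x)"
          using h(2)[OF w] \<kappa>(2)[OF w] by (simp add: g_def)
      qed
      then show "h (k (tensor_in R X A w a)) = tensor_in R X A w a" by (simp only: k(2)[OF w a])
    qed
  qed
  with h(2) show ?thesis unfolding g_def by blast
qed

section \<open>The structure of the shuffle algebra\<close>

theorem theorem3p7:
  fixes p :: nat and S :: "'s::linorder set"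
  assumes "Factorial_Ring.prime p" and "finite S"
  shows "let F = residue_ring (int p); X = TL p S;
             A = (\<lambda>w. truncated_poly F p {w}) in
    (\<exists>h. h \<in> alg_iso F (shuffle_algebra F S) (truncated_poly F p X)) \<and>
    (\<exists>h. h \<in> alg_iso F (truncated_poly F p X) (tensor_algebra F X A) \<and>
      (\<forall>w \<in> X. h (truncated_var F p X w) = tensor_in F X A w (truncated_var F p {w} w)))"
proof -
  interpret lyndon_shuffle p S "residue_ring (int p)"
    using assms by unfold_locales
  have "\<exists>h. h \<in> alg_iso (residue_ring (int p)) (shuffle_algebra (residue_ring (int p)) S)
      (truncated_poly (residue_ring (int p)) p (TL p S))"
    unfolding shuffle_algebra_def by (rule shuffle_iso_truncated_poly)
  then show ?thesis
    unfolding Let_def by (rule conjI[OF _ truncated_poly_iso_tensor[OF is_cring]])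
qed

end
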